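(* The $L^2$-zeta function $Z_\pi(u)$ of the grid (the Cayley graph of $\mathbb{Z}\times\mathbb{Z}$ with its standard generators) is not an elementary function.
   Context: Let $X$ be the Cayley graph of $\pi=\mathbb{Z}\times\mathbb{Z}=\langle a\rangle\times\langle b\rangle$ with generators $\{a,b\}$. Let $\mathcal{P}$ be the set of primitive closed paths in $X$ without backtracking, taken up to cyclic equivalence (primitive: not a shorter closed path repeated several times); $\pi$ acts freely on $\mathcal{P}$. The $L^2$-zeta function is $Z_\pi(u)=\prod_{\gamma\in\mathcal{P}/\pi}(1-u^{\mathrm{len}(\gamma)})^{-1}$, convergent for small $u$. It satisfies $Z_\pi(u)^{-1}=(1-u^2)\det_\pi\Delta_u$, where $\Delta_u=I-(a+a^{-1}+b+b^{-1})u+3u^2$ on $\ell^2(\mathbb{Z}^2)$ and $\log\det_\pi\Delta_u=\frac{1}{(2\pi)^2}\int_0^{2\pi}\int_0^{2\pi}\log(1+3u^2-2u\cos t-2u\cos s)\,ds\,dt$; this formula continues $Z_\pi$ analytically to the component $\Omega$ containing $0$ of $\mathbb{C}\setminus(\{|u|=1/\sqrt3\}\cup[-1,-1/3]\cup[1/3,1])$. An elementary function is one obtained from the variable by finitely many algebraic operations, logarithms and exponentials. *)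

theory Defs
  imports "HOL-Complex_Analysis.Complex_Analysis"
begin

definition cayley_adj :: "'g::group_add set \<Rightarrow> 'g \<Rightarrow> 'g \<Rightarrow> bool" where
  "cayley_adj S x y \<longleftrightarrow> (\<exists>s\<in>S. y = x + s \<or> x = y + s)"

definition grid_adj :: "int \<times> int \<Rightarrow> int \<times> int \<Rightarrow> bool" where
  "grid_adj = cayley_adj {(1, 0), (0, 1)}"

text \<open>
  The grid has neither loops nor multiple edges, so a closed path
  \<open>v\<^sub>0, v\<^sub>1, \<dots>, v\<^sub>n\<^sub>-\<^sub>1, v\<^sub>n = v\<^sub>0\<close> of length \<open>n > 0\<close> is given by the list
  \<open>[v\<^sub>0, \<dots>, v\<^sub>n\<^sub>-\<^sub>1]\<close> of its vertices. As closed paths are considered up to a change of the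
  starting point, backtracking is excluded at the starting point too (indices modulo \<open>n\<close>).
  A path and its inverse are not identified.
\<close>

definition closed_path :: "(int \<times> int) list \<Rightarrow> bool" where
  "closed_path vs \<longleftrightarrow>
     vs \<noteq> [] \<and> (\<forall>i<length vs. grid_adj (vs ! i) (vs ! ((i + 1) mod length vs)))"

definition backtracking :: "'a list \<Rightarrow> bool" where
  "backtracking vs \<longleftrightarrow> (\<exists>i<length vs. vs ! i = vs ! ((i + 2) mod length vs))"

definition primitive_path :: "'a list \<Rightarrow> bool" where
  "primitive_path vs \<longleftrightarrow> \<not> (\<exists>ws k. k \<ge> 2 \<and> vs = concat (replicate k ws))"

definition cyclic_class :: "'a list \<Rightarrow> 'a list set" where
  "cyclic_class vs = range (\<lambda>k. rotate k vs)"

definition grid_primes :: "(int \<times> int) list set set" where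
  "grid_primes = cyclic_class ` {vs. closed_path vs \<and> \<not> backtracking vs \<and> primitive_path vs}"

definition translate :: "'g::group_add \<Rightarrow> 'g list set \<Rightarrow> 'g list set" where
  "translate g C = map ((+) g) ` C"

definition translation_orbit :: "'g::group_add list set \<Rightarrow> 'g list set set" where
  "translation_orbit C = range (\<lambda>g. translate g C)"

definition grid_prime_orbits :: "(int \<times> int) list set set set" where
  "grid_prime_orbits = translation_orbit ` grid_primes"

definition orbit_length :: "'a list set set \<Rightarrow> nat" where
  "orbit_length \<C> = (THE n. \<exists>C\<in>\<C>. \<exists>vs\<in>C. length vs = n)"

lemma orbit_length_translation_orbit:
  "orbit_length (translation_orbit (cyclic_class vs)) = length vs"
  unfolding orbit_length_def translation_orbit_def translate_def cyclic_class_def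
  by (rule the_equality) auto

definition has_grid_euler_product :: "complex \<Rightarrow> complex \<Rightarrow> bool" where
  "has_grid_euler_product u z \<longleftrightarrow>
     ((\<lambda>F. \<Prod>\<gamma>\<in>F. inverse (1 - u ^ orbit_length \<gamma>)) \<longlongrightarrow> z)
       (finite_subsets_at_top grid_prime_orbits)"

definition grid_zeta_domain :: "complex set" where
  "grid_zeta_domain =
     connected_component_set
       (- (sphere 0 (1 / sqrt 3) \<union> complex_of_real ` {-1..-1/3} \<union> complex_of_real ` {1/3..1})) 0"

definition is_grid_zeta :: "(complex \<Rightarrow> complex) \<Rightarrow> bool" where
  "is_grid_zeta Z \<longleftrightarrow>
     Z holomorphic_on grid_zeta_domain \<and> (\<forall>\<^sub>F u in nhds 0. has_grid_euler_product u (Z u))"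

text \<open>Only the values on \<open>grid_zeta_domain\<close> are meaningful; there they are determined
  uniquely, see below.\<close>

definition grid_zeta :: "complex \<Rightarrow> complex" where
  "grid_zeta = (SOME Z. is_grid_zeta Z)"

lemma grid_zeta_domain:
  "open grid_zeta_domain" "connected grid_zeta_domain" "0 \<in> grid_zeta_domain"
proof -
  let ?S = "- (sphere 0 (1 / sqrt 3) \<union> complex_of_real ` {-1..-1/3} \<union> complex_of_real ` {1/3..1})"
  have "compact (complex_of_real ` {a..b})" for a b
    by (intro compact_continuous_image continuous_intros compact_Icc)
  then have "open ?S"
    by (intro open_Compl closed_Un closed_sphere) (auto intro: compact_imp_closed)
  then show "open grid_zeta_domain"
    unfolding grid_zeta_domain_def by (rule open_connected_component)
  show "connected grid_zeta_domain"
    unfolding grid_zeta_domain_def by (rule connected_connected_component)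
  have "0 \<in> ?S"
    by auto
  then show "0 \<in> grid_zeta_domain"
    unfolding grid_zeta_domain_def by simp
qed

lemma is_grid_zeta_unique:
  assumes "is_grid_zeta Z" "is_grid_zeta Z'" "u \<in> grid_zeta_domain"
  shows "Z u = Z' u"
proof -
  have "\<forall>\<^sub>F u in nhds 0. has_grid_euler_product u (Z u)"
    "\<forall>\<^sub>F u in nhds 0. has_grid_euler_product u (Z' u)"
    using assms(1,2) by (auto simp: is_grid_zeta_def)
  then have "\<forall>\<^sub>F u in nhds 0. Z u = Z' u"
    by eventually_elim
      (metis has_grid_euler_product_def tendsto_unique finite_subsets_at_top_neq_bot)
  then obtain V where V: "open V" "0 \<in> V" "\<And>u. u \<in> V \<Longrightarrow> Z u = Z' u"
    unfolding eventually_nhds by blast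
  show ?thesis
  proof (rule analytic_continuation_open[where s = "V \<inter> grid_zeta_domain" and s' = grid_zeta_domain
        and f = Z and g = Z' and z = u])
    show "V \<inter> grid_zeta_domain \<noteq> {}" "open (V \<inter> grid_zeta_domain)"
      using V grid_zeta_domain by auto
  qed (use V assms grid_zeta_domain in \<open>auto simp: is_grid_zeta_def\<close>)
qed

text \<open>
  \<open>elementary_on U\<close> consists of the single-valued branches, holomorphic on the domain \<open>U\<close>, that
  are built from the variable and complex constants. A logarithm of \<open>f\<close> is any holomorphic
  branch \<open>g\<close> with \<open>exp \<circ> g = f\<close>; besides the field operations, an algebraic operation is the
  solution of a nontrivial polynomial equation, which covers in particular all radicals.
\<close>

inductive_set elementary_on :: "complex set \<Rightarrow> (complex \<Rightarrow> complex) set" for U where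
  var: "(\<lambda>z. z) \<in> elementary_on U"
| const: "(\<lambda>z. c) \<in> elementary_on U"
| add: "f \<in> elementary_on U \<Longrightarrow> g \<in> elementary_on U \<Longrightarrow> (\<lambda>z. f z + g z) \<in> elementary_on U"
| diff: "f \<in> elementary_on U \<Longrightarrow> g \<in> elementary_on U \<Longrightarrow> (\<lambda>z. f z - g z) \<in> elementary_on U"
| mult: "f \<in> elementary_on U \<Longrightarrow> g \<in> elementary_on U \<Longrightarrow> (\<lambda>z. f z * g z) \<in> elementary_on U"
| divide: "f \<in> elementary_on U \<Longrightarrow> g \<in> elementary_on U \<Longrightarrow> \<forall>z\<in>U. g z \<noteq> 0 \<Longrightarrow>
    (\<lambda>z. f z / g z) \<in> elementary_on U"
| algebraic: "(\<And>i. i \<le> n \<Longrightarrow> a i \<in> elementary_on U) \<Longrightarrow> \<exists>z\<in>U. a n z \<noteq> 0 \<Longrightarrow>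
    g holomorphic_on U \<Longrightarrow> \<forall>z\<in>U. (\<Sum>i\<le>n. a i z * g z ^ i) = 0 \<Longrightarrow> g \<in> elementary_on U"
| exp: "f \<in> elementary_on U \<Longrightarrow> (\<lambda>z. exp (f z)) \<in> elementary_on U"
| log: "f \<in> elementary_on U \<Longrightarrow> g holomorphic_on U \<Longrightarrow> \<forall>z\<in>U. exp (g z) = f z \<Longrightarrow>
    g \<in> elementary_on U"

text \<open>
  The intermediate functions in an expression for an analytic function on \<open>S\<close> may have poles
  and branch points inside \<open>S\<close> even if the function itself has none. Hence only some
  subdomain \<open>U\<close> of \<open>S\<close> is required to carry single-valued branches of all of them; on the
  rest of \<open>S\<close> the expression then represents the function by analytic continuation.
\<close>

definition elementary_function :: "complex set \<Rightarrow> (complex \<Rightarrow> complex) \<Rightarrow> bool" where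
  "elementary_function S f \<longleftrightarrow>
     (\<exists>U. open U \<and> connected U \<and> U \<noteq> {} \<and> U \<subseteq> S \<and> f \<in> elementary_on U)"

end

theory Submission
  imports Defs
    "HOL-Computational_Algebra.Polynomial_Factorial"
    "HOL-Computational_Algebra.Field_as_Ring"
begin

text \<open>
  Counting cyclically reduced words through free reduction of arbitrary closed walks on the grid
  turns the Euler product into
  \<open>u Z' / Z = (1 - 3 u\<^sup>2) (h(k) / (1 + 3 u\<^sup>2) - 1 / (1 - u\<^sup>2))\<close> with \<open>k = 16 u\<^sup>2 / (1 + 3 u\<^sup>2)\<^sup>2\<close> and
  \<open>h(k) = \<Sum>\<^sub>n (2n choose n)\<^sup>2 (k / 16)\<^sup>n\<close>, a complete elliptic integral. If \<open>Z\<close> were elementary, \<open>h\<close> would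
  lie in a Liouville tower over the algebraic functions, and then so would the solution \<open>h' / h\<close> of
  the Riccati equation attached to the hypergeometric equation of \<open>h\<close>.

  Such solutions descend the tower: on the field generated by one exponential or primitive \<open>t\<close>, the
  derivation \<open>t d/dt\<close> or \<open>d/dt\<close> commutes with the given one, hence acts on the set of
  solutions, and it has a fixed point there that is free of \<open>t\<close>. So some solution is algebraic over
  \<open>\<complex>(k)\<close>. Near \<open>k = 0\<close> every other solution involves \<open>log k\<close>, so all conjugates of the algebraic
  solution coincide with \<open>h' / h\<close>, which is therefore a rational function. Comparing degrees shows
  that the equation has no rational solution.
\<close>

section \<open>Subfields and algebraic closure\<close>

text \<open>All fields are subsets of the Laurent series at one point \<open>z0\<close> of the
  domain on which the elementary expression is single-valued, so closures and adjunctions are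
  relative to one ambient field. The obstacle is that \<open>z0\<close> cannot be chosen, whereas
  the logarithm that excludes algebraic solutions is visible only at \<open>k = 0\<close>. The
  bridge is an identity between polynomials over \<complex>[k]: an algebraic solution near
  \<open>z0\<close> yields a polynomial invariant under the Riccati vector field, and its
  coefficients can be expanded at \<open>k = 0\<close> just as well. The Riccati equation replaces
  the linear one because its solutions form a one-parameter family on which a commuting derivation
  acts by Moebius transformations; a fixed point costs only a square root of a constant. The
  parameter \<open>k\<close> comes from a resolvent: reduced words are governed by
  \<open>1 - u A + 3 u^2\<close> with \<open>A\<close> the adjacency operator, so they are counted
  by arbitrary walks with weight \<open>y = u / (1 + 3 u^2)\<close> per step. There are
  \<open>(2n choose n)^2\<close> closed walks of length \<open>2 n\<close>, whence
  \<open>k = 16 y^2\<close>.\<close>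

locale subfield_set =
  fixes F :: "'a::field_char_0 set"
  assumes one_in: "1 \<in> F"
    and diff_in: "x \<in> F \<Longrightarrow> y \<in> F \<Longrightarrow> x - y \<in> F"
    and mult_in: "x \<in> F \<Longrightarrow> y \<in> F \<Longrightarrow> x * y \<in> F"
    and inverse_in: "x \<in> F \<Longrightarrow> inverse x \<in> F"
begin

lemma zero_in: "0 \<in> F"
  using diff_in[OF one_in one_in] by simp

lemma uminus_in: "x \<in> F \<Longrightarrow> - x \<in> F"
  using diff_in[OF zero_in, of x] by simp

lemma add_in: "x \<in> F \<Longrightarrow> y \<in> F \<Longrightarrow> x + y \<in> F"
  using diff_in[of x "- y"] uminus_in[of y] by simp

lemma divide_in: "x \<in> F \<Longrightarrow> y \<in> F \<Longrightarrow> x / y \<in> F"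
  by (simp add: divide_inverse mult_in inverse_in)

lemma power_in: "x \<in> F \<Longrightarrow> x ^ n \<in> F"
  by (induction n) (auto intro: one_in mult_in)

lemma of_nat_in: "of_nat n \<in> F"
  by (induction n) (auto intro: one_in zero_in add_in)

lemma numeral_in: "numeral n \<in> F"
  using of_nat_in[of "numeral n"] by simp

lemma sum_in: "(\<And>i. i \<in> I \<Longrightarrow> f i \<in> F) \<Longrightarrow> sum f I \<in> F"
  by (induction I rule: infinite_finite_induct) (auto intro: zero_in add_in)

lemmas closed_in = one_in zero_in uminus_in add_in diff_in mult_in inverse_in divide_in power_in
  of_nat_in numeral_in

end

section \<open>Polynomials over a subfield, adjunction and relative algebraic closure\<close>

definition polys :: "'a::zero set \<Rightarrow> 'a poly set" where
  "polys F = {p. \<forall>i. coeff p i \<in> F}"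

text \<open>Relative to the ambient field: only elements of the type itself are considered. Hence
  \<open>alg_cl F = F\<close> does not make \<open>F\<close> algebraically closed in the absolute
  sense.\<close>

definition alg_cl :: "'a::field set \<Rightarrow> 'a set" where
  "alg_cl F = {x. \<exists>p\<in>polys F. p \<noteq> 0 \<and> poly p x = 0}"

definition adjoin :: "'a::field set \<Rightarrow> 'a \<Rightarrow> 'a set" where
  "adjoin F x = {poly p x / poly q x | p q. p \<in> polys F \<and> q \<in> polys F \<and> poly q x \<noteq> 0}"

lemma polys_coeff: "p \<in> polys F \<Longrightarrow> coeff p i \<in> F"
  by (simp add: polys_def)

lemma polys_mono: "F \<subseteq> G \<Longrightarrow> polys F \<subseteq> polys G"
  by (auto simp: polys_def)

context subfield_set
begin

lemma polys_0: "0 \<in> polys F"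
  by (auto simp: polys_def zero_in)

lemma polys_add: "p \<in> polys F \<Longrightarrow> q \<in> polys F \<Longrightarrow> p + q \<in> polys F"
  by (auto simp: polys_def add_in)

lemma polys_diff: "p \<in> polys F \<Longrightarrow> q \<in> polys F \<Longrightarrow> p - q \<in> polys F"
  by (auto simp: polys_def diff_in)

lemma polys_pCons: "a \<in> F \<Longrightarrow> p \<in> polys F \<Longrightarrow> pCons a p \<in> polys F"
  by (auto simp: polys_def coeff_pCons split: nat.splits)

lemma polys_const: "a \<in> F \<Longrightarrow> [:a:] \<in> polys F"
  by (simp add: polys_pCons polys_0)

lemma polys_1: "1 \<in> polys F"
  using polys_const[OF one_in] by (simp add: one_pCons)

lemma polys_mult: "p \<in> polys F \<Longrightarrow> q \<in> polys F \<Longrightarrow> p * q \<in> polys F"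
  by (auto simp: polys_def coeff_mult intro!: sum_in mult_in)

lemma polys_monom: "a \<in> F \<Longrightarrow> monom a n \<in> polys F"
  by (auto simp: polys_def coeff_monom zero_in)

lemma polys_smult: "a \<in> F \<Longrightarrow> p \<in> polys F \<Longrightarrow> smult a p \<in> polys F"
  by (auto simp: polys_def mult_in)

lemma polys_pderiv: "p \<in> polys F \<Longrightarrow> pderiv p \<in> polys F"
  by (auto simp: polys_def coeff_pderiv intro!: mult_in add_in one_in of_nat_in)

lemma polys_poly: "p \<in> polys F \<Longrightarrow> x \<in> F \<Longrightarrow> poly p x \<in> F"
  by (auto simp: poly_altdef intro!: sum_in mult_in power_in polys_coeff)

lemma base_subset_adj: "F \<subseteq> adjoin F x"
proof
  fix a assume "a \<in> F"
  then show "a \<in> adjoin F x"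
    unfolding adjoin_def
    by (intro CollectI exI[of _ "[:a:]"] exI[of _ 1]) (auto simp: polys_const polys_1)
qed

lemma gen_in_adj: "x \<in> adjoin F x"
  unfolding adjoin_def
  by (intro CollectI exI[of _ "[:0,1:]"] exI[of _ 1])
     (auto simp: polys_const polys_1 polys_pCons zero_in one_in)

lemma poly_in_adj: "p \<in> polys F \<Longrightarrow> poly p x \<in> adjoin F x"
  unfolding adjoin_def by (intro CollectI exI[of _ p] exI[of _ 1]) (auto simp: polys_1)

lemma base_subset_acl: "F \<subseteq> alg_cl F"
proof
  fix a assume "a \<in> F"
  then show "a \<in> alg_cl F"
    unfolding alg_cl_def
    by (intro CollectI bexI[of _ "[:-a, 1:]"]) (auto simp: polys_pCons polys_0 closed_in)
qed

lemma subfield_adj: "subfield_set (adjoin F x)"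
proof
  show "1 \<in> adjoin F x" using base_subset_adj one_in by blast
next
  fix y z assume "y \<in> adjoin F x" "z \<in> adjoin F x"
  then obtain p q p' q' where *: "p \<in> polys F" "q \<in> polys F" "p' \<in> polys F" "q' \<in> polys F"
    "poly q x \<noteq> 0" "poly q' x \<noteq> 0" "y = poly p x / poly q x" "z = poly p' x / poly q' x"
    unfolding adjoin_def by auto
  show "y - z \<in> adjoin F x"
    unfolding adjoin_def using *
    by (intro CollectI exI[of _ "p * q' - p' * q"] exI[of _ "q * q'"])
       (auto simp: polys_mult polys_diff diff_frac_eq)
  show "y * z \<in> adjoin F x"
    unfolding adjoin_def using *
    by (intro CollectI exI[of _ "p * p'"] exI[of _ "q * q'"]) (auto simp: polys_mult)
  show "inverse y \<in> adjoin F x"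
  proof (cases "y = 0")
    case True
    then show ?thesis using \<open>y \<in> adjoin F x\<close> by simp
  next
    case False
    then show ?thesis
      unfolding adjoin_def using *
      by (intro CollectI exI[of _ q] exI[of _ p]) auto
  qed
qed

lemma adj_subset:
  assumes "subfield_set G" "F \<subseteq> G" "x \<in> G"
  shows "adjoin F x \<subseteq> G"
proof
  interpret G: subfield_set G by fact
  fix y assume "y \<in> adjoin F x"
  then show "y \<in> G"
    unfolding adjoin_def using polys_mono[OF assms(2)] assms(3)
    by (auto intro!: G.divide_in G.polys_poly)
qed

end

section \<open>Finite-dimensional modules and closure properties of algebraic elements\<close>

inductive_set lspan :: "'a::field set \<Rightarrow> 'a set \<Rightarrow> 'a set" for F B where
  zero: "0 \<in> lspan F B"
| step: "x \<in> lspan F B \<Longrightarrow> c \<in> F \<Longrightarrow> b \<in> B \<Longrightarrow> x + c * b \<in> lspan F B"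

context subfield_set
begin

lemma lspan_base: "b \<in> B \<Longrightarrow> b \<in> lspan F B"
  using lspan.step[OF lspan.zero one_in, of b B] by simp

lemma lspan_add:
  assumes "x \<in> lspan F B" "y \<in> lspan F B"
  shows "x + y \<in> lspan F B"
  using assms(2)
proof (induction y rule: lspan.induct)
  case (step y c b)
  then show ?case by (metis add.assoc lspan.step)
qed (simp add: assms)

lemma lspan_scale:
  assumes "a \<in> F" "x \<in> lspan F B"
  shows "a * x \<in> lspan F B"
  using assms(2)
proof (induction x rule: lspan.induct)
  case (step x c b)
  then have "a * x + (a * c) * b \<in> lspan F B" using assms(1) by (intro lspan.step mult_in) auto
  then show ?case by (simp add: algebra_simps)
qed (simp add: lspan.zero)

lemma lspan_sum: "(\<And>i. i \<in> I \<Longrightarrow> f i \<in> lspan F B) \<Longrightarrow> sum f I \<in> lspan F B"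
  by (induction I rule: infinite_finite_induct) (auto intro: lspan.zero lspan_add)

lemma lspan_mult_subset:
  assumes "\<And>b. b \<in> B \<Longrightarrow> y * b \<in> lspan F B'" "x \<in> lspan F B"
  shows "y * x \<in> lspan F B'"
  using assms(2)
proof (induction x rule: lspan.induct)
  case (step x c b)
  then have "y * x + c * (y * b) \<in> lspan F B'" 
    using lspan_add[OF _ lspan_scale[OF _ assms(1)]] by blast
  then show ?case by (simp add: algebra_simps)
qed (simp add: lspan.zero)

lemma lspan_insert:
  assumes "x \<in> lspan F (insert b B)"
  shows "\<exists>a\<in>F. x - a * b \<in> lspan F B"
  using assms
proof (induction x rule: lspan.induct)
  case zero
  then show ?case by (intro bexI[of _ 0]) (auto intro: zero_in lspan.zero)
next
  case (step x c b')
  then obtain a where a: "a \<in> F" "x - a * b \<in> lspan F B" by blast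
  show ?case
  proof (cases "b' = b")
    case True
    then show ?thesis using a step by (intro bexI[of _ "a + c"]) (auto intro: add_in simp: algebra_simps)
  next
    case False
    then have "(x - a * b) + c * b' \<in> lspan F B" using a step by (intro lspan.step) auto
    then show ?thesis using a by (intro bexI[of _ a]) (auto simp: algebra_simps)
  qed
qed

text \<open>Gaussian elimination on the spanning set: one \<open>f k\<close> whose coefficient at
  \<open>b\<close> is nonzero serves as pivot and removes \<open>b\<close> from the others.\<close>

lemma lspan_dependent:
  assumes "finite B" "finite J" "card B < card J" "\<And>j. j \<in> J \<Longrightarrow> f j \<in> lspan F B"
  shows "\<exists>c. (\<forall>j\<in>J. c j \<in> F) \<and> (\<exists>j\<in>J. c j \<noteq> 0) \<and> (\<Sum>j\<in>J. c j * f j) = 0"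
  using assms
proof (induction B arbitrary: J f rule: finite_induct)
  case empty
  have "x = 0" if "x \<in> lspan F {}" for x
    using that by (induction x rule: lspan.induct) auto
  then have "f j = 0" if "j \<in> J" for j using empty that by blast
  moreover have "J \<noteq> {}" using empty by auto
  ultimately show ?case by (intro exI[of _ "\<lambda>_. 1"]) (auto simp: one_in)
next
  case (insert b B)
  have "\<forall>j\<in>J. \<exists>a. a \<in> F \<and> f j - a * b \<in> lspan F B"
    using lspan_insert insert.prems(3) by blast
  then obtain a where a: "\<And>j. j \<in> J \<Longrightarrow> a j \<in> F" "\<And>j. j \<in> J \<Longrightarrow> f j - a j * b \<in> lspan F B"
    by metis
  show ?case
  proof (cases "\<forall>j\<in>J. a j = 0")
    case True
    have "card B < card J" using insert.hyps insert.prems(2) by simp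
    moreover have "f j \<in> lspan F B" if "j \<in> J" for j using a(2)[OF that] True that by simp
    ultimately show ?thesis using insert.IH[of J f] insert.prems(1) by blast
  next
    case False
    then obtain k where k: "k \<in> J" "a k \<noteq> 0" by blast
    let ?J = "J - {k}"
    let ?f = "\<lambda>j. f j - (a j / a k) * f k"
    have "?f j \<in> lspan F B" if j: "j \<in> ?J" for j
    proof -
      have "(f j - a j * b) + (- (a j / a k)) * (f k - a k * b) \<in> lspan F B"
        using j k a lspan_add[OF _ lspan_scale, of "f j - a j * b" B "- (a j / a k)" "f k - a k * b"]
        by (simp add: uminus_in divide_in)
      moreover have "(f j - a j * b) + (- (a j / a k)) * (f k - a k * b) = ?f j"
        using k by (simp add: field_simps)
      ultimately show ?thesis by metis
    qed
    moreover have "card B < card ?J" using insert.hyps insert.prems k by simp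
    ultimately obtain c where c: "\<And>j. j \<in> ?J \<Longrightarrow> c j \<in> F" "\<exists>j\<in>?J. c j \<noteq> 0"
      "(\<Sum>j\<in>?J. c j * ?f j) = 0"
      using insert.IH[of ?J ?f] insert.prems(1) by blast
    \<comment> \<open>The multiples of \<open>f k\<close> subtracted by the elimination are
      collected in the coefficient at \<open>k\<close>.\<close>
    define c' where "c' = (\<lambda>j. if j = k then - (\<Sum>j\<in>?J. c j * (a j / a k)) else c j)"
    have "(\<Sum>j\<in>J. c' j * f j) = c' k * f k + (\<Sum>j\<in>?J. c' j * f j)"
      using k insert.prems(1) by (simp add: sum.remove)
    also have "(\<Sum>j\<in>?J. c' j * f j) = (\<Sum>j\<in>?J. c j * f j)"
      by (intro sum.cong) (auto simp: c'_def)
    also have "c' k * f k = - (\<Sum>j\<in>?J. c j * (a j / a k) * f k)"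
      by (simp add: c'_def sum_distrib_right)
    also have "- (\<Sum>j\<in>?J. c j * (a j / a k) * f k) + (\<Sum>j\<in>?J. c j * f j) = (\<Sum>j\<in>?J. c j * ?f j)"
      by (simp add: right_diff_distrib sum_subtractf mult.assoc)
    finally have "(\<Sum>j\<in>J. c' j * f j) = 0" using c(3) by simp
    moreover have "c' j \<in> F" if "j \<in> J" for j
      using that c(1) a(1) k by (auto simp: c'_def intro!: uminus_in sum_in mult_in divide_in)
    moreover have "\<exists>j\<in>J. c' j \<noteq> 0" using c(2) by (auto simp: c'_def)
    ultimately show ?thesis by blast
  qed
qed

text \<open>The ring of multipliers of \<open>M\<close>. If \<open>M\<close> is finite-dimensional
  and contains 1, every multiplier is algebraic; sums and products of algebraic elements are
  therefore treated through a common \<open>M\<close>, without resultants.\<close>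

definition stab :: "'a set \<Rightarrow> 'a set" where
  "stab M = {y. \<forall>x\<in>M. y * x \<in> M}"

lemma stab_lspan_mult: "x \<in> stab M \<Longrightarrow> y \<in> stab M \<Longrightarrow> x * y \<in> stab M"
  by (auto simp: stab_def mult.assoc)

lemma stab_lspan_add: "x \<in> stab (lspan F B) \<Longrightarrow> y \<in> stab (lspan F B) \<Longrightarrow> x + y \<in> stab (lspan F B)"
  by (auto simp: stab_def distrib_right intro: lspan_add)

lemma stab_lspan_base: "F \<subseteq> stab (lspan F B)"
  by (auto simp: stab_def intro: lspan_scale)

lemma stab_lspan_diff: "x \<in> stab (lspan F B) \<Longrightarrow> y \<in> stab (lspan F B) \<Longrightarrow> x - y \<in> stab (lspan F B)"
  using stab_lspan_add[of x B "(-1) * y"] stab_lspan_mult[of "-1" "lspan F B" y]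
    stab_lspan_base[of B] uminus_in[OF one_in] by auto

text \<open>All powers of \<open>x\<close> lie in a module spanned by \<open>card B\<close>
  elements, so the first \<open>card B + 1\<close> of them are linearly dependent.\<close>

lemma stab_imp_algebraic:
  assumes "finite B" "1 \<in> lspan F B" "x \<in> stab (lspan F B)"
  shows "x \<in> alg_cl F"
proof -
  have pw: "x ^ j \<in> lspan F B" for j
    by (induction j) (use assms in \<open>auto simp: stab_def\<close>)
  obtain c where c: "\<forall>j\<in>{..card B}. c j \<in> F" "\<exists>j\<in>{..card B}. c j \<noteq> 0"
      "(\<Sum>j\<in>{..card B}. c j * x ^ j) = 0"
    using lspan_dependent[of B "{..card B}" "\<lambda>j. x ^ j"] assms(1) pw by auto
  define p where "p = (\<Sum>j\<le>card B. monom (c j) j)"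
  have cf: "coeff p i = (if i \<le> card B then c i else 0)" for i
    by (simp add: p_def coeff_sum)
  have "p \<in> polys F" using c(1) by (auto simp: polys_def cf zero_in)
  moreover have "p \<noteq> 0" using c(2) cf by (metis atMost_iff coeff_0)
  moreover have "poly p x = 0" using c(3) by (simp add: p_def poly_sum poly_monom)
  ultimately show ?thesis unfolding alg_cl_def by blast
qed

text \<open>The products \<open>b * y ^ l\<close> with \<open>l < n\<close> span a module stable
  under \<open>y\<close>, since \<open>y ^ n\<close> reduces to lower powers. The coefficients
  \<open>a l\<close> are only required to be multipliers, not elements of \<open>F\<close>; this is
  what makes the closure idempotent in \<open>acl_acl\<close>.\<close>

lemma stab_adjoin_root:
  assumes "finite B" "1 \<in> lspan F B"
    and a: "\<And>l. l < n \<Longrightarrow> a l \<in> stab (lspan F B)" and n: "0 < n"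
    and y: "y ^ n = - (\<Sum>l<n. a l * y ^ l)"
  shows "\<exists>B'. finite B' \<and> 1 \<in> lspan F B' \<and> stab (lspan F B) \<subseteq> stab (lspan F B') \<and> y \<in> stab (lspan F B')"
proof -
  define B' where "B' = (\<lambda>(b, l). b * y ^ l) ` (B \<times> {..<n})"
  have fin: "finite B'" using assms by (simp add: B'_def)
  have pw: "y ^ l * x \<in> lspan F B'" if "x \<in> lspan F B" "l < n" for x l
    by (rule lspan_mult_subset[OF _ that(1)])
       (use that in \<open>auto simp: B'_def mult.commute intro!: lspan_base\<close>)
  have one: "1 \<in> lspan F B'" using pw[of 1 0] assms(2) n by simp
  have st: "z * x \<in> lspan F B'" if z: "z \<in> stab (lspan F B)" and x: "x \<in> lspan F B'" for z x
  proof (rule lspan_mult_subset[OF _ x])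
    fix b assume "b \<in> B'"
    then obtain b0 l where "b0 \<in> B" "l < n" "b = b0 * y ^ l" by (auto simp: B'_def)
    moreover have "z * b0 \<in> lspan F B" using z lspan_base[OF \<open>b0 \<in> B\<close>] by (auto simp: stab_def)
    ultimately show "z * b \<in> lspan F B'" using pw[of "z * b0" l] by (simp add: mult_ac)
  qed
  have "y * x \<in> lspan F B'" if x: "x \<in> lspan F B'" for x
  proof (rule lspan_mult_subset[OF _ x])
    fix b assume "b \<in> B'"
    then obtain b0 l where b: "b0 \<in> B" "l < n" "b = b0 * y ^ l" by (auto simp: B'_def)
    show "y * b \<in> lspan F B'"
    proof (cases "Suc l < n")
      case True
      then show ?thesis using pw[of b0 "Suc l"] b lspan_base[OF b(1)] by (simp add: mult_ac)
    next
      case False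
      then have "Suc l = n" using b by simp
      then have "y * b = b0 * y ^ n" using b by (auto simp: mult_ac)
      also have "\<dots> = (\<Sum>l<n. (-1) * (y ^ l * (a l * b0)))"
        by (simp add: y sum_distrib_left sum_negf mult_ac)
      also have "\<dots> \<in> lspan F B'"
      proof (rule lspan_sum)
        fix l assume "l \<in> {..<n}"
        then have "a l * b0 \<in> lspan F B" "l < n"
          using lspan_base[OF b(1)] a by (auto simp: stab_def)
        then show "(-1) * (y ^ l * (a l * b0)) \<in> lspan F B'"
          using pw lspan_scale uminus_in one_in by blast
      qed
      finally show ?thesis .
    qed
  qed
  then show ?thesis using fin one st by (intro exI[of _ B']) (auto simp: stab_def)
qed

lemma acl_root_equation:
  assumes "x \<in> alg_cl F"
  shows "\<exists>n a. 0 < n \<and> (\<forall>l<n. a l \<in> F) \<and> x ^ n = - (\<Sum>l<n. a l * x ^ l)"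
proof -
  obtain p where p: "p \<in> polys F" "p \<noteq> 0" "poly p x = 0" using assms by (auto simp: alg_cl_def)
  define n where "n = degree p"
  have "n > 0" using p 
    by (intro gr0I) (auto simp: n_def elim!: degree_eq_zeroE)
  moreover define a where "a = (\<lambda>l. coeff p l / lead_coeff p)"
  have "a l \<in> F" for l using p by (simp add: a_def divide_in polys_coeff)
  moreover have "0 = (\<Sum>l\<le>n. coeff p l * x ^ l) / lead_coeff p"
    using p by (simp add: poly_altdef n_def)
  then have "0 = (\<Sum>l\<le>n. a l * x ^ l)" by (simp add: a_def sum_divide_distrib)
  then have "0 = (\<Sum>l<n. a l * x ^ l) + a n * x ^ n" by (simp add: lessThan_Suc_atMost[symmetric])
  moreover have "a n = 1" using p by (simp add: a_def n_def)
  ultimately show ?thesis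
    by (intro exI[of _ n] exI[of _ a]) (auto simp: eq_neg_iff_add_eq_0 add.commute)
qed

lemma algebraic_family_stab:
  assumes "finite A" "A \<subseteq> alg_cl F"
  shows "\<exists>B. finite B \<and> 1 \<in> lspan F B \<and> A \<subseteq> stab (lspan F B)"
  using assms
proof (induction A rule: finite_induct)
  case empty
  then show ?case by (intro exI[of _ "{1}"]) (auto intro: lspan_base)
next
  case (insert x A)
  then obtain B where B: "finite B" "1 \<in> lspan F B" "A \<subseteq> stab (lspan F B)" by auto
  obtain n a where "0 < n" "\<forall>l<n. a l \<in> F" "x ^ n = - (\<Sum>l<n. a l * x ^ l)"
    using acl_root_equation[of x] insert.prems by auto
  then obtain B' where "finite B'" "1 \<in> lspan F B'" "stab (lspan F B) \<subseteq> stab (lspan F B')" "x \<in> stab (lspan F B')"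
    using stab_adjoin_root[OF B(1,2), of n a x] stab_lspan_base by blast
  then show ?case using B by (intro exI[of _ B']) auto
qed

lemma subfield_acl: "subfield_set (alg_cl F)"
proof
  show "1 \<in> alg_cl F" using base_subset_acl one_in by blast
next
  fix x y assume xy: "x \<in> alg_cl F" "y \<in> alg_cl F"
  then obtain B where B: "finite B" "1 \<in> lspan F B" "x \<in> stab (lspan F B)" "y \<in> stab (lspan F B)"
    using algebraic_family_stab[of "{x, y}"] by auto
  show "x - y \<in> alg_cl F" "x * y \<in> alg_cl F"
    using B by (auto intro: stab_imp_algebraic stab_lspan_diff stab_lspan_mult)
next
  fix x assume x: "x \<in> alg_cl F"
  show "inverse x \<in> alg_cl F"
  proof (cases "x = 0")
    case False
    from x obtain p where p: "p \<in> polys F" "p \<noteq> 0" "poly p x = 0" by (auto simp: alg_cl_def)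
    have "reflect_poly p \<in> polys F"
      using p by (auto simp: polys_def coeff_reflect_poly zero_in)
    moreover have "reflect_poly p \<noteq> 0" using p by (metis reflect_poly_0 reflect_poly_eq_0_iff)
    moreover have "poly (reflect_poly p) (inverse x) = 0"
      using p False by (simp add: poly_reflect_poly_nz)
    ultimately show ?thesis unfolding alg_cl_def by blast
  qed (use x in simp)
qed

text \<open>The finitely many coefficients of a monic equation of \<open>x\<close> are multipliers
  of one finite-dimensional module; enlarging it by powers of \<open>x\<close> makes
  \<open>x\<close> a multiplier too.\<close>

lemma acl_acl: "alg_cl (alg_cl F) = alg_cl F"
proof
  interpret A: subfield_set "alg_cl F" by (rule subfield_acl)
  show "alg_cl F \<subseteq> alg_cl (alg_cl F)" by (rule A.base_subset_acl)
  show "alg_cl (alg_cl F) \<subseteq> alg_cl F"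
  proof
    fix x assume "x \<in> alg_cl (alg_cl F)"
    then obtain n a where na: "0 < n" "\<forall>l<n. a l \<in> alg_cl F" "x ^ n = - (\<Sum>l<n. a l * x ^ l)"
      using A.acl_root_equation by blast
    then obtain B where B: "finite B" "1 \<in> lspan F B" "a ` {..<n} \<subseteq> stab (lspan F B)"
      using algebraic_family_stab[of "a ` {..<n}"] by auto
    then obtain B' where "finite B'" "1 \<in> lspan F B'" "x \<in> stab (lspan F B')"
      using stab_adjoin_root[OF B(1,2), of n a x] na by blast
    then show "x \<in> alg_cl F" by (rule stab_imp_algebraic)
  qed
qed

section \<open>Minimal polynomials\<close>

lemma minimal_polynomial:
  assumes "x \<in> alg_cl F"
  obtains m where "m \<in> polys F" "lead_coeff m = 1" "poly m x = 0" "0 < degree m"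
    "\<And>p. p \<in> polys F \<Longrightarrow> poly p x = 0 \<Longrightarrow> degree p < degree m \<Longrightarrow> p = 0"
proof -
  let ?P = "\<lambda>n. \<exists>p\<in>polys F. p \<noteq> 0 \<and> poly p x = 0 \<and> degree p = n"
  have ex: "\<exists>n. ?P n" using assms by (auto simp: alg_cl_def)
  define n where "n = (LEAST n. ?P n)"
  obtain p where p: "p \<in> polys F" "p \<noteq> 0" "poly p x = 0" "degree p = n"
    using LeastI_ex[OF ex] unfolding n_def by blast
  define m where "m = smult (inverse (lead_coeff p)) p"
  have "lead_coeff p \<noteq> 0" using p(2) by simp
  then have deg: "degree m = n" by (simp add: m_def p(4))
  show ?thesis
  proof (rule that)
    show "m \<in> polys F" using p by (simp add: m_def polys_smult inverse_in polys_coeff)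
    have "lead_coeff p \<noteq> 0" using p(2) by simp
    then show "lead_coeff m = 1" by (simp add: m_def)
    show "poly m x = 0" using p by (simp add: m_def)
    show "0 < degree m" using p unfolding deg p(4)[symmetric]
      by (intro gr0I) (auto elim!: degree_eq_zeroE)
    fix q assume "q \<in> polys F" "poly q x = 0" "degree q < degree m"
    then show "q = 0" using not_less_Least[of "degree q" ?P] unfolding deg n_def by blast
  qed
qed

text \<open>Long division by the monic \<open>m\<close>, one leading term at a time, keeps the
  quotient over the set \<open>F\<close>; once the degree is below that of \<open>m\<close>,
  minimality forces 0.\<close>

lemma minimal_polynomial_dvd:
  assumes m: "m \<in> polys F" "lead_coeff m = 1" "poly m x = 0"
    "\<And>p. p \<in> polys F \<Longrightarrow> poly p x = 0 \<Longrightarrow> degree p < degree m \<Longrightarrow> p = 0"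
    and "p \<in> polys F" "poly p x = 0"
  shows "\<exists>q\<in>polys F. p = m * q"
  using assms(5,6)
proof (induction "degree p" arbitrary: p rule: less_induct)
  case less
  show ?case
  proof (cases "degree p < degree m \<or> p = 0")
    case True
    then have "p = 0" using m(4) less.prems by blast
    then show ?thesis by (intro bexI[of _ 0]) (auto simp: polys_0)
  next
    case False
    then have le: "degree m \<le> degree p" and p0: "p \<noteq> 0" by auto
    define r where "r = monom (lead_coeff p) (degree p - degree m)"
    have r: "r \<in> polys F" using less.prems by (simp add: r_def polys_monom polys_coeff)
    have m0: "m \<noteq> 0" using m(2) by auto
    have dr: "degree r = degree p - degree m" using p0 by (simp add: r_def degree_monom_eq)
    have lr: "lead_coeff r = lead_coeff p" using p0 dr by (simp add: r_def)
    have r0: "r \<noteq> 0" using p0 by (simp add: r_def)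
    have dmr: "degree (m * r) = degree p" using m0 r0 le dr by (simp add: degree_mult_eq)
    have lmr: "lead_coeff (m * r) = lead_coeff p" using m(2) lr by (simp add: lead_coeff_mult)
    define p' where "p' = p - m * r"
    have p': "p' \<in> polys F" "poly p' x = 0"
      using less.prems m r by (auto simp: p'_def polys_diff polys_mult)
    have "\<exists>q\<in>polys F. p' = m * q"
    proof (cases "p' = 0")
      case True then show ?thesis by (intro bexI[of _ 0]) (auto simp: polys_0)
    next
      case False
      have "degree p' \<le> degree p" unfolding p'_def using dmr by (intro degree_diff_le) auto
      moreover have "coeff p' (degree p) = 0" using lmr dmr by (simp add: p'_def)
      ultimately have "degree p' < degree p" using False by (metis leading_coeff_neq_0 le_neq_implies_less)
      then show ?thesis using less.hyps p' by blast
    qed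
    then obtain q where "q \<in> polys F" "p' = m * q" by blast
    then have "p = m * (q + r)" by (simp add: p'_def algebra_simps)
    then show ?thesis using \<open>q \<in> polys F\<close> r polys_add by blast
  qed
qed

text \<open>Separability in characteristic 0. It allows the equation \<open>m(x) = 0\<close> to be
  differentiated and solved for the derivative of \<open>x\<close>.\<close>

lemma pderiv_minimal_nonzero:
  assumes m: "m \<in> polys F" "0 < degree m"
    "\<And>p. p \<in> polys F \<Longrightarrow> poly p x = 0 \<Longrightarrow> degree p < degree m \<Longrightarrow> p = 0"
  shows "poly (pderiv m) x \<noteq> 0"
proof
  assume "poly (pderiv m) x = 0"
  moreover have "degree (pderiv m) < degree m" using m(2) by (simp add: degree_pderiv)
  ultimately have "pderiv m = 0" using m polys_pderiv by blast
  then show False using m(2) by (simp add: pderiv_eq_0_iff)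
qed

end

section \<open>Derivations and the descent of Riccati equations\<close>

text \<open>Only the arguments are confined to \<open>K\<close>; the values may lie anywhere in the
  ambient field. This covers derivations of a small field with values in a larger one.\<close>

definition derivation_on :: "'a::field_char_0 set \<Rightarrow> ('a \<Rightarrow> 'a) \<Rightarrow> bool" where
  "derivation_on K \<delta> \<longleftrightarrow> (\<forall>x\<in>K. \<forall>y\<in>K. \<delta> (x + y) = \<delta> x + \<delta> y \<and> \<delta> (x * y) = x * \<delta> y + y * \<delta> x)"

locale derivation_on_subfield = subfield_set K for K :: "'a::field_char_0 set" +
  fixes \<delta> :: "'a \<Rightarrow> 'a"
  assumes derivation: "derivation_on K \<delta>"
begin

lemma der_add: "x \<in> K \<Longrightarrow> y \<in> K \<Longrightarrow> \<delta> (x + y) = \<delta> x + \<delta> y"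
  using derivation by (auto simp: derivation_on_def)

lemma der_mult: "x \<in> K \<Longrightarrow> y \<in> K \<Longrightarrow> \<delta> (x * y) = x * \<delta> y + y * \<delta> x"
  using derivation by (auto simp: derivation_on_def)

lemma der_0: "\<delta> 0 = 0"
  using der_add[of 0 0] by (simp add: zero_in)

lemma der_1: "\<delta> 1 = 0"
  using der_mult[of 1 1] by (simp add: one_in)

lemma der_uminus: "x \<in> K \<Longrightarrow> \<delta> (- x) = - \<delta> x"
  using der_add[of x "- x"] by (simp add: uminus_in der_0 eq_neg_iff_add_eq_0 add.commute)

lemma der_diff: "x \<in> K \<Longrightarrow> y \<in> K \<Longrightarrow> \<delta> (x - y) = \<delta> x - \<delta> y"
  using der_add[of x "- y"] by (simp add: uminus_in der_uminus)

lemma der_inverse: 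
  assumes "x \<in> K" "x \<noteq> 0"
  shows "\<delta> (inverse x) = - \<delta> x / x\<^sup>2"
proof -
  have "\<delta> (x * inverse x) = 0" using assms(2) by (simp add: der_1)
  then have "x * \<delta> (inverse x) + inverse x * \<delta> x = 0"
    using der_mult[of x "inverse x"] assms by (simp add: inverse_in)
  then have "x * (x * \<delta> (inverse x)) = - \<delta> x"
    using assms(2) by (simp add: field_simps eq_neg_iff_add_eq_0)
  then show ?thesis using assms(2) by (simp add: field_simps power2_eq_square)
qed

lemma der_divide: 
  assumes "x \<in> K" "y \<in> K" "y \<noteq> 0"
  shows "\<delta> (x / y) = (\<delta> x * y - x * \<delta> y) / y\<^sup>2"
proof -
  have "\<delta> (x / y) = x * (- \<delta> y / y\<^sup>2) + inverse y * \<delta> x"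
    unfolding divide_inverse[of x y] der_mult[OF assms(1) inverse_in[OF assms(2)]]
      der_inverse[OF assms(2,3)] ..
  also have "\<dots> = (\<delta> x * y - x * \<delta> y) / y\<^sup>2"
    using assms(3) by (simp add: field_simps power2_eq_square)
  finally show ?thesis .
qed

lemma der_sum: "(\<And>i. i \<in> I \<Longrightarrow> f i \<in> K) \<Longrightarrow> \<delta> (sum f I) = (\<Sum>i\<in>I. \<delta> (f i))"
  by (induction I rule: infinite_finite_induct) (auto simp: der_0 der_add sum_in)

lemma der_of_nat: "\<delta> (of_nat n) = 0"
  by (induction n) (auto simp: der_0 der_1 der_add one_in of_nat_in)

lemma der_numeral: "\<delta> (numeral n) = 0"
  using der_of_nat[of "numeral n"] by simp

lemma der_power: "x \<in> K \<Longrightarrow> \<delta> (x ^ n) = of_nat n * x ^ (n - 1) * \<delta> x"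
proof (induction n)
  case (Suc n)
  then have "\<delta> (x ^ Suc n) = x * (of_nat n * x ^ (n - 1) * \<delta> x) + x ^ n * \<delta> x"
    by (simp add: der_mult power_in)
  then show ?case
    by (cases n) (auto simp: algebra_simps)
qed (simp add: der_1)

lemma coeff_map_der: "coeff (map_poly \<delta> p) i = \<delta> (coeff p i)"
  by (simp add: coeff_map_poly der_0)

lemma map_der_add: "p \<in> polys K \<Longrightarrow> q \<in> polys K \<Longrightarrow> map_poly \<delta> (p + q) = map_poly \<delta> p + map_poly \<delta> q"
  by (auto simp: poly_eq_iff coeff_map_der der_add polys_coeff)

lemma map_der_diff: "p \<in> polys K \<Longrightarrow> q \<in> polys K \<Longrightarrow> map_poly \<delta> (p - q) = map_poly \<delta> p - map_poly \<delta> q"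
  by (auto simp: poly_eq_iff coeff_map_der der_diff polys_coeff)

lemma map_der_mult:
  assumes "p \<in> polys K" "q \<in> polys K"
  shows "map_poly \<delta> (p * q) = p * map_poly \<delta> q + map_poly \<delta> p * q"
proof (rule poly_eqI)
  fix n
  have "coeff (map_poly \<delta> (p * q)) n = (\<Sum>i\<le>n. \<delta> (coeff p i * coeff q (n - i)))"
    using assms by (simp add: coeff_map_der coeff_mult der_sum mult_in polys_coeff)
  also have "\<dots> = (\<Sum>i\<le>n. coeff p i * \<delta> (coeff q (n - i)) + \<delta> (coeff p i) * coeff q (n - i))"
    using assms by (intro sum.cong) (auto simp: der_mult polys_coeff)
  also have "\<dots> = coeff (p * map_poly \<delta> q + map_poly \<delta> p * q) n"
    by (simp add: coeff_mult coeff_map_der sum.distrib)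
  finally show "coeff (map_poly \<delta> (p * q)) n = coeff (p * map_poly \<delta> q + map_poly \<delta> p * q) n" .
qed

lemma map_der_const: "map_poly \<delta> [:a:] = [:\<delta> a:]"
  by (simp add: poly_eq_iff coeff_map_der coeff_pCons der_0 split: nat.splits)

section \<open>Extension of derivations to simple extensions\<close>

text \<open>The value that an extension of \<open>\<delta>\<close> sending \<open>x\<close> to
  \<open>y\<close> must take at \<open>poly p x\<close>.\<close>

definition poly_der :: "'a \<Rightarrow> 'a \<Rightarrow> 'a poly \<Rightarrow> 'a" where
  "poly_der x y p = poly (map_poly \<delta> p) x + poly (pderiv p) x * y"

lemma poly_der_diff: "p \<in> polys K \<Longrightarrow> q \<in> polys K \<Longrightarrow> poly_der x y (p - q) = poly_der x y p - poly_der x y q"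
  by (simp add: poly_der_def map_der_diff pderiv_diff algebra_simps)

lemma poly_der_add: "p \<in> polys K \<Longrightarrow> q \<in> polys K \<Longrightarrow> poly_der x y (p + q) = poly_der x y p + poly_der x y q"
  by (simp add: poly_der_def map_der_add pderiv_add algebra_simps)

lemma poly_der_mult: "p \<in> polys K \<Longrightarrow> q \<in> polys K \<Longrightarrow>
    poly_der x y (p * q) = poly p x * poly_der x y q + poly q x * poly_der x y p"
  by (simp add: poly_der_def map_der_mult pderiv_mult algebra_simps)

lemma poly_der_const: "poly_der x y [:a:] = \<delta> a"
  by (simp add: poly_der_def map_der_const pderiv_pCons)

lemma der_poly:
  assumes "p \<in> polys K" "x \<in> K"
  shows "\<delta> (poly p x) = poly_der x (\<delta> x) p"
  using assms(1)
proof (induction p)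
  case 0
  then show ?case by (simp add: poly_der_def der_0)
next
  case (pCons a p)
  have a: "a \<in> K" and p: "p \<in> polys K"
    using polys_coeff[OF pCons.prems, of 0] polys_coeff[OF pCons.prems, of "Suc _"]
    by (auto simp: polys_def)
  have eq: "pCons a p = [:a:] + [:0, 1:] * p" by simp
  have x1: "[:0, 1:] \<in> polys K" by (simp add: polys_pCons polys_0 zero_in one_in)
  have "poly_der x (\<delta> x) [:0, 1:] = \<delta> x"
    using der_0 der_1
    by (simp add: poly_der_def pderiv_pCons map_poly_pCons)
  then have "poly_der x (\<delta> x) (pCons a p) = \<delta> a + (x * poly_der x (\<delta> x) p + poly p x * \<delta> x)"
    unfolding eq using poly_der_add[OF polys_const[OF a] polys_mult[OF x1 p]] poly_der_mult[OF x1 p]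
    by (simp add: poly_der_const del: mult_pCons_left)
  moreover have "\<delta> (poly (pCons a p) x) = \<delta> a + (x * \<delta> (poly p x) + poly p x * \<delta> x)"
    using a p assms(2) by (simp add: der_add der_mult mult_in polys_poly)
  ultimately show ?case using pCons.IH[OF p] by simp
qed

text \<open>The hypothesis says that \<open>poly_der x y p\<close> depends on the value
  \<open>poly p x\<close> alone; the quotient rule then gives a well-defined extension.\<close>

lemma extend_derivation:
  assumes y: "\<And>p. p \<in> polys K \<Longrightarrow> poly p x = 0 \<Longrightarrow> poly_der x y p = 0"
  shows "\<exists>\<delta>'. derivation_on (adjoin K x) \<delta>' \<and> (\<forall>a\<in>K. \<delta>' a = \<delta> a) \<and> \<delta>' x = y"
proof -
  let ?T = "poly_der x y"
  \<comment> \<open>\<open>R z p q\<close> records a representation \<open>z = p(x) / q(x)\<close>;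
    \<open>val\<close> is the quotient rule for it, written as
    \<open>(p' - z q') / q\<close>.\<close>
  define R where "R = (\<lambda>z p q. p \<in> polys K \<and> q \<in> polys K \<and> poly q x \<noteq> 0 \<and> z = poly p x / poly q x)"
  define val where "val = (\<lambda>z p q. (?T p - z * ?T q) / poly q x)"
  have Rz: "poly p x = z * poly q x" if "R z p q" for z p q using that by (auto simp: R_def)
  have val_unique: "val z p q = val z p' q'" if R: "R z p q" "R z p' q'" for z p q p' q'
  proof -
    have *: "p \<in> polys K" "q \<in> polys K" "p' \<in> polys K" "q' \<in> polys K" "poly q x \<noteq> 0" "poly q' x \<noteq> 0"
      using R by (auto simp: R_def)
    note z = Rz[OF R(1)] Rz[OF R(2)]
    have "poly (p * q' - p' * q) x = 0" using z by simp
    then have "?T (p * q' - p' * q) = 0" using * by (intro y) (auto intro: polys_diff polys_mult)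
    then have "poly p x * ?T q' + poly q' x * ?T p = poly p' x * ?T q + poly q x * ?T p'"
      using * by (simp add: poly_der_diff poly_der_mult polys_mult)
    then have "(?T p - z * ?T q) * poly q' x = (?T p' - z * ?T q') * poly q x"
      unfolding z by (simp add: algebra_simps)
    then show ?thesis using * by (simp add: val_def frac_eq_eq)
  qed
  define \<delta>' where "\<delta>' = (\<lambda>z. (SOME v. \<exists>p q. R z p q \<and> v = val z p q))"
  have \<delta>': "\<delta>' z = val z p q" if "R z p q" for z p q
  proof -
    have "\<exists>p' q'. R z p' q' \<and> \<delta>' z = val z p' q'" unfolding \<delta>'_def by (rule someI_ex) (use that in blast)
    then show ?thesis using val_unique that by metis
  qed
  have ex: "\<exists>p q. R z p q" if "z \<in> adjoin K x" for z using that by (auto simp: adjoin_def R_def)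
  have "derivation_on (adjoin K x) \<delta>'"
    unfolding derivation_on_def
  proof (intro ballI conjI)
    fix z z' assume "z \<in> adjoin K x" "z' \<in> adjoin K x"
    then obtain p q p' q' where R: "R z p q" "R z' p' q'" using ex by blast
    then have *: "p \<in> polys K" "q \<in> polys K" "p' \<in> polys K" "q' \<in> polys K" "poly q x \<noteq> 0" "poly q' x \<noteq> 0"
      "z = poly p x / poly q x" "z' = poly p' x / poly q' x"
      by (auto simp: R_def)
    have s: "R (z + z') (p * q' + p' * q) (q * q')"
      using * by (auto simp: R_def polys_mult polys_add add_frac_eq)
    have m: "R (z * z') (p * p') (q * q')"
      using * by (auto simp: R_def polys_mult)
    note z = Rz[OF R(1)] Rz[OF R(2)]
    have Tq: "?T (q * q') = poly q x * ?T q' + poly q' x * ?T q"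
      using * by (simp add: poly_der_mult)
    have "?T (p * q' + p' * q) = poly p x * ?T q' + poly q' x * ?T p + (poly p' x * ?T q + poly q x * ?T p')"
      using * by (simp add: poly_der_mult poly_der_add polys_mult)
    then have "?T (p * q' + p' * q) - (z + z') * ?T (q * q')
        = (?T p - z * ?T q) * poly q' x + (?T p' - z' * ?T q') * poly q x"
      unfolding Tq z by (simp add: algebra_simps)
    then show "\<delta>' (z + z') = \<delta>' z + \<delta>' z'"
      unfolding \<delta>'[OF s] \<delta>'[OF R(1)] \<delta>'[OF R(2)] val_def using *(5,6)
      by (simp add: add_frac_eq)
    have "?T (p * p') = poly p x * ?T p' + poly p' x * ?T p"
      using * by (simp add: poly_der_mult)
    then have "?T (p * p') - (z * z') * ?T (q * q')
        = z * (?T p' - z' * ?T q') * poly q x + z' * (?T p - z * ?T q) * poly q' x"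
      unfolding Tq z by (simp add: algebra_simps)
    then show "\<delta>' (z * z') = z * \<delta>' z' + z' * \<delta>' z"
      unfolding \<delta>'[OF m] \<delta>'[OF R(1)] \<delta>'[OF R(2)] val_def using *(5,6)
      by (simp add: add_frac_eq)
  qed
  moreover have T1: "?T 1 = 0" using poly_der_const[of x y 1] by (simp add: one_pCons der_1)
  have "\<delta>' a = \<delta> a" if "a \<in> K" for a
  proof -
    have "R a [:a:] 1" using that by (simp add: R_def polys_const polys_1)
    from \<delta>'[OF this] show ?thesis by (simp add: val_def poly_der_const T1)
  qed
  moreover have "\<delta>' x = y"
  proof -
    have "R x [:0,1:] 1" by (simp add: R_def polys_pCons polys_0 zero_in one_in polys_1)
    from \<delta>'[OF this] show ?thesis
      using der_0 der_1 by (simp add: val_def T1) (simp add: poly_der_def map_poly_pCons pderiv_pCons)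
  qed
  ultimately show ?thesis by (intro exI[of _ \<delta>'] conjI ballI)
qed

text \<open>Differentiating \<open>m(x) = 0\<close> for the minimal polynomial \<open>m\<close>
  forces the value at \<open>x\<close>. Every polynomial vanishing at \<open>x\<close> is a multiple
  of \<open>m\<close>, so the product rule makes this value consistent.\<close>

lemma extend_derivation_algebraic:
  assumes "x \<in> alg_cl K" "\<And>a. a \<in> K \<Longrightarrow> \<delta> a \<in> K"
  shows "\<exists>\<delta>'. derivation_on (adjoin K x) \<delta>' \<and> (\<forall>a\<in>K. \<delta>' a = \<delta> a) \<and> \<delta>' x \<in> adjoin K x"
proof -
  obtain m where m: "m \<in> polys K" "lead_coeff m = 1" "poly m x = 0" "0 < degree m"
    "\<And>p. p \<in> polys K \<Longrightarrow> poly p x = 0 \<Longrightarrow> degree p < degree m \<Longrightarrow> p = 0"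
    using minimal_polynomial[OF assms(1)] by blast
  have m': "poly (pderiv m) x \<noteq> 0" using pderiv_minimal_nonzero m by blast
  define y where "y = - poly (map_poly \<delta> m) x / poly (pderiv m) x"
  have ym: "poly_der x y m = 0" using m' by (simp add: poly_der_def y_def)
  have "poly_der x y p = 0" if p: "p \<in> polys K" "poly p x = 0" for p
  proof -
    obtain q where "q \<in> polys K" "p = m * q"
      using minimal_polynomial_dvd[OF m(1,2,3) m(5) p] by blast
    then show ?thesis using m ym by (simp add: poly_der_mult)
  qed
  then obtain \<delta>' where \<delta>': "derivation_on (adjoin K x) \<delta>'" "\<forall>a\<in>K. \<delta>' a = \<delta> a" "\<delta>' x = y"
    using extend_derivation by blast
  have "y \<in> adjoin K x"
  proof -
    interpret L: subfield_set "adjoin K x" by (rule subfield_adj)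
    have "map_poly \<delta> m \<in> polys K" using m assms(2) by (auto simp: polys_def coeff_map_der)
    then show ?thesis unfolding y_def
      by (intro L.divide_in L.uminus_in poly_in_adj polys_pderiv m)
  qed
  then show ?thesis using \<delta>' by (intro exI[of _ \<delta>']) simp
qed

end

section \<open>Derivations on simple extensions and their constants\<close>

context subfield_set
begin

lemma derivation_in_adj:
  assumes \<delta>: "derivation_on (adjoin F x) \<delta>" and L: "subfield_set L" "adjoin F x \<subseteq> L"
    and "\<And>a. a \<in> F \<Longrightarrow> \<delta> a \<in> L" "\<delta> x \<in> L" and z: "z \<in> adjoin F x"
  shows "\<delta> z \<in> L"
proof -
  interpret A: subfield_set "adjoin F x" by (rule subfield_adj)
  interpret A: derivation_on_subfield "adjoin F x" \<delta> by standard fact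
  interpret L: subfield_set L by fact
  have FA: "polys F \<subseteq> polys (adjoin F x)" by (intro polys_mono base_subset_adj)
  have ip: "poly p x \<in> L" if "p \<in> polys F" for p using poly_in_adj[OF that] L by blast
  have dp: "\<delta> (poly p x) \<in> L" if p: "p \<in> polys F" for p
  proof -
    have "map_poly \<delta> p \<in> polys L" using p assms(4) by (auto simp: polys_def A.coeff_map_der)
    moreover have "x \<in> L" using gen_in_adj L by blast
    moreover have "pderiv p \<in> polys L"
      using p polys_mono[of F L] base_subset_adj L by (blast intro: polys_pderiv)
    ultimately show ?thesis
      using p FA by (subst A.der_poly)
        (auto simp: A.poly_der_def gen_in_adj intro!: L.add_in L.mult_in L.polys_poly assms)
  qed
  obtain p q where "p \<in> polys F" "q \<in> polys F" "poly q x \<noteq> 0" "z = poly p x / poly q x"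
    using z by (auto simp: adjoin_def)
  then show ?thesis
    by (auto simp: A.der_divide poly_in_adj intro!: L.divide_in L.diff_in L.mult_in L.power_in dp ip)
qed

lemma derivation_zero_adj:
  assumes \<delta>: "derivation_on (adjoin F x) \<delta>" "\<And>a. a \<in> F \<Longrightarrow> \<delta> a = 0" "\<delta> x = 0" and z: "z \<in> adjoin F x"
  shows "\<delta> z = 0"
proof -
  interpret A: subfield_set "adjoin F x" by (rule subfield_adj)
  interpret A: derivation_on_subfield "adjoin F x" \<delta> by standard fact
  have FA: "polys F \<subseteq> polys (adjoin F x)" by (intro polys_mono base_subset_adj)
  have dp: "\<delta> (poly p x) = 0" if p: "p \<in> polys F" for p
  proof -
    have "map_poly \<delta> p = 0" using p assms(2) by (auto simp: poly_eq_iff A.coeff_map_der polys_def)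
    then show ?thesis
      using p FA by (subst A.der_poly) (auto simp: A.poly_der_def gen_in_adj assms(3))
  qed
  obtain p q where "p \<in> polys F" "q \<in> polys F" "poly q x \<noteq> 0" "z = poly p x / poly q x"
    using z by (auto simp: adjoin_def)
  then show ?thesis by (simp add: A.der_divide poly_in_adj dp)
qed

text \<open>Differentiating the minimal polynomial at \<open>x\<close> leaves only
  \<open>m'(x) \<delta> x\<close>, and \<open>m'(x)\<close> is nonzero.\<close>

lemma derivation_zero_algebraic:
  assumes L: "subfield_set L" "F \<subseteq> L" "derivation_on L \<delta>" "\<And>a. a \<in> F \<Longrightarrow> \<delta> a = 0"
    and x: "x \<in> L" "x \<in> alg_cl F"
  shows "\<delta> x = 0"
proof -
  interpret L: subfield_set L by fact
  interpret L: derivation_on_subfield L \<delta> by standard fact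
  obtain m where m: "m \<in> polys F" "lead_coeff m = 1" "poly m x = 0" "0 < degree m"
    "\<And>p. p \<in> polys F \<Longrightarrow> poly p x = 0 \<Longrightarrow> degree p < degree m \<Longrightarrow> p = 0"
    using minimal_polynomial[OF x(2)] by blast
  have m': "poly (pderiv m) x \<noteq> 0" using pderiv_minimal_nonzero m by blast
  have "map_poly \<delta> m = 0" using m L by (auto simp: poly_eq_iff L.coeff_map_der polys_def)
  moreover have "\<delta> (poly m x) = 0" using m by (simp add: L.der_0)
  ultimately show ?thesis
    using L.der_poly[of m x] m m' x polys_mono[OF L(2)] by (auto simp: L.poly_der_def)
qed

text \<open>If \<open>p' q = p q'\<close> and \<open>q' \<noteq> 0\<close>, then \<open>p' / q'\<close> represents the same element as \<open>p / q\<close>, with a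
  denominator of smaller degree.\<close>

lemma derivation_kernel_adj:
  assumes t: "t \<notin> alg_cl F" and \<delta>: "derivation_on (adjoin F t) \<delta>" "\<And>a. a \<in> F \<Longrightarrow> \<delta> a = 0" "\<delta> t \<noteq> 0"
    and c: "c \<in> adjoin F t" "\<delta> c = 0"
  shows "c \<in> F"
proof -
  interpret A: subfield_set "adjoin F t" by (rule subfield_adj)
  interpret A: derivation_on_subfield "adjoin F t" \<delta> by standard fact
  have FA: "polys F \<subseteq> polys (adjoin F t)" by (intro polys_mono base_subset_adj)
  have nz: "poly p t \<noteq> 0" if "p \<in> polys F" "p \<noteq> 0" for p using that t by (auto simp: alg_cl_def)
  have dp: "\<delta> (poly p t) = poly (pderiv p) t * \<delta> t" if p: "p \<in> polys F" for p
  proof -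
    have "map_poly \<delta> p = 0" using p \<delta>(2) by (auto simp: poly_eq_iff A.coeff_map_der polys_def)
    then show ?thesis using p FA by (subst A.der_poly) (auto simp: A.poly_der_def gen_in_adj)
  qed
  let ?P = "\<lambda>n. \<exists>p\<in>polys F. \<exists>q\<in>polys F. poly q t \<noteq> 0 \<and> c = poly p t / poly q t \<and> degree q = n"
  have ex: "\<exists>n. ?P n" using c(1) by (auto simp: adjoin_def)
  define n where "n = (LEAST n. ?P n)"
  obtain p q where pq: "p \<in> polys F" "q \<in> polys F" "poly q t \<noteq> 0" "c = poly p t / poly q t" "degree q = n"
    using LeastI_ex[OF ex] unfolding n_def by blast
  have "0 = \<delta> (poly p t / poly q t)" using pq c by simp
  also have "\<dots> = (poly (pderiv p) t * poly q t - poly p t * poly (pderiv q) t) * \<delta> t / (poly q t)\<^sup>2"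
    using pq by (simp add: A.der_divide poly_in_adj dp algebra_simps)
  finally have e: "poly (pderiv p) t * poly q t = poly p t * poly (pderiv q) t" using pq \<delta>(3) by simp
  have q': "pderiv q = 0"
  proof (rule ccontr)
    assume "pderiv q \<noteq> 0"
    moreover from this have "degree q > 0" by (auto simp: pderiv_eq_0_iff)
    then have "degree (pderiv q) < n" using pq by (simp add: degree_pderiv)
    moreover have "c = poly (pderiv p) t / poly (pderiv q) t"
      using e pq(3) nz[of "pderiv q"] polys_pderiv[OF pq(2)] \<open>pderiv q \<noteq> 0\<close>
      unfolding pq(4) by (simp add: frac_eq_eq)
    ultimately have "?P (degree (pderiv q))" using pq nz polys_pderiv by blast
    then show False using not_less_Least[of "degree (pderiv q)" ?P] \<open>degree (pderiv q) < n\<close>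
      unfolding n_def by blast
  qed
  then have "poly (pderiv p) t = 0" using e pq by simp
  then have "pderiv p = 0" using nz polys_pderiv pq by blast
  then have "degree p = 0" "degree q = 0" using q' by (auto simp: pderiv_eq_0_iff)
  then have "p = [:coeff p 0:]" "q = [:coeff q 0:]" by (metis degree_0_id)+
  then have "c = coeff p 0 / coeff q 0" using pq(4) by (metis poly_pCons poly_0 mult_zero_right add.right_neutral)
  then show ?thesis using pq by (simp add: divide_in polys_coeff)
qed

text \<open>Applied to the coefficients of the monic minimal polynomial of \<open>x\<close>,
  \<open>\<delta>\<close> yields a polynomial of smaller degree that still vanishes at
  \<open>x\<close>, hence 0. The coefficients are therefore constants of \<open>adjoin F t\<close>,
  and these lie in \<open>F\<close>.\<close>

lemma derivation_kernel_algebraic: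
  assumes L: "subfield_set L" "adjoin F t \<subseteq> L" "derivation_on L \<delta>"
    and t: "t \<notin> alg_cl F" and \<delta>: "\<And>a. a \<in> F \<Longrightarrow> \<delta> a = 0" "\<delta> t \<noteq> 0" "\<delta> t \<in> adjoin F t"
    and x: "x \<in> L" "x \<in> alg_cl (adjoin F t)" "\<delta> x = 0"
  shows "x \<in> alg_cl F"
proof -
  interpret A: subfield_set "adjoin F t" by (rule subfield_adj)
  interpret L: subfield_set L by fact
  interpret L: derivation_on_subfield L \<delta> by standard fact
  have dA: "derivation_on (adjoin F t) \<delta>" using L by (auto simp: derivation_on_def)
  obtain m where m: "m \<in> polys (adjoin F t)" "lead_coeff m = 1" "poly m x = 0" "0 < degree m"
    "\<And>p. p \<in> polys (adjoin F t) \<Longrightarrow> poly p x = 0 \<Longrightarrow> degree p < degree m \<Longrightarrow> p = 0"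
    using A.minimal_polynomial[OF x(2)] by blast
  have "poly (map_poly \<delta> m) x = 0"
    using L.der_poly[of m x] m x polys_mono[OF L(2)] by (auto simp: L.poly_der_def L.der_0)
  moreover have dm: "map_poly \<delta> m \<in> polys (adjoin F t)"
    using m(1) derivation_in_adj[OF dA subfield_adj subset_refl _ \<delta>(3)] \<delta>(1) A.zero_in
    by (auto simp: polys_def L.coeff_map_der)
  moreover have "degree (map_poly \<delta> m) < degree m"
  proof -
    have "degree (map_poly \<delta> m) \<le> degree m" by (intro degree_le) (auto simp: L.coeff_map_der coeff_eq_0 L.der_0)
    moreover have "coeff (map_poly \<delta> m) (degree m) = 0" using m by (simp add: L.coeff_map_der L.der_1)
    ultimately show ?thesis using m(4) by (metis degree_0 leading_coeff_0_iff le_neq_implies_less)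
  qed
  ultimately have "map_poly \<delta> m = 0" using m(5) by blast
  then have "\<delta> (coeff m i) = 0" for i by (metis L.coeff_map_der coeff_0)
  then have "m \<in> polys F"
    using derivation_kernel_adj[OF t dA \<delta>(1,2)] m(1) by (auto simp: polys_def)
  moreover have "m \<noteq> 0" using m(4) by auto
  ultimately show ?thesis using m(3) by (auto simp: alg_cl_def)
qed

end

section \<open>Riccati equations over differential fields\<close>

text \<open>The assumption \<open>constant_sqrt\<close> supplies the fixed points of a derivation
  acting on the solutions of a Riccati equation; they are given by a quadratic equation with
  constant coefficients.\<close>

locale differential_field =
  fixes d :: "'a::field_char_0 \<Rightarrow> 'a"
  assumes derivation_d: "derivation_on UNIV d"
    and constant_sqrt: "d c = 0 \<Longrightarrow> \<exists>b. b\<^sup>2 = c"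
begin

sublocale U: subfield_set "UNIV :: 'a set"
  by standard auto

sublocale U: derivation_on_subfield "UNIV :: 'a set" d
  by standard (rule derivation_d)

lemma derivation_d_on: "derivation_on K d"
  using derivation_d by (auto simp: derivation_on_def)

definition closed_dfield :: "'a set \<Rightarrow> bool" where
  "closed_dfield F \<longleftrightarrow> subfield_set F \<and> (\<forall>x\<in>F. d x \<in> F) \<and> {c. d c = 0} \<subseteq> F \<and> alg_cl F = F"

text \<open>The equation of \<open>w = y' / y\<close> for a solution of
  \<open>y'' + p y' + q y = 0\<close>.\<close>

definition riccati :: "'a \<Rightarrow> 'a \<Rightarrow> 'a \<Rightarrow> bool" where
  "riccati p q w \<longleftrightarrow> d w + w\<^sup>2 + p * w + q = 0"

text \<open>With \<open>v = \<delta> w\<close> and \<open>s = \<delta> v / v\<close>, the solutions different from \<open>w\<close> are \<open>w - 2 v / (s - 2 k)\<close> for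
  constants \<open>k\<close>. The element \<open>c = \<delta> s - s\<^sup>2 / 2\<close> is constant, and \<open>\<delta>\<close> annihilates the solution
  with \<open>k\<^sup>2 = - c / 2\<close>.\<close>

lemma riccati_invariant_solution:
  assumes L: "subfield_set L" "\<And>x. x \<in> L \<Longrightarrow> d x \<in> L" "{c. d c = 0} \<subseteq> L"
    and \<delta>: "derivation_on L \<delta>" "\<And>x. x \<in> L \<Longrightarrow> \<delta> x \<in> L" "\<And>x. x \<in> L \<Longrightarrow> d (\<delta> x) = \<delta> (d x)"
    and const: "\<And>c. d c = 0 \<Longrightarrow> \<delta> c = 0"
    and pq: "p \<in> L" "q \<in> L" "\<delta> p = 0" "\<delta> q = 0"
    and w: "w \<in> L" "riccati p q w"
  shows "\<exists>w1\<in>L. riccati p q w1 \<and> \<delta> w1 = 0"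
proof (cases "\<delta> w = 0")
  case True
  then show ?thesis using w by blast
next
  case False
  interpret L: subfield_set L by fact
  interpret L: derivation_on_subfield L \<delta> by standard fact
  note cl = L.closed_in
  define v where "v = \<delta> w"
  have v0: "v \<noteq> 0" using False by (simp add: v_def)
  have vL: "v \<in> L" using w \<delta> by (simp add: v_def)
  have dw: "d w = - w\<^sup>2 - p * w - q"
  proof -
    have "d w + (w\<^sup>2 + p * w + q) = 0" using w by (simp add: riccati_def add.assoc)
    then have "d w = - (w\<^sup>2 + p * w + q)" by (rule eq_neg_iff_add_eq_0[THEN iffD2])
    then show ?thesis by simp
  qed
  have w2: "\<delta> (w\<^sup>2) = 2 * w * v" using w by (simp add: L.der_power v_def)
  have "d v = \<delta> (d w)" using \<delta> w by (simp add: v_def)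
  also have "\<dots> = - (2 * w * v) - p * v"
    unfolding dw using w pq cl
    by (simp add: L.der_diff L.der_uminus w2 L.der_mult) (simp add: v_def)
  also have "\<dots> = - (2 * w + p) * v" by (simp add: algebra_simps)
  finally have dv: "d v = - (2 * w + p) * v" .
  define s where "s = \<delta> v / v"
  have \<delta>v: "\<delta> v = s * v" using v0 by (simp add: s_def)
  have sL: "s \<in> L" using vL \<delta> by (simp add: s_def L.divide_in)
  have "d (\<delta> v) = \<delta> (d v)" using vL \<delta> by simp
  also have "\<dots> = - ((2 * w + p) * (s * v)) - 2 * v * v"
  proof -
    have "\<delta> (2 * w + p) = 2 * v"
      using w pq cl by (simp add: L.der_add L.der_mult L.der_numeral v_def[symmetric])
    moreover have "\<delta> (- (2 * w + p)) = - \<delta> (2 * w + p)"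
      using w pq by (intro L.der_uminus cl)
    moreover have "\<delta> (- (2 * w + p) * v) = - (2 * w + p) * \<delta> v + v * \<delta> (- (2 * w + p))"
      using w pq vL by (intro L.der_mult cl)
    ultimately show ?thesis unfolding dv \<delta>v by (simp add: algebra_simps)
  qed
  finally have "s * d v + v * d s = - ((2 * w + p) * (s * v)) - 2 * v * v"
    unfolding \<delta>v by (simp add: U.der_mult)
  then have "v * d s = v * (- 2 * v)"
    unfolding dv by (simp add: algebra_simps eq_neg_iff_add_eq_0)
  then have ds: "d s = - 2 * v" using v0 mult_left_cancel by blast
  \<comment> \<open>The form is that of the Schwarzian derivative of \<open>w\<close> with respect
    to \<open>\<delta>\<close>, an invariant of Moebius transformations.\<close>
  define c where "c = \<delta> s - s\<^sup>2 / 2"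
  have "d (\<delta> s) = \<delta> (d s)" using sL \<delta> by simp
  also have "\<dots> = - 2 * (s * v)"
    unfolding ds using vL cl by (simp add: L.der_mult L.der_uminus L.der_numeral \<delta>v)
  finally have "d c = 0"
    unfolding c_def by (simp add: U.der_diff U.der_divide U.der_power U.der_numeral ds)
  moreover have "d 2 = 0" using U.der_numeral by simp
  ultimately have "d (- c / 2) = 0" by (simp add: U.der_divide U.der_uminus)
  then obtain k where k: "k\<^sup>2 = - c / 2" using constant_sqrt by blast
  have "d (k\<^sup>2) = 0" unfolding k by fact
  then have "2 * (k * d k) = 0" by (simp add: U.der_power)
  then have dk: "d k = 0" by (cases "k = 0") (auto simp: U.der_0)
  then have kL: "k \<in> L" "\<delta> k = 0" using L(3) const by auto
  define z where "z = s - 2 * k"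
  have dz: "d z = - 2 * v" by (simp add: z_def U.der_diff U.der_mult U.der_numeral dk ds)
  then have z0: "z \<noteq> 0" using v0 U.der_0 by auto
  have zL: "z \<in> L" using sL kL cl by (simp add: z_def)
  have s_eq: "s = z + 2 * k" by (simp add: z_def)
  have \<delta>s: "\<delta> s = s\<^sup>2 / 2 - 2 * k\<^sup>2" unfolding k by (simp add: c_def field_simps)
  have "\<delta> z = \<delta> s" using sL kL cl by (simp add: z_def L.der_diff L.der_mult L.der_numeral)
  also have "\<dots> = s\<^sup>2 / 2 - 2 * k\<^sup>2" by (rule \<delta>s)
  also have "\<dots> = (z\<^sup>2 + 4 * k * z) / 2" unfolding s_eq by (simp add: power2_eq_square field_simps)
  finally have \<delta>z: "\<delta> z = (z\<^sup>2 + 4 * k * z) / 2" .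
  define w1 where "w1 = w - 2 * v / z"
  have w1L: "w1 \<in> L" using w vL zL cl by (simp add: w1_def)
  have "d w1 = d w - (2 * d v * z - 2 * v * d z) / z\<^sup>2"
    using z0 by (simp add: w1_def U.der_diff U.der_divide U.der_mult U.der_numeral)
  also have "\<dots> = - w\<^sup>2 - p * w - q + 2 * (2 * w + p) * v / z - 4 * v\<^sup>2 / z\<^sup>2"
    unfolding dw dv dz using z0 by (simp add: field_simps power2_eq_square)
  finally have "riccati p q w1"
    using z0 by (simp add: riccati_def w1_def field_simps power2_eq_square)
  moreover have "\<delta> w1 = 0"
  proof -
    have "\<delta> w1 = v - (2 * (s * v) * z - 2 * v * \<delta> z) / z\<^sup>2"
      using z0 w vL zL cl
      by (simp add: w1_def L.der_diff L.der_divide L.der_mult L.der_numeral \<delta>v v_def[symmetric])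
    also have "\<dots> = 0" unfolding \<delta>z s_eq using z0 by (simp add: field_simps power2_eq_square)
    finally show ?thesis .
  qed
  ultimately show ?thesis using w1L by blast
qed

text \<open>As \<open>F\<close> is relatively algebraically closed, \<open>t\<close> lies in
  \<open>F\<close> or is transcendental over it. In the second case a solution annihilated by
  \<open>\<delta>\<close> is algebraic over the constants of \<open>\<delta>\<close> in
  \<open>F(t)\<close>, which are \<open>F\<close>.\<close>

lemma riccati_descent:
  assumes F: "closed_dfield F" and t: "\<exists>a\<in>F. d t = a \<or> d t = a * t"
    and pq: "p \<in> F" "q \<in> F" and w: "w \<in> alg_cl (adjoin F t)" "riccati p q w"
  shows "\<exists>w1\<in>F. riccati p q w1"
proof (cases "t \<in> F")
  case True
  have sF: "subfield_set F" and aF: "alg_cl F = F" using F by (auto simp: closed_dfield_def)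
  then have "adjoin F t = F"
    using subfield_set.adj_subset[OF sF sF subset_refl True] subfield_set.base_subset_adj[OF sF] by blast
  then show ?thesis using w aF by auto
next
  case False
  interpret F: subfield_set F using F by (simp add: closed_dfield_def)
  have aF: "alg_cl F = F" and dF: "\<And>x. x \<in> F \<Longrightarrow> d x \<in> F" and cF: "{c. d c = 0} \<subseteq> F"
    using F by (auto simp: closed_dfield_def)
  have tF: "t \<notin> alg_cl F" using False aF by simp
  have t0: "t \<noteq> 0" using False F.zero_in by blast
  define K where "K = adjoin F t"
  interpret K: subfield_set K unfolding K_def by (rule F.subfield_adj)
  have FK: "F \<subseteq> K" and tK: "t \<in> K" unfolding K_def by (rule F.base_subset_adj, rule F.gen_in_adj)
  have dtK: "d t \<in> K" using t FK tK K.mult_in by auto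
  have dK: "d x \<in> K" if "x \<in> K" for x
    using F.derivation_in_adj[OF derivation_d_on K.subfield_set_axioms, of t x] that dF FK dtK
    unfolding K_def by blast
  obtain a where a: "a \<in> F" "d t = a \<or> d t = a * t" using t by blast
  \<comment> \<open>The value of \<open>\<delta> t\<close>, chosen so that \<open>d\<close> and
    \<open>\<delta>\<close> commute at \<open>t\<close>: both orders give 0 for a primitive and
    \<open>a * t\<close> for an exponential.\<close>
  define \<epsilon> where "\<epsilon> = (if d t = a then 1 else t)"
  have \<epsilon>: "\<epsilon> \<noteq> 0" "\<epsilon> \<in> K" using t0 tK K.one_in by (auto simp: \<epsilon>_def)
  \<comment> \<open>The zero derivation of \<open>F\<close> extends with an arbitrary value at
    \<open>t\<close>, because only the zero polynomial vanishes at the transcendental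
    \<open>t\<close>.\<close>
  interpret Z: derivation_on_subfield F "\<lambda>_. 0" by standard (simp add: derivation_on_def)
  have "Z.poly_der t \<epsilon> p = 0" if "p \<in> polys F" "poly p t = 0" for p
  proof -
    have "p = 0" using that tF by (auto simp: alg_cl_def)
    then show ?thesis by (simp add: Z.poly_der_def)
  qed
  then obtain \<delta>0 where \<delta>0: "derivation_on K \<delta>0" "\<forall>a\<in>F. \<delta>0 a = 0" "\<delta>0 t = \<epsilon>"
    unfolding K_def using Z.extend_derivation[of t \<epsilon>] by blast
  interpret D0: derivation_on_subfield K \<delta>0 by standard fact
  have "\<delta>0 x \<in> K" if "x \<in> K" for x
    using F.derivation_in_adj[of t \<delta>0 K x] \<delta>0 \<epsilon> K.subfield_set_axioms that K.zero_in
    unfolding K_def by auto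
  then obtain \<delta> where \<delta>: "derivation_on (adjoin K w) \<delta>" "\<forall>a\<in>K. \<delta> a = \<delta>0 a" "\<delta> w \<in> adjoin K w"
    using D0.extend_derivation_algebraic[of w] w unfolding K_def by blast
  define L where "L = adjoin K w"
  interpret L: subfield_set L unfolding L_def by (rule K.subfield_adj)
  interpret L: derivation_on_subfield L \<delta> by standard (unfold L_def, rule \<delta>)
  have KL: "K \<subseteq> L" and wL: "w \<in> L" unfolding L_def by (rule K.base_subset_adj, rule K.gen_in_adj)
  have \<delta>F: "\<delta> x = 0" if "x \<in> F" for x using that \<delta> \<delta>0 FK by auto
  have \<delta>t: "\<delta> t = \<epsilon>" using \<delta> \<delta>0 tK by auto
  have \<delta>K: "\<delta> x \<in> K" if "x \<in> K" for x
    using that \<delta>(2) \<open>\<And>x. x \<in> K \<Longrightarrow> \<delta>0 x \<in> K\<close> by auto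
  have \<delta>L: "\<delta> x \<in> L" if "x \<in> L" for x
    using K.derivation_in_adj[of w \<delta> L x] \<delta> L.subfield_set_axioms \<delta>K KL that unfolding L_def by blast
  have pqL: "p \<in> L" "q \<in> L" using pq FK KL by auto
  have "d w = - (w\<^sup>2 + p * w + q)"
    using w(2) unfolding riccati_def add.assoc by (rule eq_neg_iff_add_eq_0[THEN iffD2])
  then have "d w \<in> L" using wL pqL by (auto intro!: L.closed_in)
  then have dL: "d x \<in> L" if "x \<in> L" for x
    using K.derivation_in_adj[OF derivation_d_on L.subfield_set_axioms, of w x] dK KL that
    unfolding L_def by blast
  \<comment> \<open>The commutator is again a derivation. It vanishes on \<open>F\<close> and at
    \<open>t\<close>, hence on \<open>F(t)\<close>, and then also at \<open>w\<close>, which is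
    algebraic over \<open>F(t)\<close>.\<close>
  define E where "E = (\<lambda>x. d (\<delta> x) - \<delta> (d x))"
  have E: "derivation_on L E"
    unfolding derivation_on_def
  proof (intro ballI conjI)
    fix x y assume xy: "x \<in> L" "y \<in> L"
    show "E (x + y) = E x + E y"
      using xy dL \<delta>L by (simp add: E_def L.der_add U.der_add)
    show "E (x * y) = x * E y + y * E x"
      using xy dL \<delta>L
      by (simp add: E_def L.der_mult U.der_mult L.der_add U.der_add L.mult_in algebra_simps)
  qed
  have EF: "E x = 0" if "x \<in> F" for x using that \<delta>F dF by (simp add: E_def U.der_0)
  have Et: "E t = 0"
  proof (cases "d t = a")
    case True
    then show ?thesis using a \<delta>F by (simp add: E_def \<delta>t \<epsilon>_def U.der_1)
  next
    case False
    then have dt: "d t = a * t" "\<epsilon> = t" using a by (auto simp: \<epsilon>_def)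
    have "\<delta> (a * t) = a * t" using L.der_mult[of a t] a FK KL tK \<delta>F \<delta>t dt by auto
    then show ?thesis by (simp add: E_def \<delta>t dt)
  qed
  have EK: "E x = 0" if "x \<in> K" for x
    using F.derivation_zero_adj[of t E x] that E EF Et KL unfolding K_def
    by (auto simp: derivation_on_def)
  have "E w = 0"
    using K.derivation_zero_algebraic[OF L.subfield_set_axioms KL E EK wL] w unfolding K_def by blast
  then have EL: "E x = 0" if "x \<in> L" for x
    using K.derivation_zero_adj[of w E x] E EK that unfolding L_def by blast
  then have comm: "d (\<delta> x) = \<delta> (d x)" if "x \<in> L" for x using that by (simp add: E_def)
  obtain w1 where w1: "w1 \<in> L" "riccati p q w1" "\<delta> w1 = 0"
    using riccati_invariant_solution[OF L.subfield_set_axioms dL _ L.derivation \<delta>L comm _ pqL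
        \<delta>F[OF pq(1)] \<delta>F[OF pq(2)] wL w(2)] cF FK KL \<delta>F by blast
  have "L \<subseteq> alg_cl K"
    unfolding L_def using K.adj_subset[OF K.subfield_acl K.base_subset_acl] w unfolding K_def by blast
  then have "w1 \<in> alg_cl F"
    using F.derivation_kernel_algebraic[of L t \<delta> w1] L.subfield_set_axioms KL L.derivation tF \<delta>F \<delta>t \<epsilon> w1
    unfolding K_def by auto
  then show ?thesis using w1 aF by blast
qed

text \<open>Differentiating the equation \<open>m(x) = 0\<close> of an algebraic \<open>x\<close>
  and solving for \<open>d x\<close> shows that the closure is again stable under
  \<open>d\<close>.\<close>

lemma closed_dfield_acl:
  assumes "subfield_set K" "\<And>x. x \<in> K \<Longrightarrow> d x \<in> K" "{c. d c = 0} \<subseteq> alg_cl K"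
  shows "closed_dfield (alg_cl K)"
proof -
  interpret K: subfield_set K by fact
  interpret A: subfield_set "alg_cl K" by (rule K.subfield_acl)
  have "d x \<in> alg_cl K" if x: "x \<in> alg_cl K" for x
  proof -
    obtain m where m: "m \<in> polys K" "lead_coeff m = 1" "poly m x = 0" "0 < degree m"
      "\<And>p. p \<in> polys K \<Longrightarrow> poly p x = 0 \<Longrightarrow> degree p < degree m \<Longrightarrow> p = 0"
      using K.minimal_polynomial[OF x] by blast
    have m': "poly (pderiv m) x \<noteq> 0" using K.pderiv_minimal_nonzero m by blast
    have "poly (map_poly d m) x + poly (pderiv m) x * d x = 0"
      using U.der_poly[of m x] m by (auto simp: U.poly_der_def U.der_0 polys_def)
    then have "d x = - poly (map_poly d m) x / poly (pderiv m) x"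
      using m' by (simp add: field_simps eq_neg_iff_add_eq_0)
    moreover have "map_poly d m \<in> polys (alg_cl K)" "pderiv m \<in> polys (alg_cl K)"
      using m assms(2) K.polys_pderiv polys_mono[OF K.base_subset_acl] K.base_subset_acl
      by (auto simp: polys_def U.coeff_map_der)
    ultimately show ?thesis using x by (simp add: A.divide_in A.uminus_in A.polys_poly)
  qed
  then show ?thesis
    using assms K.acl_acl K.subfield_acl by (auto simp: closed_dfield_def)
qed

lemma closed_dfield_step:
  assumes F: "closed_dfield F" and t: "\<exists>a\<in>F. d t = a \<or> d t = a * t"
  shows "closed_dfield (alg_cl (adjoin F t))" "F \<subseteq> alg_cl (adjoin F t)" "t \<in> alg_cl (adjoin F t)"
proof -
  interpret F: subfield_set F using F by (simp add: closed_dfield_def)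
  interpret K: subfield_set "adjoin F t" by (rule F.subfield_adj)
  have "d t \<in> adjoin F t" using t F.base_subset_adj[of t] F.gen_in_adj[of t] K.mult_in by auto
  then have "d x \<in> adjoin F t" if "x \<in> adjoin F t" for x
    using F.derivation_in_adj[OF derivation_d_on F.subfield_adj subset_refl _ _ that] F F.base_subset_adj
    by (auto simp: closed_dfield_def)
  moreover show sub: "F \<subseteq> alg_cl (adjoin F t)" using F.base_subset_adj K.base_subset_acl by blast
  moreover have "{c. d c = 0} \<subseteq> F" using F by (simp add: closed_dfield_def)
  ultimately show "closed_dfield (alg_cl (adjoin F t))"
    by (intro closed_dfield_acl K.subfield_set_axioms) auto
  show "t \<in> alg_cl (adjoin F t)" using F.gen_in_adj K.base_subset_acl by blast
qed

section \<open>Liouville towers\<close>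

text \<open>The generator \<open>t\<close> is a primitive or an exponential; a logarithm of
  \<open>f\<close> is a primitive of \<open>d f / f\<close>. Algebraic operations need no
  constructor, because every step ends with the relative algebraic closure.\<close>

inductive liouville_tower :: "'a set \<Rightarrow> 'a set \<Rightarrow> bool" for F0 where
  base: "liouville_tower F0 F0"
| step: "liouville_tower F0 F \<Longrightarrow> \<exists>a\<in>F. d t = a \<or> d t = a * t \<Longrightarrow> liouville_tower F0 (alg_cl (adjoin F t))"

lemma liouville_tower_closed:
  assumes "liouville_tower F0 F" "closed_dfield F0"
  shows "closed_dfield F \<and> F0 \<subseteq> F"
  using assms(1) by induction (use assms(2) closed_dfield_step in blast)+

text \<open>The solution changes at every level of the descent while \<open>p\<close> and
  \<open>q\<close> stay in the bottom field, hence an induction over arbitrary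
  \<open>w\<close>.\<close>

theorem riccati_tower_descent:
  assumes "liouville_tower F0 F" "closed_dfield F0" "p \<in> F0" "q \<in> F0" "w \<in> F" "riccati p q w"
  shows "\<exists>w\<in>F0. riccati p q w"
  using assms(1,5,6)
proof (induction arbitrary: w)
  case (step F t)
  have "closed_dfield F" "F0 \<subseteq> F" using liouville_tower_closed step.hyps assms(2) by auto
  then show ?case using riccati_descent[of F t p q w] step assms(3,4) by blast
qed blast

end

section \<open>The hypergeometric Riccati equation\<close>

text \<open>The parameter \<open>\<kappa>\<close> is realized in two ways: as \<open>fls_X\<close>
  for expansions at \<open>k = 0\<close>, and as the germ of \<open>k\<close> at an arbitrary
  point.\<close>

definition ev :: "complex fls \<Rightarrow> complex poly \<Rightarrow> complex fls" where
  "ev \<kappa> c = poly (map_poly fls_const c) \<kappa>"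

lemma ev_0 [simp]: "ev \<kappa> 0 = 0"
  by (simp add: ev_def)

lemma ev_pCons [simp]: "ev \<kappa> (pCons a c) = fls_const a + \<kappa> * ev \<kappa> c"
  by (simp add: ev_def map_poly_pCons)

lemma ev_1 [simp]: "ev \<kappa> 1 = 1"
  by (simp add: one_pCons)

lemma ev_add [simp]: "ev \<kappa> (p + q) = ev \<kappa> p + ev \<kappa> q"
  by (induction p q rule: poly_induct2) (auto simp: algebra_simps simp flip: fls_plus_const)

lemma ev_smult [simp]: "ev \<kappa> (smult a p) = fls_const a * ev \<kappa> p"
  by (induction p) (auto simp: algebra_simps simp flip: fls_const_mult_const)

lemma ev_mult [simp]: "ev \<kappa> (p * q) = ev \<kappa> p * ev \<kappa> q"
  by (induction p) (auto simp: algebra_simps)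

lemma ev_uminus [simp]: "ev \<kappa> (- p) = - ev \<kappa> p"
  using ev_add[of \<kappa> p "- p"] by (simp add: eq_neg_iff_add_eq_0 add.commute)

lemma ev_diff [simp]: "ev \<kappa> (p - q) = ev \<kappa> p - ev \<kappa> q"
  using ev_add[of \<kappa> p "- q"] by simp

lemma ev_prod: "ev \<kappa> (prod f A) = (\<Prod>i\<in>A. ev \<kappa> (f i))"
  by (induction A rule: infinite_finite_induct) auto

lemma coeff_map_ev [simp]: "coeff (map_poly (ev \<kappa>) P) i = ev \<kappa> (coeff P i)"
  by (simp add: coeff_map_poly)

lemma ev_sum: "ev \<kappa> (sum f A) = (\<Sum>i\<in>A. ev \<kappa> (f i))"
  by (induction A rule: infinite_finite_induct) auto

lemma map_ev_mult: "map_poly (ev \<kappa>) (P * Q) = map_poly (ev \<kappa>) P * map_poly (ev \<kappa>) Q"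
  by (auto simp: poly_eq_iff coeff_mult ev_sum)

lemma map_ev_add: "map_poly (ev \<kappa>) (P + Q) = map_poly (ev \<kappa>) P + map_poly (ev \<kappa>) Q"
  by (auto simp: poly_eq_iff)

lemma map_ev_smult: "map_poly (ev \<kappa>) (smult c P) = smult (ev \<kappa> c) (map_poly (ev \<kappa>) P)"
  by (auto simp: poly_eq_iff)

lemma ev_of_nat: "ev \<kappa> (of_nat n) = of_nat n"
  by (induction n) auto

lemma map_ev_pderiv: "map_poly (ev \<kappa>) (pderiv P) = pderiv (map_poly (ev \<kappa>) P)"
proof -
  have "ev \<kappa> (1 + of_nat n) = 1 + of_nat n" for n by (simp add: ev_of_nat)
  then show ?thesis by (auto simp: poly_eq_iff coeff_pderiv simp del: ev_add)
qed

text \<open>The coefficients of the hypergeometric equation \<open>k (1 - k) y'' + (1 - 2 k) y' - y / 4 = 0\<close>,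
  which is satisfied by complete elliptic integrals.\<close>

definition legendre_a :: "complex poly" where "legendre_a = [:0, 1, -1:]"
definition legendre_b :: "complex poly" where "legendre_b = [:1, -2:]"

locale fls_derivation =
  fixes d :: "complex fls \<Rightarrow> complex fls" and \<kappa> :: "complex fls"
  assumes derivation: "derivation_on UNIV d" and d_const: "d (fls_const c) = 0" and d_gen: "d \<kappa> = 1"
begin

sublocale U: subfield_set "UNIV :: complex fls set"
  by standard auto

sublocale U: derivation_on_subfield "UNIV :: complex fls set" d
  by standard (rule derivation)

lemma d_ev: "d (ev \<kappa> c) = ev \<kappa> (pderiv c)"
  by (induction c) (auto simp: U.der_0 U.der_add U.der_mult d_const d_gen pderiv_pCons algebra_simps)

text \<open>Transcendence of \<open>\<kappa>\<close>: as \<open>d \<kappa> = 1\<close>,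
  differentiation lowers the degree of a vanishing polynomial until a constant is left. Polynomial
  identities in \<open>\<kappa>\<close> therefore hold in \<complex>[k] and carry over to every
  other realization of \<open>k\<close>.\<close>

lemma ev_eq_0_iff [simp]: "ev \<kappa> c = 0 \<longleftrightarrow> c = 0"
proof
  show "ev \<kappa> c = 0 \<Longrightarrow> c = 0"
  proof (induction "degree c" arbitrary: c rule: less_induct)
    case less
    have "ev \<kappa> (pderiv c) = 0" using d_ev[of c] less.prems by (simp add: U.der_0)
    show ?case
    proof (cases "degree c = 0")
      case True
      then obtain a where "c = [:a:]" by (auto elim: degree_eq_zeroE)
      then show ?thesis using less.prems by simp
    next
      case False
      then have "degree (pderiv c) < degree c" by (simp add: degree_pderiv)
      then have "pderiv c = 0" using less.hyps \<open>ev \<kappa> (pderiv c) = 0\<close> by blast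
      then show ?thesis using False by (simp add: pderiv_eq_0_iff)
    qed
  qed
qed simp

text \<open>The Riccati equation of \<open>w = y' / y\<close>, multiplied by
  \<open>legendre_a\<close> so that its coefficients are polynomials in \<open>k\<close>.\<close>

definition legendre_riccati :: "complex fls \<Rightarrow> bool" where
  "legendre_riccati w \<longleftrightarrow>
     ev \<kappa> legendre_a * (d w + w\<^sup>2) + ev \<kappa> legendre_b * w - fls_const (1/4) = 0"

lemma degree_map_ev: "degree (map_poly (ev \<kappa>) P) = degree P"
  by (intro degree_map_poly) simp

lemma clear_denominators:
  assumes "w \<in> alg_cl (adjoin (range fls_const) \<kappa>)"
  shows "\<exists>P. P \<noteq> 0 \<and> poly (map_poly (ev \<kappa>) P) w = 0"
proof -
  from assms obtain p where p: "p \<in> polys (adjoin (range fls_const) \<kappa>)" "p \<noteq> 0" "poly p w = 0"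
    by (auto simp: alg_cl_def)
  have polyC: "\<exists>c. q = map_poly fls_const c" if "q \<in> polys (range fls_const)" for q :: "complex fls poly"
    using that
  proof (induction q)
    case 0
    then show ?case by (intro exI[of _ 0]) auto
  next
    case (pCons a q)
    have "q \<in> polys (range fls_const)" using polys_coeff[OF pCons.prems, of "Suc _"] by (auto simp: polys_def)
    then obtain c where "q = map_poly fls_const c" using pCons.IH by blast
    moreover obtain b where "a = fls_const b" using polys_coeff[OF pCons.prems, of 0] by auto
    ultimately show ?case by (intro exI[of _ "pCons b c"]) (simp add: map_poly_pCons)
  qed
  have "\<exists>A B. ev \<kappa> B \<noteq> 0 \<and> coeff p i = ev \<kappa> A / ev \<kappa> B" for i
  proof -
    obtain A B where "A \<in> polys (range fls_const)" "B \<in> polys (range fls_const)"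
      "poly B \<kappa> \<noteq> 0" "coeff p i = poly A \<kappa> / poly B \<kappa>"
      using polys_coeff[OF p(1), of i] by (auto simp: adjoin_def)
    then show ?thesis using polyC unfolding ev_def by metis
  qed
  then obtain A B where AB: "\<And>i. ev \<kappa> (B i) \<noteq> 0" "\<And>i. coeff p i = ev \<kappa> (A i) / ev \<kappa> (B i)" by metis
  define P where "P = (\<Sum>i\<le>degree p. monom (A i * (\<Prod>j\<in>{..degree p} - {i}. B j)) i)"
  have cP: "coeff P i = (if i \<le> degree p then A i * (\<Prod>j\<in>{..degree p} - {i}. B j) else 0)" for i
    by (simp add: P_def coeff_sum)
  define D where "D = (\<Prod>j\<le>degree p. ev \<kappa> (B j))"
  have D0: "D \<noteq> 0" using AB by (simp add: D_def)
  have "map_poly (ev \<kappa>) P = smult D p"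
  proof (rule poly_eqI)
    fix i
    show "coeff (map_poly (ev \<kappa>) P) i = coeff (smult D p) i"
    proof (cases "i \<le> degree p")
      case True
      then have "D = ev \<kappa> (B i) * (\<Prod>j\<in>{..degree p} - {i}. ev \<kappa> (B j))"
        unfolding D_def by (intro prod.remove) auto
      then show ?thesis using True AB(1)[of i] unfolding coeff_smult AB(2)[of i]
        by (simp add: cP ev_prod)
    qed (simp add: cP coeff_eq_0)
  qed
  then have "poly (map_poly (ev \<kappa>) P) w = 0" "map_poly (ev \<kappa>) P \<noteq> 0" using p D0 by auto
  then show ?thesis by (intro exI[of _ P]) auto
qed

text \<open>The vector field of the Riccati equation maps polynomials vanishing at the solution \<open>w\<close> to
  polynomials vanishing at \<open>w\<close>; apply this to one of minimal degree.\<close>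

lemma riccati_darboux:
  assumes w: "w \<in> alg_cl (adjoin (range fls_const) \<kappa>)" "legendre_riccati w"
  shows "\<exists>P c M. 0 < degree P \<and> c \<noteq> 0 \<and>
    smult c (smult legendre_a (map_poly pderiv P) + pderiv P * [:[:1/4:], - legendre_b, - legendre_a:]) = P * M"
proof -
  let ?R = "\<lambda>P. P \<noteq> 0 \<and> poly (map_poly (ev \<kappa>) P) w = 0"
  define n where "n = (LEAST n. \<exists>P. ?R P \<and> degree P = n)"
  have "\<exists>n. \<exists>P. ?R P \<and> degree P = n" using clear_denominators[OF w(1)] by blast
  from LeastI_ex[OF this] obtain P where P: "P \<noteq> 0" "poly (map_poly (ev \<kappa>) P) w = 0" "degree P = n"
    unfolding n_def by blast
  have min: "Q = 0" if "poly (map_poly (ev \<kappa>) Q) w = 0" "degree Q < n" for Q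
    using not_less_Least[of "degree Q" "\<lambda>n. \<exists>P. ?R P \<and> degree P = n"] that unfolding n_def by blast
  have "0 < n"
  proof (rule gr0I)
    assume "n = 0"
    then obtain a where "P = [:a:]" using P by (auto elim: degree_eq_zeroE)
    then show False using P by (simp add: map_poly_pCons)
  qed
  define R where "R = [:[:1/4:], - legendre_b, - legendre_a:]"
  define Q where "Q = smult legendre_a (map_poly pderiv P) + pderiv P * R"
  have mP: "map_poly (ev \<kappa>) (map_poly pderiv P) = map_poly d (map_poly (ev \<kappa>) P)"
    by (simp add: poly_eq_iff U.coeff_map_der coeff_map_poly d_ev)
  have "poly (map_poly (ev \<kappa>) R) w
      = fls_const (1/4) - ev \<kappa> legendre_b * w - ev \<kappa> legendre_a * w\<^sup>2"
    by (simp add: R_def map_poly_pCons power2_eq_square algebra_simps)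
  also have "\<dots> = ev \<kappa> legendre_a * d w"
    using w(2) by (simp add: legendre_riccati_def algebra_simps)
  finally have "poly (map_poly (ev \<kappa>) Q) w = ev \<kappa> legendre_a * d (poly (map_poly (ev \<kappa>) P) w)"
    using U.der_poly[of "map_poly (ev \<kappa>) P" w]
    by (simp add: Q_def map_ev_add map_ev_smult map_ev_mult map_ev_pderiv mP U.poly_der_def polys_def algebra_simps)
  then have Q0: "poly (map_poly (ev \<kappa>) Q) w = 0" using P by (simp add: U.der_0)
  \<comment> \<open>Pseudo-division, since the coefficients lie in \<complex>[k]; this introduces
    the factor \<open>c\<close>. The remainder vanishes at \<open>w\<close>, so minimality of the
    degree of \<open>P\<close> makes it 0.\<close>
  obtain c M where cM: "c \<noteq> 0" "smult c Q = P * M + pseudo_mod Q P" using pseudo_mod(1)[OF P(1)] by blast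
  have "map_poly (ev \<kappa>) (smult c Q) = map_poly (ev \<kappa>) (P * M + pseudo_mod Q P)" using cM by simp
  then have "poly (map_poly (ev \<kappa>) (pseudo_mod Q P)) w = 0"
    using Q0 P by (auto simp: map_ev_add map_ev_smult map_ev_mult dest: arg_cong[where f = "\<lambda>p. poly p w"])
  then have "pseudo_mod Q P = 0" using pseudo_mod(2)[OF P(1)] min P(3) by blast
  then show ?thesis using cM \<open>0 < n\<close> P(3) unfolding Q_def R_def by (intro exI[of _ P] exI[of _ c] exI[of _ M]) auto
qed

end

section \<open>Absence of rational solutions\<close>

text \<open>Here \<open>w = A / B\<close> in lowest terms. Poles at the singular points 0 and 1 are
  excluded, so \<open>B\<close> is coprime to \<open>legendre_a\<close> and the equation forces
  \<open>A = B'\<close>. Then \<open>B\<close> would be a polynomial solution of the hypergeometric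
  equation, which the exponent 1/2 at infinity forbids.\<close>

lemma no_rational_riccati_solution:
  fixes A B :: "complex poly"
  assumes cop: "coprime A B" and B: "B \<noteq> 0"
    and eq: "legendre_a * (pderiv A * B - A * pderiv B + A\<^sup>2) + legendre_b * A * B - [:1/4:] * B\<^sup>2 = 0"
  shows False
proof -
  have no_common: "\<not> (poly A x = 0 \<and> poly B x = 0)" for x
    using cop by (metis coprime_poly_0)
  have B0: "poly B 0 \<noteq> 0"
  proof
    assume "poly B 0 = 0"
    then obtain C where C: "B = [:0, 1:] * C" by (metis dvdE minus_zero poly_eq_0_iff_dvd)
    \<comment> \<open>With \<open>B = k C\<close> the equation becomes divisible by
      \<open>k\<close>. At \<open>k = 0\<close> the quotient reduces to \<open>A(0)^2\<close>,
      because the two terms in \<open>A C\<close> cancel; this reflects the double exponent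
      0.\<close>
    have "[:0, 1:] * ([:1, -1:] * (pderiv A * B - A * pderiv B + A\<^sup>2) + legendre_b * A * C - [:1/4:] * (B * C)) = 0"
    proof -
      have la: "legendre_a = [:0, 1:] * [:1, -1:]" by (simp add: legendre_a_def)
      show ?thesis using eq unfolding la C power2_eq_square by (simp only: algebra_simps add_0)
    qed
    then have "[:1, -1:] * (pderiv A * B - A * pderiv B + A\<^sup>2) + legendre_b * A * C - [:1/4:] * (B * C) = 0"
      by (simp only: mult_eq_0_iff) simp
    from arg_cong[OF this, of "\<lambda>p. poly p 0"] have "poly A 0 ^ 2 = 0"
      by (simp add: C pderiv_mult pderiv_pCons legendre_b_def)
    then show False using no_common \<open>poly B 0 = 0\<close> by auto
  qed
  have B1: "poly B 1 \<noteq> 0"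
  proof
    assume "poly B 1 = 0"
    then obtain C where C: "B = [:-1, 1:] * C" by (metis dvdE poly_eq_0_iff_dvd)
    have "[:-1, 1:] * ([:0, -1:] * (pderiv A * B - A * pderiv B + A\<^sup>2) + legendre_b * A * C - [:1/4:] * (B * C)) = 0"
    proof -
      have la: "legendre_a = [:-1, 1:] * [:0, -1:]" by (simp add: legendre_a_def)
      show ?thesis using eq unfolding la C power2_eq_square by (simp only: algebra_simps add_0)
    qed
    then have "[:0, -1:] * (pderiv A * B - A * pderiv B + A\<^sup>2) + legendre_b * A * C - [:1/4:] * (B * C) = 0"
      by (simp only: mult_eq_0_iff) simp
    from arg_cong[OF this, of "\<lambda>p. poly p 1"] have "poly A 1 ^ 2 = 0"
      unfolding C pderiv_mult by (simp add: pderiv_pCons legendre_b_def algebra_simps)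
    then show False using no_common \<open>poly B 1 = 0\<close> by auto
  qed
  have A0: "A \<noteq> 0" using eq B by auto
  \<comment> \<open>Otherwise \<open>legendre_a\<close> times \<open>A^2\<close> would be the only
    term of degree \<open>2 + 2 n\<close>.\<close>
  have deg: "degree A < degree B"
  proof (rule ccontr)
    assume "\<not> degree A < degree B"
    then have le: "degree B \<le> degree A" by simp
    define n where "n = degree A"
    have c1: "coeff (legendre_a * A\<^sup>2) (2 + 2 * n) = - (lead_coeff A)\<^sup>2"
    proof -
      have "coeff (legendre_a * A\<^sup>2) (degree legendre_a + degree (A\<^sup>2)) = lead_coeff legendre_a * lead_coeff (A\<^sup>2)"
        by (rule coeff_mult_degree_sum)
      moreover have "degree legendre_a = 2" "lead_coeff legendre_a = -1" by (simp_all add: legendre_a_def)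
      moreover have "lead_coeff (A\<^sup>2) = (lead_coeff A)\<^sup>2" by (rule lead_coeff_power)
      moreover have "degree (A\<^sup>2) = 2 * n" using A0 by (simp add: n_def degree_power_eq)
      ultimately show ?thesis by simp
    qed
    have small: "coeff p (2 + 2 * n) = 0" if "degree p \<le> 1 + 2 * n" for p :: "complex poly"
      using that by (intro coeff_eq_0) simp
    have da: "degree legendre_a \<le> 2" "degree legendre_b \<le> 1" by (simp_all add: legendre_a_def legendre_b_def)
    have d1: "degree (pderiv A * B) \<le> 2 * n - 1" "degree (A * pderiv B) \<le> 2 * n - 1"
      using degree_mult_le[of "pderiv A" B] degree_mult_le[of A "pderiv B"] le
      by (auto simp: degree_pderiv n_def)
    have "degree (legendre_a * (pderiv A * B - A * pderiv B)) \<le> 1 + 2 * n"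
    proof (cases "n = 0")
      case True
      then have "pderiv A = 0" "pderiv B = 0" using le by (auto simp: n_def pderiv_eq_0_iff)
      then show ?thesis by simp
    next
      case False
      have "degree (pderiv A * B - A * pderiv B) \<le> 2 * n - 1" using d1 by (intro degree_diff_le)
      then show ?thesis using degree_mult_le[of legendre_a "pderiv A * B - A * pderiv B"] da False by linarith
    qed
    moreover have "degree (legendre_b * A * B) \<le> 1 + 2 * n"
      using degree_mult_le[of "legendre_b * A" B] degree_mult_le[of legendre_b A] da le unfolding n_def by linarith
    moreover have "degree ([:1/4:] * B\<^sup>2) \<le> 1 + 2 * n"
      using degree_power_le[of B 2] le by (simp add: n_def)
    ultimately have c2: "coeff (legendre_a * (pderiv A * B - A * pderiv B) + legendre_a * A\<^sup>2
        + legendre_b * A * B - [:1/4:] * B\<^sup>2) (2 + 2 * n) = - (lead_coeff A)\<^sup>2"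
      using small c1 by simp
    have z: "legendre_a * (pderiv A * B - A * pderiv B) + legendre_a * A\<^sup>2
        + legendre_b * A * B - [:1/4:] * B\<^sup>2 = 0"
      using eq by (simp add: algebra_simps)
    show False using c2 A0 unfolding z by simp
  qed
  have "coprime legendre_a B"
  proof -
    have "coprime [:- c, 1:] B" if "poly B c \<noteq> 0" for c
      using that poly_eq_0_iff_dvd[of B c]
      by (intro prime_elem_imp_coprime prime_elem_linear_field_poly) auto
    from this[OF B0] this[OF B1] have "coprime [:0, 1:] B" "coprime [:-1, 1:] B" by simp_all
    moreover have "legendre_a = [:0, 1:] * (- [:-1, 1:])" by (simp add: legendre_a_def)
    ultimately show ?thesis using coprime_mult_left_iff coprime_minus_left_iff by metis
  qed
  then have "coprime B (legendre_a * A)" using cop by (simp add: coprime_commute)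
  moreover have "(legendre_a * A) * (A - pderiv B) = B * ([:1/4:] * B - legendre_b * A - legendre_a * pderiv A)"
    using eq unfolding power2_eq_square by (simp only: algebra_simps add_0)
  then have "B dvd (legendre_a * A) * (A - pderiv B)" by simp
  ultimately have "B dvd A - pderiv B" by (simp only: coprime_dvd_mult_right_iff)
  moreover have "degree (A - pderiv B) < degree B"
    using deg degree_diff_less[of A "degree B" "pderiv B"] by (simp add: degree_pderiv)
  ultimately have "A - pderiv B = 0" using dvd_imp_degree_le by (metis not_le)
  then have AB: "A = pderiv B" by simp
  have "B * (legendre_a * pderiv (pderiv B) + legendre_b * pderiv B - [:1/4:] * B) = 0"
  proof -
    have "B * (a * c + b * p - q * B) = a * (c * B - p * p + p * p) + b * p * B - q * (B * B)"
      for a b c p q by (simp add: algebra_simps)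
    then show ?thesis using eq unfolding AB power2_eq_square by metis
  qed
  then have ode: "legendre_a * pderiv (pderiv B) + legendre_b * pderiv B - [:1/4:] * B = 0"
    using B mult_eq_0_iff by blast
  obtain n where n: "degree B = Suc n" using deg by (cases "degree B") auto
  have cB: "coeff B (Suc (Suc n)) = 0" using n by (simp add: coeff_eq_0)
  have "legendre_a * pderiv (pderiv B) + legendre_b * pderiv B - [:1/4:] * B
      = pCons 0 (pderiv (pderiv B)) - pCons 0 (pCons 0 (pderiv (pderiv B))) + pderiv B
        - smult 2 (pCons 0 (pderiv B)) - smult (1/4) B"
    by (simp add: legendre_a_def legendre_b_def)
  then have "pCons 0 (pderiv (pderiv B)) - pCons 0 (pCons 0 (pderiv (pderiv B))) + pderiv B
        - smult 2 (pCons 0 (pderiv B)) - smult (1/4) B = 0" using ode by metis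
  \<comment> \<open>The factor is \<open>(n + 3/2)^2\<close>, that is \<open>(m + 1/2)^2\<close> for
    the degree \<open>m = n + 1\<close> of \<open>B\<close>.\<close>
  from arg_cong[OF this, of "\<lambda>p. coeff p (Suc n)"] have "(of_nat (Suc n) * of_nat n + 2 * of_nat (Suc n) + 1/4) * coeff B (Suc n) = 0"
    using cB by (cases n) (auto simp: coeff_pderiv algebra_simps)
  moreover have "coeff B (Suc n) \<noteq> 0" using B n by (metis leading_coeff_0_iff)
  ultimately have "of_nat (Suc n) * of_nat n + 2 * of_nat (Suc n) + (1/4 :: complex) = 0"
    using mult_eq_0_iff by blast
  then have "Re (of_nat (Suc n) * of_nat n + 2 * of_nat (Suc n) + (1/4 :: complex)) = 0" by simp
  then have "real (Suc n) * real n + 2 * real (Suc n) + 1/4 = 0" by simp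
  moreover have "0 \<le> real (Suc n) * real n" by simp
  ultimately show False by linarith
qed

section \<open>Local analysis at a simple pole\<close>

text \<open>A shift by a nonconstant \<open>w\<close> does not commute with differentiating the
  coefficients; the correction is the chain rule term. It serves to move a known solution to
  0.\<close>

lemma map_poly_der_pcompose_shift:
  fixes P :: "complex fls poly"
  shows "map_poly fls_deriv (pcompose P [:w, 1:])
    = pcompose (map_poly fls_deriv P) [:w, 1:] + smult (fls_deriv w) (pcompose (pderiv P) [:w, 1:])"
proof (induction P)
  case (pCons a P)
  have m: "map_poly fls_deriv (p + q) = map_poly fls_deriv p + map_poly fls_deriv q" for p q :: "complex fls poly"
    by (simp add: poly_eq_iff coeff_map_poly)
  have l: "map_poly fls_deriv ([:w, 1:] * p) = smult (fls_deriv w) p + [:w, 1:] * map_poly fls_deriv p"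
    for p :: "complex fls poly"
    by (auto simp: poly_eq_iff coeff_map_poly coeff_pCons algebra_simps split: nat.splits)
  show ?case
    by (simp only: pcompose_pCons pderiv_pCons m l pCons.IH map_poly_pCons fls_deriv_zero pcompose_add)
       (simp add: algebra_simps smult_add_right pcompose_pCons map_poly_pCons)
qed simp

text \<open>A Laurent series solution of \<open>g' = p g + c\<close>, where \<open>p\<close> has a simple pole with residue 1,
  would be \<open>g = x (1 + \<dots>) \<integral> c / (x (1 + \<dots>))\<close>, which contains \<open>c log x\<close>.\<close>

lemma simple_pole_resonance:
  fixes g p :: "complex fls" and c :: complex
  assumes "fls_X * p = 1 + fls_X * fps_to_fls f" "fls_deriv g = p * g + fls_const c"
  shows "c = 0"
proof (cases "g = 0")
  case True
  then show ?thesis using assms(2) by simp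
next
  case False
  let ?s = "fls_subdegree g"
  have "fls_X * fls_deriv g = (fls_X * p) * g + fls_X * fls_const c"
    using assms(2) by (simp add: algebra_simps)
  then have e: "fls_X * fls_deriv g = g + fls_X * (fps_to_fls f * g) + fls_X * fls_const c"
    unfolding assms(1) by (simp add: algebra_simps)
  have z: "fls_nth (fps_to_fls f * g) (?s - 1) = 0"
    by (rule fls_times_nth_eq0) (use fls_subdegree_fls_to_fps_gt0[of f] in simp)
  from arg_cong[OF e, of "\<lambda>h. fls_nth h ?s"]
  have "of_int ?s * fls_nth g ?s = fls_nth g ?s + (if ?s = 1 then c else 0)"
    using z by (simp add: fls_X_times_conv_shift(1))
  moreover have "fls_nth g ?s \<noteq> 0" using False by (rule nth_fls_subdegree_nonzero)
  ultimately show ?thesis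
    by (cases "?s = 1") (auto simp: algebra_simps)
qed

text \<open>\<open>G\<close> is invariant, with cofactor \<open>N\<close>, under the vector field
  \<open>v' = - p v - v^2\<close>, which has the solution 0. Any other solution gives
  \<open>z = 1 / v\<close> with \<open>z' = p z + 1\<close>, which is impossible for a Laurent
  series. Comparing the lowest nonzero coefficient of \<open>G\<close> with the next one gives the
  same conclusion without adjoining roots of \<open>G\<close>.\<close>

lemma darboux_local_power:
  fixes G :: "complex fls poly"
  assumes G: "G \<noteq> 0"
    and eq: "map_poly fls_deriv G + pderiv G * [:0, - p, -1:] = G * N"
    and p: "fls_X * p = 1 + fls_X * fps_to_fls f"
  shows "G = monom (lead_coeff G) (degree G)"
proof -
  define n where "n = degree G"
  let ?g = "coeff G"
  have lhs: "coeff (map_poly fls_deriv G + pderiv G * [:0, - p, -1:]) (Suc j)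
      = fls_deriv (?g (Suc j)) - p * of_nat (Suc j) * ?g (Suc j) - of_nat j * ?g j" for j
    by (cases j) (auto simp: coeff_map_poly coeff_pderiv algebra_simps)
  have lhs0: "coeff (map_poly fls_deriv G + pderiv G * [:0, - p, -1:]) 0 = fls_deriv (?g 0)"
    by (simp add: coeff_map_poly)
  have gn: "?g n \<noteq> 0" using G by (simp add: n_def)
  have N: "degree N \<le> 1"
  proof (cases "N = 0")
    case False
    have "degree G + degree N = degree (map_poly fls_deriv G + pderiv G * [:0, - p, -1:])"
      unfolding eq using G False by (simp add: degree_mult_eq)
    also have "\<dots> \<le> n + 1"
    proof (rule degree_le, intro allI impI)
      fix i assume "n + 1 < i"
      then show "coeff (map_poly fls_deriv G + pderiv G * [:0, - p, -1:]) i = 0"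
        by (cases i) (use lhs in \<open>auto simp: n_def coeff_eq_0\<close>)
    qed
    finally show ?thesis by (simp add: n_def)
  qed simp
  obtain \<alpha> \<beta> where N_eq: "N = [:\<alpha>, \<beta>:]"
  proof -
    have "N = [:coeff N 0, coeff N 1:]"
      using N by (auto simp: poly_eq_iff coeff_pCons coeff_eq_0 split: nat.splits)
    then show ?thesis using that by blast
  qed
  have rhs: "coeff (G * N) (Suc j) = \<alpha> * ?g (Suc j) + \<beta> * ?g j" for j
    by (simp add: N_eq algebra_simps)
  have rhs0: "coeff (G * N) 0 = \<alpha> * ?g 0" by (simp add: N_eq algebra_simps)
  have rel: "fls_deriv (?g (Suc j)) = (\<alpha> + p * of_nat (Suc j)) * ?g (Suc j) + (\<beta> + of_nat j) * ?g j" for j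
    using lhs[of j] rhs[of j] unfolding eq by (simp add: algebra_simps)
  \<comment> \<open>The relation at index \<open>n\<close> fixes \<open>\<beta>\<close>, because the
    coefficient above the leading one is 0.\<close>
  have "(\<beta> + of_nat n) * ?g n = 0" using rel[of n] by (simp add: n_def coeff_eq_0)
  then have \<beta>: "\<beta> = - of_nat n" using gn by (simp add: eq_neg_iff_add_eq_0)
  define i where "i = (LEAST i. ?g i \<noteq> 0)"
  have gi: "?g i \<noteq> 0" unfolding i_def by (rule LeastI[of _ n]) (rule gn)
  have lt: "?g j = 0" if "j < i" for j using not_less_Least[of j "\<lambda>i. ?g i \<noteq> 0"] that unfolding i_def by blast
  have in_le: "i \<le> n" unfolding i_def by (rule Least_le) (rule gn)
  have di: "fls_deriv (?g i) = (\<alpha> + p * of_nat i) * ?g i"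
  proof (cases i)
    case 0
    then show ?thesis using lhs0 rhs0 unfolding eq by simp
  next
    case (Suc j)
    then show ?thesis using rel[of j] lt[of j] by simp
  qed
  \<comment> \<open>The quotient eliminates the unknown \<open>\<alpha>\<close>: what remains is
    \<open>\<gamma>' = p \<gamma> + (i - n)\<close>, solvable only for \<open>i = n\<close>.\<close>
  define \<gamma> where "\<gamma> = ?g (Suc i) / ?g i"
  have gs: "?g (Suc i) = \<gamma> * ?g i" using gi by (simp add: \<gamma>_def)
  have "fls_deriv \<gamma> * ?g i + \<gamma> * fls_deriv (?g i) = (\<alpha> + p * of_nat (Suc i)) * (\<gamma> * ?g i) + (\<beta> + of_nat i) * ?g i"
    using rel[of i] unfolding gs by (simp add: algebra_simps)
  then have "?g i * fls_deriv \<gamma> = ?g i * (p * \<gamma> + (of_nat i - of_nat n))"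
    unfolding di \<beta> by (simp add: algebra_simps)
  then have "fls_deriv \<gamma> = p * \<gamma> + (of_nat i - of_nat n)" using gi mult_left_cancel by blast
  moreover have "(of_nat i - of_nat n :: complex fls) = fls_const (of_nat i - of_nat n)"
    by (simp add: fls_of_nat fls_minus_const)
  ultimately have "(of_nat i - of_nat n :: complex) = 0" using simple_pole_resonance[OF p] by metis
  then have "i = n" by simp
  show ?thesis
  proof (rule poly_eqI)
    fix j
    show "?g j = coeff (monom (lead_coeff G) (degree G)) j"
      using lt[of j] \<open>i = n\<close> by (cases j n rule: linorder_cases) (auto simp: n_def coeff_eq_0)
  qed
qed


section \<open>The hypergeometric series at k = 0\<close>

text \<open>The hypergeometric series with parameters 1/2, 1/2 and 1. The squared binomial
  coefficient is the number of closed grid walks of length \<open>2 n\<close>; the factor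
  \<open>16 ^ n\<close> puts the second finite singular point at 1.\<close>

definition hyp_fps :: "complex fps" where
  "hyp_fps = Abs_fps (\<lambda>n. (of_nat ((2 * n) choose n))\<^sup>2 / 16 ^ n)"

lemma central_binomial_rec: "Suc n * ((2 * Suc n) choose Suc n) = 2 * (2 * n + 1) * ((2 * n) choose n)"
proof -
  have "Suc n * (Suc (Suc (2 * n)) choose Suc n) = Suc (Suc (2 * n)) * (Suc (2 * n) choose n)"
    using Suc_times_binomial_eq[of "Suc (2 * n)" n] by (simp only: mult.commute)
  moreover have "Suc n * (Suc (2 * n) choose Suc n) = Suc (2 * n) * ((2 * n) choose n)"
    using Suc_times_binomial_eq[of "2 * n" n] by (simp only: mult.commute)
  moreover have "Suc (2 * n) choose n = Suc (2 * n) choose Suc n"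
    using binomial_symmetric[of n "Suc (2 * n)"] by (simp add: Suc_diff_le mult_2)
  ultimately have "Suc n * (Suc (Suc (2 * n)) choose Suc n) = 2 * (Suc n * (Suc (2 * n) choose Suc n))"
    by (simp only: mult_Suc_right mult_Suc) simp
  also have "\<dots> = 2 * (2 * n + 1) * ((2 * n) choose n)"
    using \<open>Suc n * (Suc (2 * n) choose Suc n) = Suc (2 * n) * ((2 * n) choose n)\<close> by simp
  finally show ?thesis by simp
qed

lemma hyp_fps_rec:
  "of_nat (Suc n) ^ 2 * fps_nth hyp_fps (Suc n) = (of_nat n + 1/2)\<^sup>2 * fps_nth hyp_fps n"
proof -
  define c c' N :: complex where "c = of_nat ((2 * n) choose n)"
    and "c' = of_nat ((2 * Suc n) choose Suc n)" and "N = of_nat n"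
  have "of_nat (Suc n) * c' = of_nat (2 * (2 * n + 1)) * c"
    unfolding c_def c'_def of_nat_mult[symmetric] central_binomial_rec ..
  then have "of_nat (Suc n) * c' = 4 * ((N + 1/2) * c)" by (simp add: N_def algebra_simps)
  then have "(of_nat (Suc n) * c')\<^sup>2 = 16 * ((N + 1/2) * c)\<^sup>2" by (simp add: power_mult_distrib)
  moreover have "fps_nth hyp_fps (Suc n) = c'\<^sup>2 / (16 * 16 ^ n)" "fps_nth hyp_fps n = c\<^sup>2 / 16 ^ n"
    by (simp_all add: hyp_fps_def c_def c'_def)
  ultimately show ?thesis
    unfolding N_def[symmetric] by (simp only: power_mult_distrib times_divide_eq_right) simp
qed

lemma hyp_fps_ode:
  "fps_X * (1 - fps_X) * fps_deriv (fps_deriv hyp_fps) + (1 - 2 * fps_X) * fps_deriv hyp_fps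
     - fps_const (1/4) * hyp_fps = 0"
proof (rule fps_ext)
  fix n
  have eq: "fps_X * (1 - fps_X) * fps_deriv (fps_deriv hyp_fps) + (1 - 2 * fps_X) * fps_deriv hyp_fps
     - fps_const (1/4) * hyp_fps
    = fps_X * fps_deriv (fps_deriv hyp_fps) - fps_X * (fps_X * fps_deriv (fps_deriv hyp_fps))
      + fps_deriv hyp_fps - fps_const 2 * (fps_X * fps_deriv hyp_fps) - fps_const (1/4) * hyp_fps"
    by (simp add: algebra_simps flip: numeral_fps_const)
  show "fps_nth (fps_X * (1 - fps_X) * fps_deriv (fps_deriv hyp_fps) + (1 - 2 * fps_X) * fps_deriv hyp_fps
     - fps_const (1/4) * hyp_fps) n = fps_nth 0 n"
    unfolding eq using hyp_fps_rec[of n]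
    by (cases n; cases "n - 1") (auto simp: power2_eq_square algebra_simps)
qed

interpretation L: fls_derivation fls_deriv fls_X
  by standard (auto simp: derivation_on_def algebra_simps)

lemma hyp_log_deriv_riccati: "L.legendre_riccati (fps_to_fls (fps_deriv hyp_fps) / fps_to_fls hyp_fps)"
proof -
  let ?h = "fps_to_fls hyp_fps"
  have h0: "?h \<noteq> 0"
  proof -
    have "fps_nth hyp_fps 0 \<noteq> 0" by (simp add: hyp_fps_def)
    then show ?thesis by (metis fps_to_fls_eq_0_iff fps_zero_nth)
  qed
  have ode: "fls_X * (1 - fls_X) * fls_deriv (fls_deriv ?h) + (1 - 2 * fls_X) * fls_deriv ?h - fls_const (1/4) * ?h = 0"
    using arg_cong[OF hyp_fps_ode, of fps_to_fls]
    by (simp add: fls_times_fps_to_fls fls_deriv_fps_to_fls fps_const_to_fls)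
  define w where "w = fls_deriv ?h / ?h"
  have dh: "fls_deriv ?h = w * ?h" using h0 by (simp add: w_def)
  have ddh: "fls_deriv (fls_deriv ?h) = (fls_deriv w + w\<^sup>2) * ?h"
    unfolding dh by (simp add: dh power2_eq_square algebra_simps)
  have ab: "ev fls_X legendre_a = fls_X * (1 - fls_X)" "ev fls_X legendre_b = 1 - 2 * fls_X"
    by (simp_all add: legendre_a_def legendre_b_def algebra_simps)
  have "?h * (ev fls_X legendre_a * (fls_deriv w + w\<^sup>2) + ev fls_X legendre_b * w - fls_const (1/4)) = 0"
    using ode unfolding ddh unfolding dh ab by (simp only: algebra_simps)
  then have "L.legendre_riccati w" using h0 unfolding L.legendre_riccati_def by simp
  then show ?thesis unfolding w_def fls_deriv_fps_to_fls .
qed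

section \<open>Absence of algebraic solutions\<close>

context fls_derivation
begin

text \<open>The relation from \<open>riccati_darboux\<close> lives over \<complex>[k], so it may be
  evaluated at \<open>fls_X\<close> although \<open>w\<close> belongs to another realization of
  \<open>k\<close>. At \<open>k = 0\<close> the known solution \<open>w0 = h' / h\<close> must then
  be the only root of \<open>P\<close>, and two coefficients of \<open>P\<close> exhibit it as a
  rational function.\<close>

theorem no_algebraic_riccati_solution:
  assumes "w \<in> alg_cl (adjoin (range fls_const) \<kappa>)" "legendre_riccati w"
  shows False
proof -
  let ?e = "ev fls_X"
  let ?R = "[:[:1/4:], - legendre_b, - legendre_a:]"
  obtain P c M where P: "0 < degree P" "c \<noteq> 0"
    and PM: "smult c (smult legendre_a (map_poly pderiv P) + pderiv P * ?R) = P * M"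
    using riccati_darboux[OF assms] by blast
  define a b where "a = ?e legendre_a" and "b = ?e legendre_b"
  have a0: "a \<noteq> 0" by (simp add: a_def del: ev_pCons) (simp add: legendre_a_def)
  define w0 where "w0 = fps_to_fls (fps_deriv hyp_fps) / fps_to_fls hyp_fps"
  have w0: "a * (fls_deriv w0 + w0\<^sup>2) + b * w0 - fls_const (1/4) = 0"
    using hyp_log_deriv_riccati unfolding L.legendre_riccati_def w0_def a_def b_def .
  define Q where "Q = map_poly ?e P"
  define N where "N = smult (inverse (?e c)) (map_poly ?e M)"
  have c0: "?e c \<noteq> 0" using P by simp
  have mQ: "map_poly ?e (map_poly pderiv P) = map_poly fls_deriv Q"
    unfolding Q_def by (simp add: poly_eq_iff coeff_map_poly L.d_ev)
  have mR: "map_poly ?e ?R = [:fls_const (1/4), - b, - a:]"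
    by (simp add: map_poly_pCons a_def b_def)
  have "smult (?e c) (smult a (map_poly fls_deriv Q) + pderiv Q * [:fls_const (1/4), - b, - a:]) = Q * map_poly ?e M"
    using arg_cong[OF PM, of "map_poly ?e"]
    unfolding map_ev_smult map_ev_add map_ev_mult map_ev_pderiv mQ mR unfolding Q_def a_def .
  from arg_cong[OF this, of "smult (inverse (?e c))"]
  have Qeq: "smult a (map_poly fls_deriv Q) + pderiv Q * [:fls_const (1/4), - b, - a:] = Q * N"
    using c0 by (simp add: N_def)
  \<comment> \<open>The substitution \<open>W = w0 + v\<close> moves the solution \<open>w0\<close>
    to \<open>v = 0\<close>.\<close>
  define s where "s = [:w0, 1:]"
  define G where "G = pcompose Q s"
  have pG: "pcompose (pderiv Q) s = pderiv G" by (simp add: G_def pderiv_pcompose s_def pderiv_pCons)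
  have mG: "pcompose (map_poly fls_deriv Q) s = map_poly fls_deriv G - smult (fls_deriv w0) (pderiv G)"
    using map_poly_der_pcompose_shift[of Q w0] unfolding G_def[symmetric] s_def[symmetric] pG by simp
  have "pcompose [:fls_const (1/4), - b, - a:] s = [:fls_const (1/4) - b * w0 - a * w0\<^sup>2, - b - 2 * a * w0, - a:]"
    by (simp add: s_def pcompose_pCons power2_eq_square algebra_simps)
  also have "fls_const (1/4) - b * w0 - a * w0\<^sup>2 = a * fls_deriv w0"
    using w0 by (simp add: algebra_simps)
  finally have "smult a (map_poly fls_deriv G - smult (fls_deriv w0) (pderiv G))
      + pderiv G * [:a * fls_deriv w0, - b - 2 * a * w0, - a:] = G * pcompose N s"
    using arg_cong[OF Qeq, of "\<lambda>p. pcompose p s"]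
    by (simp only: pcompose_add pcompose_smult pcompose_mult mG pG G_def[symmetric])
  moreover have "[:a * fls_deriv w0, - b - 2 * a * w0, - a:]
      = [:a * fls_deriv w0:] + smult a [:0, - (b / a + 2 * w0), -1:]"
    using a0 by (simp add: field_simps)
  ultimately have "smult a (map_poly fls_deriv G + pderiv G * [:0, - (b / a + 2 * w0), -1:]) = G * pcompose N s"
    by (simp only: smult_diff_right smult_add_right distrib_left mult_smult_right) (simp add: algebra_simps)
  from arg_cong[OF this, of "smult (inverse a)"]
  have Geq: "map_poly fls_deriv G + pderiv G * [:0, - (b / a + 2 * w0), -1:] = G * smult (inverse a) (pcompose N s)"
    using a0 by simp
  have Q0: "Q \<noteq> 0" and dQ: "degree Q = degree P"
    using P L.degree_map_ev[of P] unfolding Q_def by auto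
  have dG: "degree G = degree P" unfolding G_def by (simp add: s_def dQ degree_pcompose)
  then have G0: "G \<noteq> 0" using P by auto
  \<comment> \<open>From \<open>b / a = 1 / k - 1 / (1 - k)\<close>: since \<open>h\<close> does not
    vanish at 0, \<open>w0\<close> is a power series, and \<open>b / a + 2 w0\<close> has a simple
    pole with residue 1 and regular part \<open>f\<close>.\<close>
  define f where "f = - inverse (1 - fps_X) + 2 * (fps_deriv hyp_fps * inverse hyp_fps)"
  have h0: "fps_nth hyp_fps 0 \<noteq> 0" by (simp add: hyp_fps_def)
  have "fls_X * (b / a + 2 * w0) = 1 + fls_X * fps_to_fls f"
  proof -
    have ab: "a = fls_X * (1 - fls_X)" "b = 1 - 2 * fls_X"
      by (simp_all add: a_def b_def legendre_a_def legendre_b_def algebra_simps)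
    have x1: "1 - fls_X \<noteq> (0 :: complex fls)" using a0 unfolding ab by auto
    have i1: "fps_to_fls (inverse (1 - fps_X)) = inverse (1 - fls_X :: complex fls)"
      by (subst fls_inverse_fps_to_fls[symmetric]) (auto simp: fps_to_fls_minus subdegree_eq_0)
    have i2: "fps_to_fls (inverse hyp_fps) = inverse (fps_to_fls hyp_fps)"
      using h0 by (subst fls_inverse_fps_to_fls[symmetric]) (auto simp: subdegree_eq_0)
    have f: "fps_to_fls f = - inverse (1 - fls_X) + 2 * w0"
      by (simp add: f_def fls_times_fps_to_fls i1 i2 w0_def divide_inverse)
    have ba: "fls_X * (b / a) = 1 - fls_X * inverse (1 - fls_X)"
      unfolding ab using x1 by (simp add: field_simps)
    show ?thesis unfolding distrib_left ba f by (simp add: algebra_simps)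
  qed
  from darboux_local_power[OF G0 Geq this]
  have "G = monom (lead_coeff G) (degree P)" unfolding dG .
  then obtain g where g: "G = smult g ([:0, 1:] ^ degree P)" by (metis monom_altdef)
  have "Q = pcompose G [:- w0, 1:]"
    unfolding G_def pcompose_assoc[symmetric] s_def by (simp add: pcompose_pCons pcompose_idR)
  also have "\<dots> = smult g ([:- w0, 1:] ^ degree P)"
  proof -
    have "pcompose (p ^ n) r = pcompose p r ^ n" for p r :: "complex fls poly" and n
      by (induction n) (auto simp: pcompose_1 pcompose_mult)
    then show ?thesis unfolding g by (simp add: pcompose_smult pcompose_pCons)
  qed
  finally have Qg: "Q = smult g ([:- w0, 1:] ^ degree P)" .
  obtain n where n: "degree P = Suc n" using P by (cases "degree P") auto
  \<comment> \<open>The quotient of the two top coefficients of a power of \<open>W - w0\<close> is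
    \<open>w0\<close> up to the factor \<open>- (n + 1)\<close>; both come from
    \<complex>[k].\<close>
  have "coeff Q (Suc n) = g" "coeff Q n = - (of_nat (Suc n) * w0 * g)"
    unfolding Qg n coeff_smult by (subst coeff_linear_poly_power; simp add: algebra_simps)+
  then have w0Q: "?e (coeff P n) = - (of_nat (Suc n) * w0 * ?e (coeff P (Suc n)))" unfolding Q_def by simp
  define A where "A = - coeff P n"
  define B where "B = of_nat (Suc n) * coeff P (Suc n)"
  have "coeff P (Suc n) \<noteq> 0" using n P by (metis leading_coeff_0_iff degree_0 less_irrefl)
  then have B0: "B \<noteq> 0" unfolding B_def by (simp del: of_nat_Suc)
  have AB: "?e A = w0 * ?e B" 
    unfolding A_def B_def ev_uminus w0Q by (simp add: ev_of_nat algebra_simps)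
  define A' B' where "A' = A div gcd A B" and "B' = B div gcd A B"
  have gcd0: "gcd A B \<noteq> 0" using B0 by simp
  have cop: "coprime A' B'" unfolding A'_def B'_def using B0 by (intro div_gcd_coprime) auto
  have A'B': "A = gcd A B * A'" "B = gcd A B * B'" by (simp_all add: A'_def B'_def)
  then have B'0: "B' \<noteq> 0" using B0 by auto
  have "?e (gcd A B) * ?e A' = ?e (gcd A B) * (w0 * ?e B')"
    using AB A'B' by (metis ev_mult mult.left_commute)
  then have AB': "?e A' = w0 * ?e B'"
    using gcd0 mult_left_cancel[of "?e (gcd A B)"] L.ev_eq_0_iff by blast
  have "?e (pderiv A') = fls_deriv w0 * ?e B' + w0 * ?e (pderiv B')"
    using arg_cong[OF AB', of fls_deriv] by (simp add: L.d_ev algebra_simps)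
  then have "?e (legendre_a * (pderiv A' * B' - A' * pderiv B' + A'\<^sup>2) + legendre_b * A' * B' - [:1/4:] * B'\<^sup>2)
      = (a * (fls_deriv w0 + w0\<^sup>2) + b * w0 - fls_const (1/4)) * (?e B')\<^sup>2"
    unfolding power2_eq_square ev_diff ev_add ev_mult AB' a_def[symmetric] b_def[symmetric]
    by (simp add: algebra_simps)
  then have "legendre_a * (pderiv A' * B' - A' * pderiv B' + A'\<^sup>2) + legendre_b * A' * B' - [:1/4:] * B'\<^sup>2 = 0"
    unfolding w0 by (simp only: L.ev_eq_0_iff mult_zero_left)
  then show False using no_rational_riccati_solution[OF cop B'0] by blast
qed

end

section \<open>Counting closed paths\<close>

definition steps :: "(int \<times> int) set" where
  "steps = {(1, 0), (-1, 0), (0, 1), (0, -1)}"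

lemma finite_steps [simp]: "finite steps"
  by (simp add: steps_def)

lemma card_steps [simp]: "card steps = 4"
  by (simp add: steps_def)

lemma uminus_steps_iff [simp]: "- s \<in> steps \<longleftrightarrow> s \<in> steps"
  by (cases s) (auto simp: steps_def)

abbreviation reduced :: "(int \<times> int) list \<Rightarrow> bool" where
  "reduced ws \<equiv> successively (\<lambda>s t. s + t \<noteq> 0) ws"

definition reduced_words :: "nat \<Rightarrow> int \<times> int \<Rightarrow> (int \<times> int) list set" where
  "reduced_words n v = {ws. length ws = n \<and> set ws \<subseteq> steps \<and> reduced ws \<and> sum_list ws = v}"

definition cyclic_words :: "nat \<Rightarrow> int \<times> int \<Rightarrow> (int \<times> int) list set" where
  "cyclic_words n v = {ws \<in> reduced_words n v. last ws + hd ws \<noteq> 0}"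

lemma finite_reduced_words [simp]: "finite (reduced_words n v)"
proof (rule finite_subset)
  show "reduced_words n v \<subseteq> {ws. set ws \<subseteq> steps \<and> length ws = n}" by (auto simp: reduced_words_def)
qed (simp add: finite_lists_length_eq)

lemma finite_cyclic_words [simp]: "finite (cyclic_words n v)"
  by (simp add: cyclic_words_def)

lemma reduced_words_0: "reduced_words 0 v = (if v = 0 then {[]} else {})"
  by (auto simp: reduced_words_def)

lemma reduced_words_1: "reduced_words 1 v = (if v \<in> steps then {[v]} else {})"
  by (auto simp: reduced_words_def length_Suc_conv)

text \<open>A letter \<open>s\<close> is put in front of a reduced word of length \<open>n\<close>.
  Either the result is reduced (\<open>A1\<close>), or \<open>s\<close> cancels the first letter
  (\<open>A2\<close>) and leaves a reduced word \<open>w\<close> of length \<open>n - 1\<close>;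
  then \<open>s\<close> may be any step except \<open>hd w\<close>, or any of the four if
  \<open>w\<close> is empty.\<close>

lemma reduced_words_rec:
  assumes "0 < n"
  shows "(\<Sum>s\<in>steps. card (reduced_words n (v - s)))
    = card (reduced_words (Suc n) v) + (if n = 1 then 4 else 3) * card (reduced_words (n - 1) v)"
proof -
  define A where "A = Sigma steps (\<lambda>s. reduced_words n (v - s))"
  define A1 where "A1 = (\<lambda>w. (hd w, tl w)) ` reduced_words (Suc n) v"
  define D where "D = Sigma (reduced_words (n - 1) v) (\<lambda>w. {s \<in> steps. w = [] \<or> s \<noteq> hd w})"
  define A2 where "A2 = (\<lambda>(w, s). (s, (- s) # w)) ` D"
  have cA: "card A = (\<Sum>s\<in>steps. card (reduced_words n (v - s)))" by (simp add: A_def)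
  have A12: "A = A1 \<union> A2"
  proof (intro equalityI subsetI)
    fix x assume "x \<in> A"
    then obtain s w where x: "x = (s, w)" and s: "s \<in> steps" and w: "w \<in> reduced_words n (v - s)"
      by (auto simp: A_def)
    obtain t w' where w': "w = t # w'" using w assms by (cases w) (auto simp: reduced_words_def)
    show "x \<in> A1 \<union> A2"
    proof (cases "s + t = 0")
      case True
      then have t: "t = - s" by (simp add: eq_neg_iff_add_eq_0 add.commute)
      have "reduced w'" "w' = [] \<or> s \<noteq> hd w'"
        using w unfolding w' t by (cases w'; auto simp: reduced_words_def)+
      then have "(w', s) \<in> D" using w s unfolding w' t by (auto simp: D_def reduced_words_def)
      then show ?thesis unfolding A2_def x w' t by force
    next
      case False
      have "s # w \<in> reduced_words (Suc n) v"
        using w s False unfolding w' by (auto simp: reduced_words_def)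
      then show ?thesis unfolding A1_def x by (intro UnI1 image_eqI[of _ _ "s # w"]) auto
    qed
  next
    fix x assume "x \<in> A1 \<union> A2"
    then show "x \<in> A"
    proof
      assume "x \<in> A1"
      then obtain w where w: "w \<in> reduced_words (Suc n) v" "x = (hd w, tl w)" by (auto simp: A1_def)
      then obtain s w' where "w = s # w'" by (cases w) (auto simp: reduced_words_def)
      then show ?thesis using w by (auto simp: A_def reduced_words_def successively_Cons)
    next
      assume "x \<in> A2"
      then obtain w s where "(w, s) \<in> D" and x: "x = (s, (- s) # w)" by (auto simp: A2_def)
      then show ?thesis using assms by (auto simp: A_def D_def reduced_words_def successively_Cons)
    qed
  qed
  have disj: "A1 \<inter> A2 = {}"
  proof -
    have "s + t \<noteq> 0" if st: "(s, t # w) \<in> A1" for s t w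
    proof -
      obtain w' where "w' \<in> reduced_words (Suc n) v" "hd w' = s" "tl w' = t # w" using st by (auto simp: A1_def)
      then show ?thesis by (cases w') (auto simp: reduced_words_def)
    qed
    from this[of s "- s" for s] show ?thesis by (auto simp: A2_def)
  qed
  have "finite A1" "finite A2" by (auto simp: A1_def A2_def D_def)
  then have "(\<Sum>s\<in>steps. card (reduced_words n (v - s))) = card A1 + card A2"
    unfolding cA[symmetric] A12 using disj by (rule card_Un_disjoint)
  moreover have "card A1 = card (reduced_words (Suc n) v)"
    unfolding A1_def
  proof (intro card_image inj_onI)
    fix x y assume "x \<in> reduced_words (Suc n) v" "y \<in> reduced_words (Suc n) v" "(hd x, tl x) = (hd y, tl y)"
    then show "x = y" by (cases x; cases y) (simp_all add: reduced_words_def)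
  qed
  moreover have "card A2 = card D" unfolding A2_def by (intro card_image inj_onI) auto
  moreover have "card D = (\<Sum>w\<in>reduced_words (n - 1) v. card {s \<in> steps. w = [] \<or> s \<noteq> hd w})"
    by (simp add: D_def)
  moreover have "\<dots> = (\<Sum>w\<in>reduced_words (n - 1) v. if n = 1 then 4 else 3)"
  proof (intro sum.cong refl)
    fix w assume w: "w \<in> reduced_words (n - 1) v"
    show "card {s \<in> steps. w = [] \<or> s \<noteq> hd w} = (if n = 1 then 4 else 3)"
    proof (cases "n = 1")
      case True
      then show ?thesis using w by (simp add: reduced_words_def)
    next
      case False
      then have "w \<noteq> []" using w assms by (auto simp: reduced_words_def)
      then have "{s \<in> steps. w = [] \<or> s \<noteq> hd w} = steps - {hd w}" "hd w \<in> steps"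
        using w by (auto simp: reduced_words_def)
      then show ?thesis using False by simp
    qed
  qed
  ultimately show ?thesis by simp
qed

text \<open>A reduced word that is not cyclically reduced is \<open>s w (-s)\<close> with
  \<open>w\<close> reduced, of the same sum. The letter \<open>s\<close> must avoid
  \<open>- hd w\<close> and \<open>last w\<close>, and these differ exactly when \<open>w\<close> is
  cyclically reduced.\<close>

lemma card_not_cyclic_words:
  assumes "0 < n"
  shows "card (reduced_words (n + 2) v - cyclic_words (n + 2) v)
    = 2 * card (cyclic_words n v) + 3 * card (reduced_words n v - cyclic_words n v)"
proof -
  define D where "D = Sigma (reduced_words n v) (\<lambda>w. {s \<in> steps. s + hd w \<noteq> 0 \<and> s \<noteq> last w})"
  have "reduced_words (n + 2) v - cyclic_words (n + 2) v = (\<lambda>(w, s). s # w @ [- s]) ` D"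
  proof (intro equalityI subsetI)
    fix x assume x: "x \<in> reduced_words (n + 2) v - cyclic_words (n + 2) v"
    then have len: "length x = n + 2" by (simp add: reduced_words_def)
    then obtain s y where y: "x = s # y" by (cases x) auto
    obtain w t where w: "y = w @ [t]" using len y by (cases y rule: rev_cases) auto
    have "last x + hd x = 0" using x by (auto simp: cyclic_words_def)
    then have t: "t = - s" unfolding y w by (simp add: eq_neg_iff_add_eq_0)
    have "w \<noteq> []" using len y w assms by auto
    then have "(w, s) \<in> D"
      using x len unfolding y w t by (auto simp: D_def reduced_words_def successively_Cons successively_append_iff)
    then show "x \<in> (\<lambda>(w, s). s # w @ [- s]) ` D" unfolding y w t by force
  next
    fix x assume "x \<in> (\<lambda>(w, s). s # w @ [- s]) ` D"
    then obtain w s where x: "x = s # w @ [- s]" "(w, s) \<in> D" by auto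
    then have "w \<noteq> []" using assms by (auto simp: D_def reduced_words_def)
    then show "x \<in> reduced_words (n + 2) v - cyclic_words (n + 2) v"
      using x by (auto simp: D_def reduced_words_def cyclic_words_def successively_Cons successively_append_iff)
  qed
  moreover have "inj_on (\<lambda>(w, s). s # w @ [- s]) D" by (intro inj_onI) auto
  ultimately have "card (reduced_words (n + 2) v - cyclic_words (n + 2) v) = card D" by (simp add: card_image)
  also have "\<dots> = (\<Sum>w\<in>reduced_words n v. card {s \<in> steps. s + hd w \<noteq> 0 \<and> s \<noteq> last w})"
    by (simp add: D_def)
  also have "\<dots> = (\<Sum>w\<in>reduced_words n v. if w \<in> cyclic_words n v then 2 else 3)"
  proof (intro sum.cong refl)
    fix w assume w: "w \<in> reduced_words n v"
    then have st: "hd w \<in> steps" "last w \<in> steps" using assms by (cases w; auto simp: reduced_words_def)+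
    have eq: "{s \<in> steps. s + hd w \<noteq> 0 \<and> s \<noteq> last w} = steps - {- hd w, last w}"
      by (auto simp: eq_neg_iff_add_eq_0)
    have "card {- hd w, last w} = (if w \<in> cyclic_words n v then 2 else 1)"
      using w by (auto simp: cyclic_words_def card_insert_if add_eq_0_iff2)
    then show "card {s \<in> steps. s + hd w \<noteq> 0 \<and> s \<noteq> last w} = (if w \<in> cyclic_words n v then 2 else 3)"
      unfolding eq using st by (subst card_Diff_subset) auto
  qed
  also have "\<dots> = 2 * card (cyclic_words n v) + 3 * card (reduced_words n v - cyclic_words n v)"
  proof -
    have sub: "cyclic_words n v \<subseteq> reduced_words n v" by (auto simp: cyclic_words_def)
    have "(\<Sum>w\<in>reduced_words n v. if w \<in> cyclic_words n v then 2 else 3 :: nat)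
      = (\<Sum>w\<in>reduced_words n v - cyclic_words n v. if w \<in> cyclic_words n v then 2 else 3)
        + (\<Sum>w\<in>cyclic_words n v. if w \<in> cyclic_words n v then 2 else 3)"
      by (rule sum.subset_diff[OF sub]) simp
    also have "\<dots> = (\<Sum>w\<in>reduced_words n v - cyclic_words n v. 3) + (\<Sum>w\<in>cyclic_words n v. 2)"
      by (intro arg_cong2[where f = "(+)"] sum.cong) auto
    finally show ?thesis by simp
  qed
  finally show ?thesis .
qed

section \<open>Generating functions of reduced and cyclically reduced words\<close>

definition reduced_fps :: "int \<times> int \<Rightarrow> complex fps" where
  "reduced_fps v = Abs_fps (\<lambda>n. of_nat (card (reduced_words n v)))"

text \<open>The constant coefficient is set by hand, since \<open>hd\<close> and \<open>last\<close>
  of the empty word are unspecified and a closed path has positive length.\<close>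

definition cyclic_fps :: "complex fps" where
  "cyclic_fps = Abs_fps (\<lambda>n. if n = 0 then 0 else of_nat (card (cyclic_words n 0)))"

lemma fps_X2_nth: "fps_nth (fps_X\<^sup>2 * f) n = (if n < 2 then 0 else fps_nth f (n - 2))" for f :: "complex fps"
  by (simp add: fps_X_power_mult_nth)

text \<open>With \<open>r\<close> and \<open>c\<close> the numbers of reduced and of cyclically
  reduced words, \<open>card_not_cyclic_words\<close> becomes
  \<open>c(n + 2) - c(n) = r(n + 2) - 3 r(n)\<close> for positive \<open>n\<close>; the lengths up
  to 2 are checked directly.\<close>

lemma cyclic_fps_eq: "(1 - fps_X\<^sup>2) * cyclic_fps = (1 - 3 * fps_X\<^sup>2) * (reduced_fps 0 - 1)"
proof (rule fps_ext)
  fix n :: nat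
  let ?r = "\<lambda>n. card (reduced_words n 0)" and ?c = "\<lambda>n. card (cyclic_words n 0)"
  have le: "?c n \<le> ?r n" for n by (intro card_mono) (auto simp: cyclic_words_def)
  have sub: "cyclic_words n 0 \<subseteq> reduced_words n 0" for n by (auto simp: cyclic_words_def)
  have diff: "card (reduced_words n 0 - cyclic_words n 0) = ?r n - ?c n" for n
    by (intro card_Diff_subset sub) simp
  have l: "(1 - fps_X\<^sup>2) * cyclic_fps = cyclic_fps - fps_X\<^sup>2 * cyclic_fps" by (simp add: algebra_simps)
  have r: "(1 - 3 * fps_X\<^sup>2) * (reduced_fps 0 - 1) = (reduced_fps 0 - 1) - fps_const 3 * (fps_X\<^sup>2 * (reduced_fps 0 - 1))"
    by (simp add: algebra_simps flip: numeral_fps_const)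
  consider "n = 0" | "n = 1" | "n = 2" | "3 \<le> n" by linarith
  then show "fps_nth ((1 - fps_X\<^sup>2) * cyclic_fps) n = fps_nth ((1 - 3 * fps_X\<^sup>2) * (reduced_fps 0 - 1)) n"
  proof cases
    case 1
    then show ?thesis unfolding l r fps_sub_nth fps_mult_left_const_nth fps_X2_nth
      by (simp add: cyclic_fps_def reduced_fps_def reduced_words_0)
  next
    case 2
    have "0 \<notin> steps" by (simp add: steps_def zero_prod_def)
    then have "reduced_words 1 0 = {}" by (simp only: reduced_words_1) simp
    moreover from this have "cyclic_words 1 0 = {}" by (simp add: cyclic_words_def)
    ultimately show ?thesis using 2 unfolding l r fps_sub_nth fps_mult_left_const_nth fps_X2_nth
      by (simp add: cyclic_fps_def reduced_fps_def)
  next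
    case 3
    have "cyclic_words 2 0 = reduced_words 2 0"
      by (auto simp: cyclic_words_def reduced_words_def length_Suc_conv numeral_2_eq_2 add.commute)
    then show ?thesis using 3 unfolding l r fps_sub_nth fps_mult_left_const_nth fps_X2_nth
      by (simp add: cyclic_fps_def reduced_fps_def reduced_words_0)
  next
    case n3: 4
    define m where "m = n - 2"
    have 4: "n = m + 2" "0 < m" using n3 by (simp_all add: m_def)
    have "?r (m + 2) - ?c (m + 2) = 2 * ?c m + 3 * (?r m - ?c m)"
      using card_not_cyclic_words[of m 0] 4 by (simp add: diff)
    then have "?r (m + 2) + ?c m = ?c (m + 2) + 3 * ?r m" using le[of m] le[of "m + 2"] by linarith
    from arg_cong[OF this, of "of_nat :: nat \<Rightarrow> complex"]
    have "(of_nat (?c (m + 2)) :: complex) - of_nat (?c m) = of_nat (?r (m + 2)) - 3 * of_nat (?r m)"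
      by (simp add: algebra_simps)
    then show ?thesis using 4 unfolding l r fps_sub_nth fps_mult_left_const_nth fps_X2_nth
      by (simp add: cyclic_fps_def reduced_fps_def)
  qed
qed

text \<open>The pointwise form of \<open>(1 - u A + 3 u^2) R = 1 - u^2\<close> for the adjacency
  operator \<open>A\<close>, as in the Ihara-Bass formula. The term \<open>- u^2\<close> corrects
  the recursion at length 2, where the empty word admits four cancelling letters instead of
  three.\<close>

lemma reduced_fps_eq:
  "(1 + 3 * fps_X\<^sup>2) * reduced_fps v = fps_X * (\<Sum>s\<in>steps. reduced_fps (v - s)) + (if v = 0 then 1 - fps_X\<^sup>2 else 0)"
proof (rule fps_ext)
  fix n :: nat
  have l: "(1 + 3 * fps_X\<^sup>2) * reduced_fps v = reduced_fps v + fps_const 3 * (fps_X\<^sup>2 * reduced_fps v)"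
    by (simp add: algebra_simps flip: numeral_fps_const)
  have S: "fps_nth (\<Sum>s\<in>steps. reduced_fps (v - s)) m = of_nat (\<Sum>s\<in>steps. card (reduced_words m (v - s)))" for m
    by (simp add: fps_sum_nth reduced_fps_def)
  have S0: "(\<Sum>s\<in>steps. card (reduced_words 0 (v - s))) = card (reduced_words 1 v)"
  proof -
    have "(\<Sum>s\<in>steps. card (reduced_words 0 (v - s))) = (\<Sum>s\<in>steps. if s = v then 1 else 0)"
      by (intro sum.cong) (auto simp: reduced_words_0)
    then show ?thesis by (simp add: reduced_words_1[unfolded One_nat_def])
  qed
  have i: "fps_nth (if v = 0 then 1 - fps_X\<^sup>2 else (0 :: complex fps)) n = (if v = 0 then (if n = 0 then 1 else if n = 2 then -1 else 0) else 0)"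
    by auto
  consider "n = 0" | "n = 1" | m where "n = Suc (Suc m)"
    by (cases n; cases "n - 1") auto
  then show "fps_nth ((1 + 3 * fps_X\<^sup>2) * reduced_fps v) n
      = fps_nth (fps_X * (\<Sum>s\<in>steps. reduced_fps (v - s)) + (if v = 0 then 1 - fps_X\<^sup>2 else 0)) n"
  proof cases
    case 1
    then show ?thesis unfolding l fps_add_nth fps_mult_left_const_nth fps_X2_nth i
      by (auto simp: reduced_fps_def reduced_words_0)
  next
    case 2
    then show ?thesis unfolding l fps_add_nth fps_mult_left_const_nth fps_X2_nth i
      by (simp add: S S0) (simp add: reduced_fps_def)
  next
    case (3 m)
    have "(\<Sum>s\<in>steps. card (reduced_words (Suc m) (v - s)))
        = card (reduced_words (Suc (Suc m)) v) + (if m = 0 then 4 else 3) * card (reduced_words m v)"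
      using reduced_words_rec[of "Suc m" v] by simp
    then show ?thesis using 3 unfolding l fps_add_nth fps_mult_left_const_nth fps_X2_nth i
      by (simp add: S) (auto simp: reduced_fps_def reduced_words_0)
  qed
qed

section \<open>Walks with backtracking and the closed form\<close>

fun line_walks :: "nat \<Rightarrow> int \<Rightarrow> nat" where
  "line_walks 0 p = (if p = 0 then 1 else 0)"
| "line_walks (Suc j) p = line_walks j (p - 1) + line_walks j (p + 1)"

lemma line_walks_eq_0: "int j < \<bar>p\<bar> \<Longrightarrow> line_walks j p = 0"
  by (induction j arbitrary: p) auto

lemma line_walks_odd: "odd (int j + p) \<Longrightarrow> line_walks j p = 0"
  by (induction j arbitrary: p) auto

text \<open>With \<open>i\<close> of the \<open>j\<close> steps upwards the endpoint is
  \<open>2 i - j\<close>; the induction is Pascal's rule.\<close>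

lemma line_walks_binomial: "line_walks j (2 * int i - int j) = j choose i"
proof (induction j arbitrary: i)
  case (Suc j)
  have e: "2 * int i - int (Suc j) + 1 = 2 * int i - int j" by simp
  show ?case
  proof (cases i)
    case 0
    then show ?thesis using Suc[of 0] line_walks_eq_0[of j "- 2 - int j"] by simp
  next
    case (Suc i')
    then have e': "2 * int i - int (Suc j) - 1 = 2 * int i' - int j" by simp
    have "line_walks (Suc j) (2 * int i - int (Suc j)) = (j choose i') + (j choose i)"
      unfolding line_walks.simps e e' using Suc.IH[of i] Suc.IH[of i'] by simp
    then show ?thesis by (simp add: Suc)
  qed
qed auto

text \<open>In the coordinates \<open>(a + b, a - b)\<close> a walk on the grid is a pair of independent walks
  on the line.\<close>

definition grid_walks :: "nat \<Rightarrow> int \<times> int \<Rightarrow> nat" where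
  "grid_walks j v = line_walks j (fst v + snd v) * line_walks j (fst v - snd v)"

lemma grid_walks_rec: "grid_walks (Suc j) v = (\<Sum>s\<in>steps. grid_walks j (v - s))"
  by (cases v) (simp add: grid_walks_def steps_def algebra_simps)

definition walks_fps :: "int \<times> int \<Rightarrow> complex fps" where
  "walks_fps v = Abs_fps (\<lambda>j. of_nat (grid_walks j v))"

lemma walks_fps_eq: "walks_fps v = (if v = 0 then 1 else 0) + fps_X * (\<Sum>s\<in>steps. walks_fps (v - s))"
proof (rule fps_ext)
  fix n :: nat
  show "fps_nth (walks_fps v) n = fps_nth ((if v = 0 then 1 else 0) + fps_X * (\<Sum>s\<in>steps. walks_fps (v - s))) n"
  proof (cases n)
    case 0
    then show ?thesis
      by (cases v) (auto simp: walks_fps_def grid_walks_def zero_prod_def)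
  next
    case (Suc m)
    then show ?thesis by (simp add: walks_fps_def grid_walks_rec fps_sum_nth)
  qed
qed

text \<open>A closed walk of length \<open>2 m\<close> is a pair of closed walks on the line, which
  produces the squared central binomial coefficient; the factor 16 undoes the denominators of
  \<open>hyp_fps\<close>.\<close>

lemma walks_fps_0: "walks_fps 0 = hyp_fps oo (fps_const 16 * fps_X\<^sup>2)"
proof (rule fps_ext)
  fix n :: nat
  have "fps_nth (hyp_fps oo (fps_const 16 * fps_X\<^sup>2)) n
      = (\<Sum>i=0..n. fps_nth hyp_fps i * (if n = 2 * i then 16 ^ i else 0))"
    unfolding fps_compose_nth power_mult_distrib fps_const_power
    by (intro sum.cong) (auto simp: fps_X_power_nth simp flip: power_mult)
  also have "\<dots> = (if even n then fps_nth hyp_fps (n div 2) * 16 ^ (n div 2) else 0)"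
  proof (cases "even n")
    case True
    then obtain m where "n = 2 * m" by blast
    then show ?thesis by (simp add: if_distrib sum.delta cong: if_cong)
  next
    case False
    then have "n \<noteq> 2 * i" for i by auto
    then show ?thesis using False by simp
  qed
  also have "\<dots> = of_nat (grid_walks n 0)"
  proof (cases "even n")
    case True
    then obtain m where m: "n = 2 * m" by blast
    then show ?thesis using line_walks_binomial[of n m]
      by (simp add: grid_walks_def hyp_fps_def power2_eq_square)
  next
    case False
    then show ?thesis using line_walks_odd[of n 0] by (simp add: grid_walks_def)
  qed
  finally show "fps_nth (walks_fps 0) n = fps_nth (hyp_fps oo (fps_const 16 * fps_X\<^sup>2)) n"
    by (simp add: walks_fps_def)
qed

text \<open>Division by \<open>1 + 3 u^2\<close> turns the recursion for reduced words into the one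
  for arbitrary walks with weight \<open>y\<close> per step. The difference \<open>\<delta>\<close>
  satisfies the homogeneous recursion at all points \<open>v\<close> together, and as
  \<open>y\<close> has no constant term, its coefficients vanish by induction.\<close>

lemma reduced_fps_walks:
  fixes y :: "complex fps"
  defines "y \<equiv> fps_X * inverse (1 + 3 * fps_X\<^sup>2)"
  shows "reduced_fps v = (1 - fps_X\<^sup>2) * inverse (1 + 3 * fps_X\<^sup>2) * (walks_fps v oo y)"
proof -
  define q :: "complex fps" where "q = 1 + 3 * fps_X\<^sup>2"
  define c where "c = (1 - fps_X\<^sup>2) * inverse q"
  have q0: "fps_nth q 0 \<noteq> 0" by (simp add: q_def)
  have qi: "inverse q * q = 1" using q0 by (rule inverse_mult_eq_1)
  have y0: "fps_nth y 0 = 0" by (simp add: y_def)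
  have yq: "y = fps_X * inverse q" by (simp add: y_def q_def)
  define \<delta> where "\<delta> = (\<lambda>v. reduced_fps v - c * (walks_fps v oo y))"
  have 1: "reduced_fps v = y * (\<Sum>s\<in>steps. reduced_fps (v - s)) + (if v = 0 then c else 0)" for v
  proof -
    have "reduced_fps v = (inverse q * q) * reduced_fps v" by (simp add: qi)
    also have "\<dots> = inverse q * (fps_X * (\<Sum>s\<in>steps. reduced_fps (v - s)) + (if v = 0 then 1 - fps_X\<^sup>2 else 0))"
      unfolding reduced_fps_eq[of v, symmetric] q_def by (simp only: mult.assoc)
    finally show ?thesis by (simp add: yq c_def algebra_simps)
  qed
  have 2: "walks_fps v oo y = (if v = 0 then 1 else 0) + y * (\<Sum>s\<in>steps. walks_fps (v - s) oo y)" for v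
  proof -
    have "walks_fps v oo y = ((if v = 0 then 1 else 0) + fps_X * (\<Sum>s\<in>steps. walks_fps (v - s))) oo y"
      using walks_fps_eq[of v] by simp
    also have "\<dots> = (if v = 0 then 1 else 0) + y * ((\<Sum>s\<in>steps. walks_fps (v - s)) oo y)"
      using y0 by (auto simp: fps_compose_add_distrib fps_compose_mult_distrib fps_X_fps_compose_startby0)
    finally show ?thesis by (simp add: fps_compose_sum_distrib)
  qed
  have \<delta>: "\<delta> v = y * (\<Sum>s\<in>steps. \<delta> (v - s))" for v
  proof -
    have "\<delta> v = y * (\<Sum>s\<in>steps. reduced_fps (v - s)) - c * (y * (\<Sum>s\<in>steps. walks_fps (v - s) oo y))"
      unfolding \<delta>_def using 1[of v] 2[of v] by (cases "v = 0") (simp_all add: distrib_left)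
    then show ?thesis
      by (simp add: \<delta>_def sum_subtractf sum_distrib_left right_diff_distrib mult_ac)
  qed
  have "fps_nth (\<delta> v) n = 0" for n v
  proof (induction n arbitrary: v rule: less_induct)
    case (less n)
    have "fps_nth (\<delta> v) n = (\<Sum>i=0..n. fps_nth y i * (\<Sum>s\<in>steps. fps_nth (\<delta> (v - s)) (n - i)))"
      by (subst \<delta>) (simp add: fps_mult_nth fps_sum_nth)
    also have "\<dots> = 0"
    proof (intro sum.neutral ballI)
      fix i assume "i \<in> {0..n}"
      then show "fps_nth y i * (\<Sum>s\<in>steps. fps_nth (\<delta> (v - s)) (n - i)) = 0"
        using less y0 by (cases "i = 0") auto
    qed
    finally show ?case .
  qed
  then have "\<delta> v = 0" by (simp add: fps_eq_iff)
  then show ?thesis by (simp add: \<delta>_def c_def q_def)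
qed

theorem cyclic_fps_closed_form:
  fixes k :: "complex fps"
  defines "k \<equiv> 16 * fps_X\<^sup>2 * inverse ((1 + 3 * fps_X\<^sup>2)\<^sup>2)"
  shows "cyclic_fps = (1 - 3 * fps_X\<^sup>2) * ((hyp_fps oo k) * inverse (1 + 3 * fps_X\<^sup>2) - inverse (1 - fps_X\<^sup>2))"
proof -
  define q :: "complex fps" where "q = 1 + 3 * fps_X\<^sup>2"
  define r :: "complex fps" where "r = 1 - fps_X\<^sup>2"
  define y where "y = fps_X * inverse q"
  have y0: "fps_nth y 0 = 0" by (simp add: y_def)
  have "walks_fps 0 oo y = hyp_fps oo ((fps_const 16 * fps_X\<^sup>2) oo y)"
    unfolding walks_fps_0 using y0 by (intro fps_compose_assoc[symmetric]) (auto simp: power2_eq_square)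
  also have "(fps_const 16 * fps_X\<^sup>2) oo y = k"
  proof -
    have "(fps_const 16 * fps_X\<^sup>2) oo y = fps_const 16 * y\<^sup>2"
      using y0 by (simp add: fps_compose_mult_distrib power2_eq_square fps_X_fps_compose_startby0)
    also have "\<dots> = k"
      by (simp add: k_def y_def q_def power_mult_distrib fps_inverse_power numeral_fps_const)
    finally show ?thesis .
  qed
  finally have w: "reduced_fps 0 = r * inverse q * (hyp_fps oo k)"
    using reduced_fps_walks[of 0] by (simp add: y_def q_def r_def)
  have r1: "inverse r * r = 1" by (rule inverse_mult_eq_1) (simp add: r_def)
  have "cyclic_fps = inverse r * r * cyclic_fps" by (simp add: r1)
  also have "\<dots> = inverse r * ((1 - 3 * fps_X\<^sup>2) * (r * inverse q * (hyp_fps oo k) - 1))"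
    using cyclic_fps_eq unfolding w r_def[symmetric] mult.assoc by simp
  also have "\<dots> = (1 - 3 * fps_X\<^sup>2) * (inverse r * r * (inverse q * (hyp_fps oo k)) - inverse r)"
    by (simp add: algebra_simps)
  finally show ?thesis unfolding r1 by (simp add: q_def r_def mult.commute)
qed

section \<open>Periods of cyclic lists\<close>

text \<open>The periodic extension to all indices: statements about cyclic neighbours and periods
  lose their reduction modulo the length.\<close>

definition per :: "'a list \<Rightarrow> nat \<Rightarrow> 'a" where
  "per xs i = xs ! (i mod length xs)"

lemma per_add_length [simp]: "per xs (i + length xs) = per xs i"
  by (simp add: per_def)

lemma per_add_mult_length [simp]: "per xs (i + m * length xs) = per xs i"
  by (simp add: per_def)

lemma per_nth: "i < length xs \<Longrightarrow> per xs i = xs ! i"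
  by (simp add: per_def)

lemma per_eqI:
  assumes "length xs = length ys" "\<And>i. i < length xs \<Longrightarrow> per xs i = per ys i"
  shows "xs = ys"
  using assms by (intro nth_equalityI) (auto simp: per_nth)

lemma per_map: "xs \<noteq> [] \<Longrightarrow> per (map f xs) i = f (per xs i)"
  by (simp add: per_def)

lemma per_rotate: "xs \<noteq> [] \<Longrightarrow> per (rotate k xs) i = per xs (i + k)"
  by (simp add: per_def nth_rotate mod_simps add.commute)

lemma length_concat_replicate: "length (concat (replicate k ws)) = k * length ws"
  by (induction k) auto

lemma nth_concat_replicate: "i < k * length ws \<Longrightarrow> concat (replicate k ws) ! i = ws ! (i mod length ws)"
proof (induction k arbitrary: i)
  case (Suc k)
  show ?case
  proof (cases "i < length ws")
    case False
    then show ?thesis using Suc.IH[of "i - length ws"] Suc.prems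
      by (simp add: nth_append le_mod_geq)
  qed (simp add: nth_append)
qed simp

lemma per_concat_replicate:
  assumes "0 < k" "ws \<noteq> []"
  shows "per (concat (replicate k ws)) i = per ws i"
proof -
  have "i mod (k * length ws) < k * length ws" using assms by simp
  then show ?thesis
    by (simp add: per_def length_concat_replicate nth_concat_replicate mod_mod_cancel)
qed

lemma concat_replicate_per:
  assumes "0 < d" "\<And>i. per xs (i + d) = per xs i" "length xs = k * d"
  shows "xs = concat (replicate k (map (per xs) [0..<d]))"
proof (rule nth_equalityI)
  let ?p = "map (per xs) [0..<d]"
  show "length xs = length (concat (replicate k ?p))" using assms by (simp add: length_concat_replicate)
  fix i assume i: "i < length xs"
  have "per xs (j + m * d) = per xs j" for j m
    by (induction m) (use assms(2)[of "j + _ * d"] in \<open>auto simp: add_ac\<close>)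
  from this[of "i mod d" "i div d"] have "per xs i = per xs (i mod d)" by simp
  then show "xs ! i = concat (replicate k ?p) ! i"
    using i assms by (simp add: nth_concat_replicate per_nth)
qed

lemma period_gcd:
  fixes f :: "nat \<Rightarrow> 'a"
  assumes "0 < m" "\<And>i. f (i + m) = f i" "\<And>i. f (i + n) = f i"
  shows "f (i + gcd m n) = f i"
proof -
  have mult: "f (i + k * d) = f i" if "\<And>i. f (i + d) = f i" for i k d
    by (induction k) (use that[of "i + _ * d"] in \<open>auto simp: add_ac\<close>)
  obtain x y where xy: "m * x = n * y + gcd m n" using bezout_nat[of m n] assms(1) by auto
  have "f (i + gcd m n) = f (i + gcd m n + y * n)" using mult[OF assms(3)] by simp
  also have "\<dots> = f (i + x * m)" using xy by (simp add: algebra_simps)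
  also have "\<dots> = f i" using mult[OF assms(2)] by simp
  finally show ?thesis .
qed

text \<open>The gcd of the length and a period is again a period, and it divides the length, so the
  list is a power of its initial block of that size.\<close>

lemma primitive_path_iff:
  assumes "xs \<noteq> []"
  shows "primitive_path xs \<longleftrightarrow> (\<forall>d>0. (\<forall>i. per xs (i + d) = per xs i) \<longrightarrow> length xs dvd d)"
proof
  assume prim: "primitive_path xs"
  show "\<forall>d>0. (\<forall>i. per xs (i + d) = per xs i) \<longrightarrow> length xs dvd d"
  proof (intro allI impI)
    fix d :: nat assume d: "0 < d" "\<forall>i. per xs (i + d) = per xs i"
    define g where "g = gcd (length xs) d"
    have g0: "0 < g" using d by (simp add: g_def)
    have g: "per xs (i + g) = per xs i" for i
      unfolding g_def using period_gcd[of "length xs" "per xs" d i] assms d by auto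
    obtain k where k: "length xs = k * g" unfolding g_def by (metis dvdE gcd_dvd1 mult.commute)
    have "xs = concat (replicate k (map (per xs) [0..<g]))" by (rule concat_replicate_per[OF g0 g k])
    then have "\<not> 2 \<le> k" using prim unfolding primitive_path_def by blast
    moreover have "k \<noteq> 0" using k assms by (cases k) auto
    ultimately have "length xs = g" using k by (simp add: numeral_2_eq_2 not_less_eq_eq)
    then show "length xs dvd d" by (metis g_def gcd_dvd2)
  qed
next
  assume R: "\<forall>d>0. (\<forall>i. per xs (i + d) = per xs i) \<longrightarrow> length xs dvd d"
  show "primitive_path xs"
    unfolding primitive_path_def
  proof
    assume "\<exists>ws k. 2 \<le> k \<and> xs = concat (replicate k ws)"
    then obtain ws k where k: "2 \<le> k" "xs = concat (replicate k ws)" by blast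
    have ws: "ws \<noteq> []" using assms k by auto
    have "per xs (i + length ws) = per xs i" for i
      unfolding k(2) using k(1) ws by (simp add: per_concat_replicate)
    then have "length xs dvd length ws" using R ws by auto
    then show False using k ws by (auto simp: length_concat_replicate dest!: dvd_imp_le)
  qed
qed

section \<open>Closed paths without backtracking as cyclic words\<close>

definition nb_closed_paths :: "(int \<times> int) list set" where
  "nb_closed_paths = {vs. closed_path vs \<and> \<not> backtracking vs}"

lemma grid_adj_iff: "grid_adj x y \<longleftrightarrow> y - x \<in> steps"
  unfolding grid_adj_def cayley_adj_def steps_def
  by (cases x; cases y) auto

lemma all_per_iff: "xs \<noteq> [] \<Longrightarrow> (\<forall>i. P (i mod length xs)) \<longleftrightarrow> (\<forall>i<length xs. P i)"
  by (metis length_greater_0_conv mod_less mod_less_divisor)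

lemma nb_closed_paths_iff:
  "vs \<in> nb_closed_paths \<longleftrightarrow>
     vs \<noteq> [] \<and> (\<forall>i. per vs (i + 1) - per vs i \<in> steps) \<and> (\<forall>i. per vs (i + 2) \<noteq> per vs i)"
proof (cases "vs = []")
  case True
  then show ?thesis by (simp add: nb_closed_paths_def closed_path_def)
next
  case False
  have 1: "(\<forall>i. per vs (i + 1) - per vs i \<in> steps) \<longleftrightarrow> (\<forall>i<length vs. grid_adj (vs ! i) (vs ! ((i + 1) mod length vs)))"
    using all_per_iff[OF False, of "\<lambda>i. grid_adj (vs ! i) (vs ! ((i + 1) mod length vs))"]
    by (simp add: per_def grid_adj_iff mod_simps)
  have "(\<forall>i. per vs (i + 2) \<noteq> per vs i) \<longleftrightarrow> (\<forall>i<length vs. vs ! ((i + 2) mod length vs) \<noteq> vs ! i)"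
    using all_per_iff[OF False, of "\<lambda>i. vs ! ((i + 2) mod length vs) \<noteq> vs ! i"]
    by (simp add: per_def mod_simps)
  also have "\<dots> \<longleftrightarrow> \<not> backtracking vs" unfolding backtracking_def by metis
  finally show ?thesis unfolding 1 using False
    by (auto simp: nb_closed_paths_def closed_path_def)
qed

text \<open>Starting at the origin picks one representative from each translation class of closed
  paths with a marked starting point.\<close>

definition rooted_paths :: "nat \<Rightarrow> (int \<times> int) list set" where
  "rooted_paths n = {vs \<in> nb_closed_paths. length vs = n \<and> per vs 0 = 0}"

lemma cyclic_words_iff:
  assumes "0 < n"
  shows "ws \<in> cyclic_words n v \<longleftrightarrow> length ws = n \<and> (\<forall>i. per ws i \<in> steps) \<and>
    (\<forall>i. per ws i + per ws (i + 1) \<noteq> 0) \<and> sum_list ws = v"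
proof (cases "length ws = n")
  case True
  then have ne: "ws \<noteq> []" using assms by auto
  have 1: "(\<forall>i. per ws i \<in> steps) \<longleftrightarrow> set ws \<subseteq> steps"
    using all_per_iff[OF ne, of "\<lambda>i. ws ! i \<in> steps"] by (auto simp: per_def set_conv_nth)
  have "(\<forall>i. per ws i + per ws (i + 1) \<noteq> 0) \<longleftrightarrow> (\<forall>i<n. ws ! i + ws ! ((i + 1) mod n) \<noteq> 0)"
    using all_per_iff[OF ne, of "\<lambda>i. ws ! i + ws ! ((i + 1) mod n) \<noteq> 0"] True
    by (simp add: per_def mod_simps)
  also have "\<dots> \<longleftrightarrow> reduced ws \<and> last ws + hd ws \<noteq> 0"
  proof -
    obtain m where m: "n = Suc m" using assms by (cases n) auto
    have "(\<forall>i<n. ws ! i + ws ! ((i + 1) mod n) \<noteq> 0)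
        \<longleftrightarrow> (\<forall>i<m. ws ! i + ws ! ((i + 1) mod n) \<noteq> 0) \<and> ws ! m + ws ! 0 \<noteq> 0"
      unfolding m by (auto simp: less_Suc_eq)
    moreover have "(\<forall>i<m. ws ! i + ws ! ((i + 1) mod n) \<noteq> 0) \<longleftrightarrow> (\<forall>i<m. ws ! i + ws ! (Suc i) \<noteq> 0)"
      by (simp add: m)
    moreover have "ws ! m = last ws" "ws ! 0 = hd ws"
      using ne True m by (simp_all add: last_conv_nth hd_conv_nth)
    ultimately show ?thesis using True m by (auto simp: successively_conv_nth)
  qed
  finally show ?thesis unfolding 1 using True by (auto simp: cyclic_words_def reduced_words_def)
qed (auto simp: cyclic_words_def reduced_words_def)

definition step_word :: "(int \<times> int) list \<Rightarrow> (int \<times> int) list" where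
  "step_word vs = map (\<lambda>i. per vs (i + 1) - per vs i) [0..<length vs]"

definition word_path :: "(int \<times> int) list \<Rightarrow> (int \<times> int) list" where
  "word_path ws = map (\<lambda>i. sum_list (take i ws)) [0..<length ws]"

lemma per_step_word: "vs \<noteq> [] \<Longrightarrow> per (step_word vs) i = per vs (i + 1) - per vs i"
  by (simp add: per_def step_word_def mod_simps)

lemma per_word_path:
  assumes "ws \<noteq> []" "sum_list ws = 0"
  shows "per (word_path ws) (i + 1) - per (word_path ws) i = per ws i"
proof -
  let ?n = "length ws"
  define j where "j = i mod ?n"
  have j: "j < ?n" using assms by (simp add: j_def)
  have P: "per (word_path ws) i = sum_list (take j ws)"
    using j by (simp add: per_def word_path_def j_def)
  have "per (word_path ws) (i + 1) = sum_list (take (Suc j) ws)"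
  proof (cases "Suc j < ?n")
    case True
    then have "(i + 1) mod ?n = Suc j" by (simp add: j_def mod_Suc)
    then show ?thesis using True by (simp add: per_def word_path_def)
  next
    \<comment> \<open>The wrap-around step; here the condition \<open>sum_list ws = 0\<close> closes
      the path.\<close>
    case False
    then have "Suc j = ?n" using j by simp
    moreover from this have "(i + 1) mod ?n = 0" by (simp add: j_def mod_Suc)
    ultimately show ?thesis using assms by (simp add: per_def word_path_def)
  qed
  then show ?thesis unfolding P using j by (simp add: take_Suc_conv_app_nth per_def j_def)
qed

lemma bij_step_word:
  assumes "0 < n"
  shows "bij_betw step_word (rooted_paths n) (cyclic_words n 0)"
proof (rule bij_betw_byWitness[where f' = word_path])
  have part: "sum_list (map (\<lambda>i. per vs (i + 1) - per vs i) [0..<m]) = per vs m - per vs 0" for vs :: "(int \<times> int) list" and m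
    by (induction m) auto
  show "\<forall>vs\<in>rooted_paths n. word_path (step_word vs) = vs"
  proof
    fix vs assume vs: "vs \<in> rooted_paths n"
    show "word_path (step_word vs) = vs"
    proof (rule nth_equalityI)
      show "length (word_path (step_word vs)) = length vs" by (simp add: word_path_def step_word_def)
      fix i assume "i < length (word_path (step_word vs))"
      then have i: "i < length vs" by (simp add: word_path_def step_word_def)
      then have "word_path (step_word vs) ! i = sum_list (map (\<lambda>i. per vs (i + 1) - per vs i) [0..<i])"
        by (simp add: word_path_def step_word_def take_map)
      also have "\<dots> = vs ! i" using vs i part[of vs i] by (simp add: rooted_paths_def per_nth)
      finally show "word_path (step_word vs) ! i = vs ! i" .
    qed
  qed
  show "\<forall>ws\<in>cyclic_words n 0. step_word (word_path ws) = ws"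
  proof
    fix ws assume ws: "ws \<in> cyclic_words n 0"
    then have "ws \<noteq> []" "sum_list ws = 0" using assms by (auto simp: cyclic_words_iff)
    moreover have "word_path ws \<noteq> []" using \<open>ws \<noteq> []\<close> by (simp add: word_path_def)
    moreover have "length (step_word (word_path ws)) = length ws" by (simp add: step_word_def word_path_def)
    ultimately show "step_word (word_path ws) = ws"
      by (intro per_eqI) (simp_all add: per_step_word per_word_path[simplified])
  qed
  show "step_word ` rooted_paths n \<subseteq> cyclic_words n 0"
  proof (intro image_subsetI)
    fix vs assume vs: "vs \<in> rooted_paths n"
    then have ne: "vs \<noteq> []" using assms by (auto simp: rooted_paths_def)
    have "sum_list (step_word vs) = 0"
      unfolding step_word_def part using per_add_length[of vs 0] by simp
    moreover have "per (step_word vs) i + per (step_word vs) (i + 1) = per vs (i + 2) - per vs i" for i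
      using ne by (simp add: per_step_word)
    ultimately show "step_word vs \<in> cyclic_words n 0"
      using vs ne assms per_step_word[OF ne]
      by (simp add: cyclic_words_iff rooted_paths_def nb_closed_paths_iff) (simp add: step_word_def)
  qed
  show "word_path ` cyclic_words n 0 \<subseteq> rooted_paths n"
  proof (intro image_subsetI)
    fix ws assume ws: "ws \<in> cyclic_words n 0"
    then have *: "ws \<noteq> []" "sum_list ws = 0" "length ws = n" using assms by (auto simp: cyclic_words_iff)
    have d: "per (word_path ws) (i + 1) - per (word_path ws) i = per ws i" for i
      using * by (intro per_word_path)
    have "per (word_path ws) (i + 2) - per (word_path ws) i = per ws i + per ws (i + 1)" for i
      using d[of i] d[of "i + 1"] by (simp add: algebra_simps)
    then have "per (word_path ws) (i + 2) \<noteq> per (word_path ws) i" for i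
      using ws assms by (metis cyclic_words_iff diff_self)
    moreover have "per (word_path ws) 0 = 0" "word_path ws \<noteq> []" "length (word_path ws) = n"
      using * by (auto simp: per_def word_path_def)
    ultimately show "word_path ws \<in> rooted_paths n"
      using ws d assms by (simp add: rooted_paths_def nb_closed_paths_iff cyclic_words_iff)
  qed
qed

lemma finite_rooted_paths [simp]: "0 < n \<Longrightarrow> finite (rooted_paths n)"
  using bij_betw_finite[OF bij_step_word] by simp

lemma card_rooted_paths: "0 < n \<Longrightarrow> card (rooted_paths n) = card (cyclic_words n 0)"
  using bij_betw_same_card[OF bij_step_word] .

text \<open>A crude bound, enough for absolute convergence when \<open>norm u < 1/4\<close>.\<close>

lemma card_cyclic_words_le: "card (cyclic_words n v) \<le> 4 ^ n"
proof -
  have "card (cyclic_words n v) \<le> card {ws. set ws \<subseteq> steps \<and> length ws = n}"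
    by (intro card_mono finite_lists_length_eq) (auto simp: cyclic_words_def reduced_words_def)
  then show ?thesis by (simp add: card_lists_length_eq)
qed

section \<open>Primitive roots and translation orbits\<close>

definition rooted_primes :: "(int \<times> int) list set" where
  "rooted_primes = {p \<in> nb_closed_paths. primitive_path p \<and> per p 0 = 0}"

text \<open>Existence and uniqueness of the primitive root. The root is the initial block whose
  length is the smallest period; equal powers have the same periodic extension, so the lengths of
  two roots divide each other.\<close>

lemma bij_concat_replicate:
  "bij_betw (\<lambda>(p, m). concat (replicate m p)) (rooted_primes \<times> {1..}) (\<Union>n\<in>{1..}. rooted_paths n)"
  unfolding bij_betw_def
proof (intro conjI inj_onI equalityI subsetI)
  fix x y assume xy: "x \<in> rooted_primes \<times> {1..}" "y \<in> rooted_primes \<times> {1..}"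
    "(case x of (p, m) \<Rightarrow> concat (replicate m p)) = (case y of (p, m) \<Rightarrow> concat (replicate m p))"
  obtain p m q r where x: "x = (p, m)" and y: "y = (q, r)" by (cases x; cases y)
  have p: "p \<noteq> []" "primitive_path p" "0 < m" and q: "q \<noteq> []" "primitive_path q" "0 < r"
    using xy unfolding x y by (auto simp: rooted_primes_def nb_closed_paths_iff)
  have eq: "concat (replicate m p) = concat (replicate r q)" using xy unfolding x y by simp
  have per: "per p i = per q i" for i
    using per_concat_replicate[OF p(3,1), of i] per_concat_replicate[OF q(3,1), of i] eq by simp
  have "length p dvd length q"
    using p(2) q(1) unfolding primitive_path_iff[OF p(1)] by (auto simp: per)
  moreover have "length q dvd length p"
    using q(2) p(1) unfolding primitive_path_iff[OF q(1)] by (auto simp flip: per)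
  ultimately have len: "length p = length q" by (rule dvd_antisym)
  then have "p = q" by (intro per_eqI) (auto simp: per)
  moreover have "m * length p = r * length q" using arg_cong[OF eq, of length] by (simp add: length_concat_replicate)
  then have "m = r" using len p(1) q(1) by simp
  ultimately show "x = y" by (simp add: x y)
next
  fix w assume "w \<in> (\<lambda>(p, m). concat (replicate m p)) ` (rooted_primes \<times> {1..})"
  then obtain p m where p: "p \<in> rooted_primes" "1 \<le> m" and w: "w = concat (replicate m p)" by auto
  then have ne: "p \<noteq> []" by (auto simp: rooted_primes_def nb_closed_paths_iff)
  have per: "per w i = per p i" for i unfolding w using p ne by (intro per_concat_replicate) auto
  have "w \<noteq> []" using ne p by (simp add: w)
  then have "w \<in> rooted_paths (length w)"
    using p by (auto simp: rooted_paths_def rooted_primes_def nb_closed_paths_iff per)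
  moreover have "1 \<le> length w" using \<open>w \<noteq> []\<close> by (simp add: Suc_le_eq)
  ultimately show "w \<in> (\<Union>n\<in>{1..}. rooted_paths n)" by auto
next
  fix w assume "w \<in> (\<Union>n\<in>{1..}. rooted_paths n)"
  then have w: "w \<in> nb_closed_paths" "per w 0 = 0" by (auto simp: rooted_paths_def)
  then have ne: "w \<noteq> []" by (simp add: nb_closed_paths_iff)
  let ?P = "\<lambda>d. 0 < d \<and> (\<forall>i. per w (i + d) = per w i)"
  define d where "d = (LEAST d. ?P d)"
  have "?P (length w)" using ne by simp
  then have d: "?P d" unfolding d_def by (rule LeastI)
  have min: "d \<le> e" if "?P e" for e unfolding d_def using that by (rule Least_le)
  have "?P (gcd (length w) d)" using period_gcd[of "length w" "per w" d] d ne by auto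
  then have "d \<le> gcd (length w) d" by (rule min)
  then have "d dvd length w"
    by (metis d dvd_imp_le gcd_dvd1 gcd_dvd2 le_antisym)
  then obtain k where k: "length w = k * d" by (metis dvdE mult.commute)
  define p where "p = map (per w) [0..<d]"
  have wp: "w = concat (replicate k p)" unfolding p_def using d k by (intro concat_replicate_per) auto
  have k0: "0 < k" using k ne by (intro gr0I) auto
  have pne: "p \<noteq> []" using d by (simp add: p_def)
  have per: "per p i = per w i" for i using per_concat_replicate[OF k0 pne, of i] wp by simp
  have "length p dvd e" if "0 < e" "\<forall>i. per p (i + e) = per p i" for e
  proof -
    have "?P (gcd d e)" using period_gcd[of d "per w" e] d that by (auto simp: per)
    then have "d \<le> gcd d e" by (rule min)
    then have "gcd d e = d" using d by (intro antisym gcd_le1_nat) auto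
    then have "d dvd e" using gcd_dvd2[of d e] by simp
    then show ?thesis by (simp add: p_def)
  qed
  then have "p \<in> rooted_primes"
    using w pne by (auto simp: rooted_primes_def nb_closed_paths_iff per primitive_path_iff)
  then show "w \<in> (\<lambda>(p, m). concat (replicate m p)) ` (rooted_primes \<times> {1..})"
    using wp k0 by (intro image_eqI[of _ _ "(p, k)"]) auto
qed

definition path_orbit :: "(int \<times> int) list \<Rightarrow> (int \<times> int) list set set" where
  "path_orbit p = translation_orbit (cyclic_class p)"

lemma translate_cyclic_class: "translate g (cyclic_class p) = cyclic_class (map ((+) g) p)"
  by (auto simp: translate_def cyclic_class_def rotate_map image_image)

lemma path_orbit_map: "path_orbit (map ((+) g) p) = path_orbit p"
proof -
  have "translate h (cyclic_class (map ((+) g) p)) = translate (h + g) (cyclic_class p)" for h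
    by (simp add: translate_cyclic_class comp_def add.assoc[abs_def] fun_eq_iff cong: map_cong)
  then have "path_orbit (map ((+) g) p) = (\<lambda>h. translate (h + g) (cyclic_class p)) ` UNIV"
    by (simp add: path_orbit_def translation_orbit_def)
  also have "\<dots> = (\<lambda>h. translate h (cyclic_class p)) ` range (\<lambda>h. h + g)" by (simp only: image_image)
  also have "range (\<lambda>h. h + g) = UNIV" by (rule surj_plus_right)
  finally show ?thesis by (simp add: path_orbit_def translation_orbit_def)
qed

lemma cyclic_class_rotate: "cyclic_class (rotate k p) = cyclic_class p"
proof (cases "p = []")
  case False
  let ?n = "length p"
  show ?thesis
  proof (intro equalityI subsetI)
    fix x assume "x \<in> cyclic_class p"
    then obtain j where x: "x = rotate j p" by (auto simp: cyclic_class_def)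
    have "rotate (j + (?n - k mod ?n)) (rotate k p) = rotate ((j + (?n - k mod ?n) + k) mod ?n) p"
      by (simp add: rotate_rotate rotate_conv_mod[symmetric])
    also have "(j + (?n - k mod ?n) + k) mod ?n = j mod ?n"
    proof -
      have "k mod ?n \<le> ?n" using False by (simp add: less_imp_le)
      moreover have "k mod ?n \<le> k" by simp
      ultimately have "j + (?n - k mod ?n) + k = j + ?n + (k - k mod ?n)" by linarith
      also have "\<dots> = j + ?n + ?n * (k div ?n)" by (simp add: minus_mod_eq_mult_div)
      also have "\<dots> mod ?n = j mod ?n" by simp
      finally show ?thesis .
    qed
    also have "rotate (j mod ?n) p = x" by (simp add: x rotate_conv_mod[symmetric])
    finally show "x \<in> cyclic_class (rotate k p)" unfolding cyclic_class_def by (metis rangeI)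
  qed (auto simp: cyclic_class_def rotate_rotate)
qed (simp add: cyclic_class_def)

text \<open>The path started at its \<open>j\<close>-th vertex and moved back to the origin; these
  are the rooted members of one orbit.\<close>

definition rebase :: "nat \<Rightarrow> (int \<times> int) list \<Rightarrow> (int \<times> int) list" where
  "rebase j p = map ((+) (- per p j)) (rotate j p)"

lemma path_orbit_rebase: "path_orbit (rebase j p) = path_orbit p"
  unfolding rebase_def path_orbit_map by (simp add: path_orbit_def cyclic_class_rotate)

lemma length_rebase [simp]: "length (rebase j p) = length p"
  by (simp add: rebase_def)

lemma per_rebase: "p \<noteq> [] \<Longrightarrow> per (rebase j p) i = per p (i + j) - per p j"
  by (simp add: rebase_def per_map per_rotate)

text \<open>Adding a multiple of the length moves any index beyond \<open>j\<close> without changing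
  the vertex.\<close>

lemma period_shift:
  assumes "p \<noteq> []" "\<And>i. i \<ge> j \<Longrightarrow> per p (i + d) = per p i + g"
  shows "per p (i + d) = per p i + (g :: 'a :: monoid_add)"
proof -
  have "j \<le> i + j * length p" using assms by (cases "length p") auto
  from assms(2)[OF this] show ?thesis
    by (metis add.assoc add.commute per_add_mult_length)
qed

lemma rebase_in_rooted_primes:
  assumes "p \<in> nb_closed_paths" "primitive_path p"
  shows "rebase j p \<in> rooted_primes"
proof -
  have ne: "p \<noteq> []" using assms by (simp add: nb_closed_paths_iff)
  then have ne': "rebase j p \<noteq> []" by (metis length_0_conv length_rebase)
  have "length p dvd d" if d: "0 < d" "\<forall>i. per (rebase j p) (i + d) = per (rebase j p) i" for d
  proof -
    have "per p (i + d) = per p i" if "j \<le> i" for i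
    proof -
      have "per p (i - j + d + j) = per p (i - j + j)" using d(2)[rule_format, of "i - j"] ne by (simp add: per_rebase)
      then show ?thesis using that by (simp add: add_ac)
    qed
    then have "per p (i + d) = per p i" for i using period_shift[of p j d 0 i] ne by simp
    then show ?thesis using assms(2) d(1) by (auto simp: primitive_path_iff[OF ne])
  qed
  then have "primitive_path (rebase j p)" by (simp add: primitive_path_iff[OF ne'])
  moreover have "rebase j p \<in> nb_closed_paths"
    unfolding nb_closed_paths_iff
  proof (intro conjI allI)
    fix i
    have "per p (i + j + 1) - per p (i + j) \<in> steps" "per p (i + j + 2) \<noteq> per p (i + j)"
      using assms unfolding nb_closed_paths_iff by blast+
    then show "per (rebase j p) (i + 1) - per (rebase j p) i \<in> steps" "per (rebase j p) (i + 2) \<noteq> per (rebase j p) i"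
      using ne by (simp_all add: per_rebase add_ac)
  qed (rule ne')
  moreover have "per (rebase j p) 0 = 0" using ne by (simp add: per_rebase)
  ultimately show ?thesis by (simp add: rooted_primes_def)
qed

text \<open>If two of them agree, an index shift \<open>d\<close> acts on the path as a translation
  by \<open>g\<close>. After \<open>length p\<close> such shifts the path is back at the same
  vertex, so \<open>length p\<close> times \<open>g\<close> is 0 and \<open>g = 0\<close>, the
  translation group being torsion-free; then \<open>d\<close> is a period shorter than the length.
  This is where freeness of the translation action enters.\<close>

lemma inj_on_rebase:
  assumes "p \<in> rooted_primes"
  shows "inj_on (\<lambda>j. rebase j p) {..<length p}"
proof (rule linorder_inj_onI')
  have ne: "p \<noteq> []" and prim: "primitive_path p" using assms by (auto simp: rooted_primes_def nb_closed_paths_iff)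
  fix i j assume ij: "i \<in> {..<length p}" "j \<in> {..<length p}" "i < j"
  show "rebase i p \<noteq> rebase j p"
  proof
    assume eq: "rebase i p = rebase j p"
    define d where "d = j - i"
    define g where "g = per p j - per p i"
    have "per p (x + d) = per p x + g" if x: "i \<le> x" for x
    proof -
      have "per p (x - i + i) - per p i = per p (x - i + j) - per p j"
        using arg_cong[OF eq, of "\<lambda>q. per q (x - i)"] ne by (simp add: per_rebase)
      moreover have "x - i + i = x" "x - i + j = x + d" using x ij by (auto simp: d_def)
      ultimately show ?thesis by (simp add: g_def algebra_simps)
    qed
    then have step: "per p (x + d) = per p x + g" for x using period_shift[of p i d g x] ne by blast
    have "per p (x + m * d) = per p x + (of_nat m * fst g, of_nat m * snd g)" for x m
    proof (induction m)
      case (Suc m)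
      have "per p (x + Suc m * d) = per p (x + m * d) + g" using step[of "x + m * d"] by (simp add: add_ac)
      then show ?case unfolding Suc by (cases g) (simp add: algebra_simps)
    qed (simp flip: zero_prod_def)
    from this[of 0 "length p"] have "(of_nat (length p) * fst g, of_nat (length p) * snd g) = (0 :: int \<times> int)"
      using per_add_mult_length[of p 0 d] by (simp add: mult.commute)
    then have "g = 0" using ne by (cases g) (simp add: zero_prod_def)
    then have "length p dvd d" using prim step ij unfolding primitive_path_iff[OF ne] by (auto simp: d_def)
    then show False using ij by (auto simp: d_def dest!: dvd_imp_le)
  qed
qed

text \<open>Together with \<open>inj_on_rebase\<close>, each orbit contains exactly as many rooted
  primes as its length; this cancels the factor \<open>1 / length\<close> in the logarithm of the
  Euler product.\<close>

lemma path_orbit_fiber: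
  assumes p: "p \<in> rooted_primes"
  shows "{q \<in> rooted_primes. path_orbit q = path_orbit p} = (\<lambda>j. rebase j p) ` {..<length p}"
proof (intro equalityI subsetI)
  have ne: "p \<noteq> []" using p by (auto simp: rooted_primes_def nb_closed_paths_iff)
  fix q assume "q \<in> {q \<in> rooted_primes. path_orbit q = path_orbit p}"
  then have q: "q \<in> rooted_primes" and eq: "path_orbit q = path_orbit p" by auto
  have "cyclic_class q = translate 0 (cyclic_class q)"
    by (simp add: translate_cyclic_class map_idI)
  then have "cyclic_class q \<in> path_orbit q" by (auto simp: path_orbit_def translation_orbit_def)
  then obtain g where "cyclic_class q = cyclic_class (map ((+) g) p)"
    unfolding eq by (auto simp: path_orbit_def translation_orbit_def translate_cyclic_class)
  moreover have "q \<in> cyclic_class q" by (auto simp: cyclic_class_def intro: range_eqI[of _ _ 0])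
  ultimately obtain k where "q = rotate k (map ((+) g) p)" by (auto simp: cyclic_class_def)
  then have qk: "q = map ((+) g) (rotate k p)" by (simp add: rotate_map)
  have "per q 0 = 0" using q by (simp add: rooted_primes_def)
  then have "g = - per p k" unfolding qk using ne by (simp add: per_map per_rotate eq_neg_iff_add_eq_0)
  then have "q = rebase k p" by (simp add: rebase_def qk)
  also have "\<dots> = rebase (k mod length p) p"
    by (simp add: rebase_def rotate_conv_mod[symmetric] per_def)
  finally show "q \<in> (\<lambda>j. rebase j p) ` {..<length p}" using ne by auto
next
  fix q assume "q \<in> (\<lambda>j. rebase j p) ` {..<length p}"
  then show "q \<in> {q \<in> rooted_primes. path_orbit q = path_orbit p}"
    using p rebase_in_rooted_primes by (auto simp: path_orbit_rebase rooted_primes_def)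
qed

lemma grid_prime_orbits_eq: "grid_prime_orbits = path_orbit ` rooted_primes"
proof (intro equalityI subsetI)
  fix \<gamma> assume "\<gamma> \<in> grid_prime_orbits"
  then obtain p where p: "p \<in> nb_closed_paths" "primitive_path p" "\<gamma> = path_orbit p"
    by (auto simp: grid_prime_orbits_def grid_primes_def nb_closed_paths_def path_orbit_def)
  then show "\<gamma> \<in> path_orbit ` rooted_primes"
    using rebase_in_rooted_primes[of p 0] path_orbit_rebase[of 0 p] by (intro image_eqI[of _ _ "rebase 0 p"]) auto
next
  fix \<gamma> assume "\<gamma> \<in> path_orbit ` rooted_primes"
  then show "\<gamma> \<in> grid_prime_orbits"
    by (auto simp: grid_prime_orbits_def grid_primes_def nb_closed_paths_def path_orbit_def rooted_primes_def)
qed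

lemma orbit_length_path_orbit: "orbit_length (path_orbit p) = length p"
  unfolding path_orbit_def by (rule orbit_length_translation_orbit)

section \<open>The Euler product\<close>

lemma norm_power_divide_le: "norm (z ^ m / of_nat m :: complex) \<le> norm z ^ m"
proof (cases "m = 0")
  case False
  have "norm z ^ m / real m \<le> norm z ^ m / 1" using False by (intro divide_left_mono) auto
  then show ?thesis by (simp add: norm_divide norm_power)
qed simp

lemma log_series_has_sum:
  fixes z :: complex
  assumes "norm z < 1"
  shows "((\<lambda>m. z ^ m / of_nat m) has_sum - Ln (1 - z)) {1..}"
proof -
  have s: "(\<lambda>m. z ^ m / of_nat m) sums - Ln (1 - z)"
    using sums_minus[OF Ln_series'[of "- z"]] assms by simp
  have "summable (\<lambda>m. norm (z ^ m / of_nat m))"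
  proof (rule summable_comparison_test'[where N = 0 and g = "\<lambda>m. norm z ^ m"])
    show "norm (norm (z ^ m / of_nat m)) \<le> norm z ^ m" for m
      using norm_power_divide_le[of z m] by simp
  qed (use assms in \<open>simp add: summable_geometric\<close>)
  then have "((\<lambda>m. z ^ m / of_nat m) has_sum - Ln (1 - z)) UNIV" using s by (rule norm_summable_imp_has_sum)
  then show ?thesis
    by (rule has_sum_cong_neutral[THEN iffD1, rotated -1]) (auto simp: not_le)
qed

text \<open>The sum of \<open>u ^ length w / length w\<close> over all rooted paths \<open>w\<close>
  converges absolutely and is evaluated in three ways: by length, by primitive root and exponent,
  and by orbit. In the last form it is a logarithm of the product.\<close>

theorem grid_euler_product:
  fixes u :: complex
  assumes u: "norm u < 1/4"
  shows "\<exists>S. (\<lambda>n. of_nat (card (cyclic_words n 0)) * u ^ n / of_nat n) sums S \<and> has_grid_euler_product u (exp S)"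
proof -
  have c: "rooted_paths 0 = {}" by (auto simp: rooted_paths_def nb_closed_paths_iff)
  then have fin: "finite (rooted_paths n)" for n by (cases "n = 0") auto
  \<comment> \<open>At \<open>n = 0\<close> both sides are 0 because division by 0 yields 0, so the
    value of \<open>card (cyclic_words 0 0)\<close> has no influence.\<close>
  have card: "of_nat (card (rooted_paths n)) * u ^ n / of_nat n = of_nat (card (cyclic_words n 0)) * u ^ n / of_nat n" for n
    by (cases "n = 0") (auto simp: card_rooted_paths)
  let ?f = "\<lambda>(n, w :: (int \<times> int) list). u ^ n / of_nat n"
  have "(\<lambda>x. norm (?f x)) summable_on Sigma UNIV rooted_paths"
  proof (rule summable_on_SigmaI)
    show "((\<lambda>w. norm (?f (n, w))) has_sum (real (card (rooted_paths n)) * norm (u ^ n / of_nat n))) (rooted_paths n)" for n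
      using fin by (intro has_sum_finiteI) auto
    have "summable (\<lambda>n. norm (real (card (rooted_paths n)) * norm (u ^ n / of_nat n)))"
    proof (rule summable_comparison_test'[where N = 0 and g = "\<lambda>n. (4 * norm u) ^ n"])
      show "summable (\<lambda>n. (4 * norm u) ^ n)" using u by (intro summable_geometric) simp
      fix n :: nat
      show "norm (norm (real (card (rooted_paths n)) * norm (u ^ n / of_nat n))) \<le> (4 * norm u) ^ n"
      proof (cases "n = 0")
        case False
        have "card (rooted_paths n) \<le> 4 ^ n"
          using card_cyclic_words_le[of n 0] card_rooted_paths[of n] False by simp
        from of_nat_mono[OF this, where 'a = real] have "real (card (rooted_paths n)) \<le> 4 ^ n" by simp
        then have "real (card (rooted_paths n)) * norm (u ^ n / of_nat n) \<le> 4 ^ n * norm u ^ n"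
          by (intro mult_mono norm_power_divide_le) auto
        then show ?thesis by (simp add: power_mult_distrib)
      qed simp
    qed
    then show "(\<lambda>n. real (card (rooted_paths n)) * norm (u ^ n / of_nat n)) summable_on UNIV"
      by (rule norm_summable_imp_summable_on)
  qed auto
  then have "?f summable_on Sigma UNIV rooted_paths" by (rule abs_summable_summable)
  then obtain S where S: "(?f has_sum S) (Sigma UNIV rooted_paths)" by (auto simp: summable_on_def)
  have "((\<lambda>n. of_nat (card (rooted_paths n)) * (u ^ n / of_nat n)) has_sum S) UNIV"
    by (rule has_sum_SigmaD[OF S]) (use fin in \<open>auto intro!: has_sum_finiteI\<close>)
  then have sums: "(\<lambda>n. of_nat (card (cyclic_words n 0)) * u ^ n / of_nat n) sums S"
    using has_sum_imp_sums by (simp add: card)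
  have "bij_betw snd (Sigma UNIV rooted_paths) (\<Union>n\<in>{1..}. rooted_paths n)"
    unfolding bij_betw_def
  proof (intro conjI inj_onI equalityI subsetI)
    fix x y assume "x \<in> Sigma UNIV rooted_paths" "y \<in> Sigma UNIV rooted_paths" "snd x = snd y"
    then show "x = y" by (auto simp: rooted_paths_def)
  next
    fix w assume "w \<in> snd ` Sigma UNIV rooted_paths"
    then obtain n where n: "w \<in> rooted_paths n" by auto
    then have "n \<noteq> 0" using c by (cases n) auto
    then show "w \<in> (\<Union>n\<in>{1..}. rooted_paths n)" using n by (auto simp: Suc_le_eq)
  next
    fix w assume "w \<in> (\<Union>n\<in>{1..}. rooted_paths n)"
    then show "w \<in> snd ` Sigma UNIV rooted_paths" by force
  qed
  then have "((\<lambda>w. u ^ length w / of_nat (length w)) has_sum S) (\<Union>n\<in>{1..}. rooted_paths n)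
      \<longleftrightarrow> ((\<lambda>x. u ^ length (snd x) / of_nat (length (snd x))) has_sum S) (Sigma UNIV rooted_paths)"
    by (rule has_sum_reindex_bij_betw[symmetric])
  also have "\<dots> \<longleftrightarrow> (?f has_sum S) (Sigma UNIV rooted_paths)"
    by (intro has_sum_cong) (auto simp: rooted_paths_def)
  finally have "((\<lambda>w. u ^ length w / of_nat (length w)) has_sum S) (\<Union>n\<in>{1..}. rooted_paths n)" using S by simp
  then have "((\<lambda>x. u ^ length (case x of (p, m) \<Rightarrow> concat (replicate m p))
      / of_nat (length (case x of (p, m) \<Rightarrow> concat (replicate m p)))) has_sum S) (rooted_primes \<times> {1..})"
    by (rule has_sum_reindex_bij_betw[OF bij_concat_replicate, THEN iffD2])
  then have P: "((\<lambda>p. - Ln (1 - u ^ length p) / of_nat (length p)) has_sum S) rooted_primes"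
  proof (rule has_sum_SigmaD)
    fix p assume "p \<in> rooted_primes"
    then have ne: "p \<noteq> []" by (auto simp: rooted_primes_def nb_closed_paths_iff)
    have "norm u ^ length p < 1" using u ne by (intro power_less_one_iff[THEN iffD2]) auto
    then have "norm (u ^ length p) < 1" by (simp add: norm_power)
    \<comment> \<open>For a fixed root \<open>p\<close> the sum over the exponents is the logarithm
      series in \<open>u ^ length p\<close>, divided by \<open>length p\<close>.\<close>
    then have "((\<lambda>m. (u ^ length p) ^ m / of_nat m * inverse (of_nat (length p))) has_sum
        - Ln (1 - u ^ length p) * inverse (of_nat (length p))) {1..}"
      by (intro has_sum_cmult_left log_series_has_sum)
    moreover have "(u ^ length p) ^ m / of_nat m * inverse (of_nat (length p))
        = u ^ length (concat (replicate m p)) / of_nat (length (concat (replicate m p)))" for m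
      by (simp add: length_concat_replicate divide_inverse mult.commute flip: power_mult)
    ultimately show "((\<lambda>m. u ^ length (case (p, m) of (p, m) \<Rightarrow> concat (replicate m p))
      / of_nat (length (case (p, m) of (p, m) \<Rightarrow> concat (replicate m p)))) has_sum
        - Ln (1 - u ^ length p) / of_nat (length p)) {1..}"
      by (simp add: divide_inverse)
  qed
  define B where "B = (\<lambda>\<gamma>. {p \<in> rooted_primes. path_orbit p = \<gamma>})"
  have "bij_betw snd (Sigma grid_prime_orbits B) rooted_primes"
    unfolding bij_betw_def by (force simp: inj_on_def B_def grid_prime_orbits_eq image_iff)
  then have "((\<lambda>x. - Ln (1 - u ^ length (snd x)) / of_nat (length (snd x))) has_sum S) (Sigma grid_prime_orbits B)"
    using P by (rule has_sum_reindex_bij_betw[THEN iffD2])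
  then have G: "((\<lambda>\<gamma>. - Ln (1 - u ^ orbit_length \<gamma>)) has_sum S) grid_prime_orbits"
  proof (rule has_sum_SigmaD)
    fix \<gamma> assume "\<gamma> \<in> grid_prime_orbits"
    then obtain p where p: "p \<in> rooted_primes" "\<gamma> = path_orbit p" by (auto simp: grid_prime_orbits_eq)
    have ne: "p \<noteq> []" using p by (auto simp: rooted_primes_def nb_closed_paths_iff)
    have B: "B \<gamma> = (\<lambda>j. rebase j p) ` {..<length p}" unfolding B_def p(2) using path_orbit_fiber[OF p(1)] .
    have "(\<Sum>q\<in>B \<gamma>. - Ln (1 - u ^ length q) / of_nat (length q))
        = (\<Sum>j<length p. - Ln (1 - u ^ length p) / of_nat (length p))"
      unfolding B by (subst sum.reindex[OF inj_on_rebase[OF p(1)]]) simp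
    also have "\<dots> = - Ln (1 - u ^ orbit_length \<gamma>)"
      using ne by (simp add: p orbit_length_path_orbit)
    finally show "((\<lambda>q. - Ln (1 - u ^ length (snd (\<gamma>, q))) / of_nat (length (snd (\<gamma>, q)))) has_sum
        - Ln (1 - u ^ orbit_length \<gamma>)) (B \<gamma>)"
      by (intro has_sum_finiteI) (auto simp: B)
  qed
  \<comment> \<open>Exponentiating the finite partial sums turns the unordered sum into the limit
    that defines the Euler product and removes the dependence on the branch of the
    logarithm.\<close>
  have ex: "exp (\<Sum>\<gamma>\<in>F. - Ln (1 - u ^ orbit_length \<gamma>)) = (\<Prod>\<gamma>\<in>F. inverse (1 - u ^ orbit_length \<gamma>))"
    if F: "finite F" "F \<subseteq> grid_prime_orbits" for F
  proof -
    have "exp (- Ln (1 - u ^ orbit_length \<gamma>)) = inverse (1 - u ^ orbit_length \<gamma>)" if \<gamma>F: "\<gamma> \<in> F" for \<gamma>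
    proof -
      obtain p where p: "p \<in> rooted_primes" "\<gamma> = path_orbit p" using \<gamma>F F by (auto simp: grid_prime_orbits_eq)
      have ne: "p \<noteq> []" using p by (auto simp: rooted_primes_def nb_closed_paths_iff)
      have "norm u ^ length p < 1" using u ne by (intro power_less_one_iff[THEN iffD2]) auto
      then have "norm (u ^ orbit_length \<gamma>) < 1" by (simp add: norm_power p orbit_length_path_orbit)
      then have "1 - u ^ orbit_length \<gamma> \<noteq> 0" by auto
      then show ?thesis by (simp add: exp_minus)
    qed
    then show ?thesis using F by (simp add: exp_sum)
  qed
  have "((\<lambda>F. exp (\<Sum>\<gamma>\<in>F. - Ln (1 - u ^ orbit_length \<gamma>))) \<longlongrightarrow> exp S) (finite_subsets_at_top grid_prime_orbits)"
    using G unfolding has_sum_def by (rule tendsto_exp)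
  then have "((\<lambda>F. \<Prod>\<gamma>\<in>F. inverse (1 - u ^ orbit_length \<gamma>)) \<longlongrightarrow> exp S) (finite_subsets_at_top grid_prime_orbits)"
  proof (rule Lim_transform_eventually)
    show "\<forall>\<^sub>F F in finite_subsets_at_top grid_prime_orbits.
        exp (\<Sum>\<gamma>\<in>F. - Ln (1 - u ^ orbit_length \<gamma>)) = (\<Prod>\<gamma>\<in>F. inverse (1 - u ^ orbit_length \<gamma>))"
      by (rule eventually_finite_subsets_at_top_weakI) (rule ex)
  qed
  then show ?thesis using sums unfolding has_grid_euler_product_def by blast
qed

section \<open>Analytic continuation\<close>

definition cut_plane :: "complex set" where
  "cut_plane = - complex_of_real ` {1..}"

definition elliptic_integrand :: "complex \<Rightarrow> real \<Rightarrow> complex" where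
  "elliptic_integrand k t = inverse (csqrt (1 - k * of_real ((sin t)\<^sup>2)))"

text \<open>This is \<open>2 K / \<pi>\<close> for the complete elliptic integral \<open>K\<close> of the first kind; its argument \<open>k\<close> is
  the parameter, that is, the square of the modulus.\<close>

definition hyp :: "complex \<Rightarrow> complex" where
  "hyp k = integral (cbox 0 pi) (elliptic_integrand k) / of_real pi"

lemma open_cut_plane: "open cut_plane"
proof -
  have "complex_of_real ` {1..} = {z. Im z = 0 \<and> 1 \<le> Re z}"
    by (force simp: complex_eq_iff image_iff)
  then have "closed (complex_of_real ` {1..})"
    by (simp add: closed_Collect_conj closed_Collect_eq closed_Collect_le continuous_intros)
  then show ?thesis by (simp add: cut_plane_def open_Compl)
qed

text \<open>The square root is evaluated off its branch cut: a nonpositive value of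
  \<open>1 - k s\<close> with \<open>s\<close> in [0, 1] would make \<open>k\<close> real and at
  least 1.\<close>

lemma cut_plane_csqrt_arg:
  assumes "k \<in> cut_plane"
  shows "1 - k * of_real ((sin t)\<^sup>2) \<notin> \<real>\<^sub>\<le>\<^sub>0"
proof
  define s where "s = (sin t)\<^sup>2"
  have s: "0 \<le> s" "s \<le> 1" by (auto simp: s_def power2_le_iff_abs_le abs_square_le_1)
  assume "1 - k * of_real ((sin t)\<^sup>2) \<in> \<real>\<^sub>\<le>\<^sub>0"
  then obtain r where r: "r \<le> 0" "1 - k * of_real s = of_real r" unfolding s_def[symmetric] by (auto elim!: nonpos_Reals_cases)
  have s0: "s \<noteq> 0" using r by auto
  have "k * of_real s = of_real (1 - r)" using r by (simp add: algebra_simps)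
  then have "k = of_real ((1 - r) / s)" using s0 by (simp add: field_simps)
  moreover have "1 \<le> (1 - r) / s" using r s s0 by (simp add: le_divide_eq)
  ultimately show False using assms unfolding cut_plane_def by blast
qed

lemma hyp_holomorphic: "hyp holomorphic_on cut_plane"
proof -
  have "hyp field_differentiable at k0" if k0: "k0 \<in> cut_plane" for k0
  proof -
    obtain e where e: "0 < e" "ball k0 e \<subseteq> cut_plane" using open_cut_plane k0 open_contains_ball by blast
    let ?z = "\<lambda>k t. 1 - k * of_real ((sin t)\<^sup>2)"
    let ?fx = "\<lambda>k t. of_real ((sin t)\<^sup>2) / (2 * csqrt (?z k t) ^ 3)"
    have nz: "?z k t \<notin> \<real>\<^sub>\<le>\<^sub>0" if "k \<in> ball k0 e" for k t
      using cut_plane_csqrt_arg e that by blast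
    then have nz0: "?z k t \<noteq> 0" if "k \<in> ball k0 e" for k t using that by (metis nonpos_Reals_zero_I)
    have "(\<lambda>k. integral (cbox 0 pi) (elliptic_integrand k)) holomorphic_on ball k0 e"
    proof (rule leibniz_rule_holomorphic[where fx = ?fx])
      fix k t assume kt: "k \<in> ball k0 e" "t \<in> cbox 0 pi"
      show "((\<lambda>k. elliptic_integrand k t) has_field_derivative ?fx k t) (at k within ball k0 e)"
      proof -
        have c0: "csqrt (?z k t) \<noteq> 0" using nz0[OF kt(1)] by (simp add: csqrt_eq_0)
        have "((\<lambda>k. ?z k t) has_field_derivative - of_real ((sin t)\<^sup>2)) (at k within ball k0 e)"
          by (auto intro!: derivative_eq_intros)
        then have "((\<lambda>k. csqrt (?z k t)) has_field_derivative - of_real ((sin t)\<^sup>2) / (2 * csqrt (?z k t))) (at k within ball k0 e)"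
          using nz[OF kt(1)] by (rule has_field_derivative_csqrt')
        then have der: "((\<lambda>k. inverse (csqrt (?z k t))) has_field_derivative
            - (inverse (csqrt (?z k t)) * (- of_real ((sin t)\<^sup>2) / (2 * csqrt (?z k t))) * inverse (csqrt (?z k t))))
            (at k within ball k0 e)"
          using c0 by (rule DERIV_inverse')
        have "- (inverse c * (- \<sigma> / (2 * c)) * inverse c) = \<sigma> / (2 * c ^ 3)" for c \<sigma> :: complex
          by (cases "c = 0") (simp_all add: field_simps power3_eq_cube)
        from der[unfolded this] show ?thesis unfolding elliptic_integrand_def .
      qed
    next
      fix k assume k: "k \<in> ball k0 e"
      show "elliptic_integrand k integrable_on cbox 0 pi"
        unfolding elliptic_integrand_def
        by (intro integrable_continuous continuous_intros continuous_on_compose2[OF continuous_on_csqrt])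
           (use nz[OF k] nz0[OF k] in auto)
    next
      show "continuous_on (ball k0 e \<times> cbox 0 pi) (\<lambda>(k, t). ?fx k t)"
        unfolding case_prod_unfold
        by (intro continuous_intros continuous_on_compose2[OF continuous_on_csqrt])
           (use nz nz0 in \<open>auto simp: csqrt_eq_0\<close>)
    qed simp
    then have "hyp holomorphic_on ball k0 e" unfolding hyp_def by (intro holomorphic_intros) auto
    then show ?thesis using e by (intro holomorphic_on_imp_differentiable_at[of _ "ball k0 e"]) auto
  qed
  then show ?thesis by (auto simp: holomorphic_on_def intro: field_differentiable_at_within)
qed

text \<open>These are both the binomial coefficients of \<open>(1 - x) powr (-1/2)\<close> and the
  means of \<open>sin t ^ (2 * n)\<close> over [0, \<pi>]; this is why the coefficients of
  \<open>hyp\<close> are squares.\<close>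

definition cbin :: "nat \<Rightarrow> real" where
  "cbin n = real ((2 * n) choose n) / 4 ^ n"

lemma cbin_rec: "cbin (Suc n) * (2 * real n + 2) = cbin n * (2 * real n + 1)"
proof -
  have "real (Suc n) * real ((2 * Suc n) choose Suc n) = real (2 * (2 * n + 1)) * real ((2 * n) choose n)"
    unfolding of_nat_mult[symmetric] central_binomial_rec ..
  then have "real ((2 * Suc n) choose Suc n) * (2 * real n + 2) = 4 * (real ((2 * n) choose n) * (2 * real n + 1))"
    by (simp add: algebra_simps)
  then show ?thesis unfolding cbin_def by (simp only: power_Suc times_divide_eq_left) (simp add: divide_simps)
qed

lemma cbin_le_1: "0 \<le> cbin n \<and> cbin n \<le> 1"
proof (induction n)
  case (Suc n)
  have "cbin (Suc n) * (2 * real n + 2) \<le> 1 * (2 * real n + 2)"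
    unfolding cbin_rec using Suc by (intro mult_mono) auto
  then have "cbin (Suc n) \<le> 1" by (subst (asm) mult_le_cancel_right) auto
  then show ?case by (simp add: cbin_def)
qed (simp add: cbin_def)

lemma gbinomial_neg_half: "((- 1/2) gchoose n) * (- 1) ^ n = (of_real (cbin n) :: complex)"
proof (induction n)
  case (Suc n)
  have "of_nat (Suc n) * ((- 1/2) gchoose Suc n) = (- 1/2 - of_nat n) * ((- 1/2 :: complex) gchoose n)"
    using gbinomial_mult_1[of "- 1/2 :: complex" n] by (simp add: algebra_simps)
  moreover have "x * (c' * (- 1 * e)) = (1/2 + N) * (c * e)" if *: "x * c' = (- 1/2 - N) * c" for x c c' N e :: complex
  proof -
    have "x * (c' * (- 1 * e)) = - (x * c') * e" by simp
    also have "\<dots> = (1/2 + N) * (c * e)" unfolding * by (simp add: algebra_simps)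
    finally show ?thesis .
  qed
  ultimately have "of_nat (Suc n) * (((- 1/2) gchoose Suc n) * (- 1) ^ Suc n)
      = (1/2 + of_nat n) * (((- 1/2) gchoose n) * (- 1) ^ n :: complex)"
    unfolding power_Suc by blast
  also have "\<dots> = of_real ((1/2 + real n) * cbin n)" unfolding Suc by simp
  also have "(1/2 + real n) * cbin n = real (Suc n) * cbin (Suc n)" using cbin_rec[of n] by (simp add: algebra_simps)
  finally have "of_nat (Suc n) * (((- 1/2) gchoose Suc n) * (- 1) ^ Suc n) = of_nat (Suc n) * (of_real (cbin (Suc n)) :: complex)"
    by simp
  then show ?case by (simp only: mult_left_cancel of_nat_eq_0_iff nat.distinct not_False_eq_True)
qed (simp add: cbin_def)

lemma wallis_integral: "((\<lambda>t. (sin t) ^ (2 * n)) has_integral pi * cbin n) {0..pi}"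
proof (induction n)
  case 0
  then show ?case using has_integral_const_real[of "1::real" 0 pi] by (simp add: cbin_def)
next
  case (Suc n)
  \<comment> \<open>The integrand is the derivative of \<open>- cos t * sin t ^ (2 * n + 1)\<close>,
    which vanishes at both ends.\<close>
  have "((\<lambda>t. (2 * real n + 2) * sin t ^ (2 * Suc n) - (2 * real n + 1) * sin t ^ (2 * n)) has_integral
      (- cos pi * sin pi ^ (2 * n + 1)) - (- cos 0 * sin 0 ^ (2 * n + 1))) {0..pi}"
  proof (rule fundamental_theorem_of_calculus)
    fix t :: real
    have s: "sin t * sin t = 1 - cos t * cos t" using sin_cos_squared_add[of t] by (simp add: power2_eq_square algebra_simps)
    have "((\<lambda>t. - cos t * sin t ^ (2 * n + 1)) has_real_derivative
      sin t * sin t ^ (2 * n + 1) - cos t * (real (2 * n + 1) * sin t ^ (2 * n) * cos t)) (at t)"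
    proof -
      have "((\<lambda>t. - cos t * sin t ^ m) has_real_derivative
          sin t * sin t ^ m - cos t * (real m * sin t ^ (m - 1) * cos t)) (at t)" for m
        by (auto intro!: derivative_eq_intros)
      from this[of "2 * n + 1"] show ?thesis by simp
    qed
    also have "sin t * sin t ^ (2 * n + 1) - cos t * (real (2 * n + 1) * sin t ^ (2 * n) * cos t)
        = (2 * real n + 2) * sin t ^ (2 * Suc n) - (2 * real n + 1) * sin t ^ (2 * n)"
    proof -
      have "cos t * (real (2 * n + 1) * sin t ^ (2 * n) * cos t) = real (2 * n + 1) * sin t ^ (2 * n) * (1 - sin t * sin t)"
        unfolding s by (simp add: algebra_simps)
      moreover have "sin t ^ (2 * Suc n) = sin t ^ (2 * n) * (sin t * sin t)" by simp
      moreover have "sin t * sin t ^ (2 * n + 1) = sin t ^ (2 * n) * (sin t * sin t)" by simp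
      ultimately show ?thesis by (simp add: algebra_simps)
    qed
    finally show "((\<lambda>t. - cos t * sin t ^ (2 * n + 1)) has_vector_derivative
        (2 * real n + 2) * sin t ^ (2 * Suc n) - (2 * real n + 1) * sin t ^ (2 * n)) (at t within {0..pi})"
      by (auto simp: has_real_derivative_iff_has_vector_derivative intro: has_vector_derivative_at_within)
  qed simp
  then have "((\<lambda>t. (2 * real n + 2) * sin t ^ (2 * Suc n) - (2 * real n + 1) * sin t ^ (2 * n)) has_integral 0) {0..pi}"
    by simp
  from has_integral_add[OF this has_integral_mult_right[OF Suc, of "2 * real n + 1"]]
  have "((\<lambda>t. (2 * real n + 2) * sin t ^ (2 * Suc n)) has_integral (2 * real n + 1) * (pi * cbin n)) {0..pi}"
    by simp
  from has_integral_divide[OF this, of "2 * real n + 2"]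
  have "((\<lambda>t. sin t ^ (2 * Suc n)) has_integral (2 * real n + 1) * (pi * cbin n) / (2 * real n + 2)) {0..pi}"
    by simp
  also have "(2 * real n + 1) * (pi * cbin n) / (2 * real n + 2) = pi * cbin (Suc n)"
    using cbin_rec[of n] by (simp add: field_simps)
  finally show ?case .
qed

lemma hyp_fps_nth_cbin: "fps_nth hyp_fps n = of_real (cbin n ^ 2)"
proof -
  have "(16 :: complex) ^ n = (4 ^ n)\<^sup>2" by (simp add: power2_eq_square flip: power_mult_distrib)
  then show ?thesis by (simp add: hyp_fps_def cbin_def power_divide)
qed

text \<open>Binomial expansion of the integrand, uniform on [0, \<pi>] by the majorant
  \<open>norm k ^ n\<close>, and integration term by term.\<close>

lemma hyp_sums:
  assumes k: "norm k < 1"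
  shows "(\<lambda>n. fps_nth hyp_fps n * k ^ n) sums hyp k"
proof -
  let ?f = "\<lambda>n t. of_real (cbin n) * (k * of_real ((sin t)\<^sup>2)) ^ n"
  have bound: "norm (k * of_real ((sin t)\<^sup>2)) \<le> norm k" for t :: real
    by (simp add: norm_mult mult_left_le abs_square_le_1 norm_power power_le_one)
  have s: "(\<lambda>n. ?f n t) sums elliptic_integrand k t" for t
  proof -
    have "norm (- (k * of_real ((sin t)\<^sup>2))) < 1" using bound[of t] k by simp
    from gen_binomial_complex[OF this, of "- 1/2"]
    have "(\<lambda>n. ((- 1/2) gchoose n) * (- (k * of_real ((sin t)\<^sup>2))) ^ n) sums (1 - k * of_real ((sin t)\<^sup>2)) powr (- 1/2)"
      by simp
    moreover have "((- 1/2) gchoose n) * (- (k * of_real ((sin t)\<^sup>2))) ^ n = ?f n t" for n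
      unfolding gbinomial_neg_half[symmetric] power_minus[of "k * of_real ((sin t)\<^sup>2)"] by (simp add: mult_ac)
    moreover have "(1 - k * of_real ((sin t)\<^sup>2)) powr (- 1/2) = elliptic_integrand k t"
      unfolding elliptic_integrand_def csqrt_conv_powr using powr_minus[of _ "1/2 :: complex"] by simp
    ultimately show ?thesis by simp
  qed
  have "uniform_limit {0..pi} (\<lambda>n t. \<Sum>i<n. ?f i t) (\<lambda>t. suminf (\<lambda>i. ?f i t)) sequentially"
  proof (rule Weierstrass_m_test)
    show "summable (\<lambda>n. norm k ^ n)" using k by (simp add: summable_geometric)
    fix n t
    have "norm (?f n t) \<le> 1 * norm k ^ n"
      unfolding norm_mult norm_power using cbin_le_1[of n] bound[of t]
      by (intro mult_mono power_mono) (auto simp: norm_mult norm_power)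
    then show "norm (?f n t) \<le> norm k ^ n" by simp
  qed
  moreover have "(\<lambda>t. suminf (\<lambda>i. ?f i t)) = elliptic_integrand k" by (intro ext sums_unique[OF s, symmetric])
  ultimately have ul: "uniform_limit {0..pi} (\<lambda>n t. \<Sum>i<n. ?f i t) (elliptic_integrand k) sequentially" by simp
  have cont: "continuous_on {0..pi} (\<lambda>t. \<Sum>i<n. ?f i t)" for n by (intro continuous_intros)
  obtain I J where I: "\<And>n. ((\<lambda>t. \<Sum>i<n. ?f i t) has_integral I n) {0..pi}"
    and J: "(elliptic_integrand k has_integral J) {0..pi}" and IJ: "I \<longlonglongrightarrow> J"
    using uniform_limit_integral[OF ul cont] by auto
  have "((\<lambda>t. \<Sum>i<n. ?f i t) has_integral (\<Sum>i<n. of_real (cbin i) * k ^ i * of_real (pi * cbin i))) {0..pi}" for n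
  proof (rule has_integral_sum)
    fix i
    have "((\<lambda>t. complex_of_real (sin t ^ (2 * i))) has_integral of_real (pi * cbin i)) {0..pi}"
      using has_integral_linear[OF wallis_integral[of i] bounded_linear_of_real] by (simp add: comp_def)
    from has_integral_mult_right[OF this, of "of_real (cbin i) * k ^ i"]
    show "(?f i has_integral of_real (cbin i) * k ^ i * of_real (pi * cbin i)) {0..pi}"
      by (simp add: power_mult_distrib power_mult mult.assoc)
  qed simp
  then have "I n = (\<Sum>i<n. of_real (cbin i) * k ^ i * of_real (pi * cbin i))" for n
    using I has_integral_unique by blast
  then have "I = (\<lambda>n. \<Sum>i<n. of_real (cbin i) * k ^ i * of_real (pi * cbin i))" by blast
  then have "(\<lambda>n. of_real (cbin n) * k ^ n * of_real (pi * cbin n)) sums J" using IJ unfolding sums_def by simp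
  from sums_divide[OF this, of "of_real pi"]
  have "(\<lambda>n. fps_nth hyp_fps n * k ^ n) sums (J / of_real pi)"
    by (simp add: hyp_fps_nth_cbin power2_eq_square mult_ac)
  moreover have "J / of_real pi = hyp k" using J by (simp add: hyp_def integral_unique)
  ultimately show ?thesis by simp
qed

lemma hyp_has_fps_expansion: "hyp has_fps_expansion hyp_fps"
proof (rule has_fps_expansionI)
  have "eventually (\<lambda>u :: complex. u \<in> ball 0 1) (nhds 0)" by (intro eventually_nhds_in_open) auto
  then show "\<forall>\<^sub>F u in nhds 0. (\<lambda>n. fps_nth hyp_fps n * u ^ n) sums hyp u"
    by eventually_elim (auto intro: hyp_sums)
qed

lemma hyp_0: "hyp 0 = 1"
  using has_fps_expansion_imp_0_eq_fps_nth_0[OF hyp_has_fps_expansion] by (simp add: hyp_fps_def)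

lemma cut_plane_scale: "t \<in> {0..1} \<Longrightarrow> k \<in> cut_plane \<Longrightarrow> of_real t * k \<in> cut_plane"
proof -
  assume t: "t \<in> {0..1}" and k: "k \<in> cut_plane"
  show "of_real t * k \<in> cut_plane"
  proof (rule ccontr)
    assume "of_real t * k \<notin> cut_plane"
    then obtain r where r: "1 \<le> r" "of_real t * k = of_real r" by (auto simp: cut_plane_def)
    then have t0: "t \<noteq> 0" by auto
    then have "k = of_real (r / t)" using r by (simp add: field_simps)
    moreover have "1 \<le> r / t" using t t0 r by (simp add: le_divide_eq)
    ultimately show False using k unfolding cut_plane_def by blast
  qed
qed

lemma connected_cut_plane: "connected cut_plane"
proof -
  have "closed_segment 0 k \<subseteq> cut_plane" if "k \<in> cut_plane" for k
    using cut_plane_scale that by (auto simp: closed_segment_def scaleR_conv_of_real)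
  moreover have "0 \<in> cut_plane" by (auto simp: cut_plane_def)
  ultimately have "starlike cut_plane" by (auto simp: starlike_def)
  then show ?thesis by (rule starlike_imp_connected)
qed

text \<open>By \<open>hyp_fps_ode\<close> the left-hand side has the zero expansion at 0, and the
  cut plane is connected.\<close>

lemma hyp_ode:
  assumes "k \<in> cut_plane"
  shows "k * (1 - k) * deriv (deriv hyp) k + (1 - 2 * k) * deriv hyp k - hyp k / 4 = 0"
proof -
  have 0: "0 \<in> cut_plane" by (auto simp: cut_plane_def)
  let ?f = "\<lambda>k. k * (1 - k) * deriv (deriv hyp) k + (1 - 2 * k) * deriv hyp k - hyp k * (1/4)"
  have hol: "?f holomorphic_on cut_plane"
    by (intro holomorphic_intros holomorphic_deriv hyp_holomorphic open_cut_plane)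
  have "?f has_fps_expansion (fps_X * (1 - fps_X) * fps_deriv (fps_deriv hyp_fps) + (1 - 2 * fps_X) * fps_deriv hyp_fps
      - hyp_fps * fps_const (1/4))"
    by (intro fps_expansion_intros hyp_has_fps_expansion)
  also have "fps_X * (1 - fps_X) * fps_deriv (fps_deriv hyp_fps) + (1 - 2 * fps_X) * fps_deriv hyp_fps
      - hyp_fps * fps_const (1/4) = 0"
    using hyp_fps_ode by (simp add: mult.commute)
  finally have "?f has_fps_expansion 0" .
  from has_fps_expansion_0_analytic_continuation[OF this hol open_cut_plane connected_cut_plane 0 assms]
  show ?thesis by simp
qed

section \<open>The slit disc and the parameter k\<close>

text \<open>An explicit star-shaped set containing \<open>grid_zeta_domain\<close>; this inclusion
  is enough, so the connected component need not be determined.\<close>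

definition slit_disc :: "complex set" where
  "slit_disc = ball 0 (1 / sqrt 3) - (complex_of_real ` {-1..-1/3} \<union> complex_of_real ` {1/3..1})"

lemma open_slit_disc: "open slit_disc"
proof -
  have "compact (complex_of_real ` {a..b})" for a b
    by (intro compact_continuous_image continuous_intros compact_Icc)
  then show ?thesis unfolding slit_disc_def
    by (intro open_Diff closed_Un open_ball) (auto intro: compact_imp_closed)
qed

lemma zero_in_slit_disc: "0 \<in> slit_disc"
  by (auto simp: slit_disc_def)

text \<open>A connected set that meets the disc but not its boundary circle stays inside the
  disc.\<close>

lemma grid_zeta_domain_subset: "grid_zeta_domain \<subseteq> slit_disc"
proof -
  have D: "grid_zeta_domain \<subseteq> - (sphere 0 (1 / sqrt 3) \<union> complex_of_real ` {-1..-1/3} \<union> complex_of_real ` {1/3..1})"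
    unfolding grid_zeta_domain_def by (rule connected_component_subset)
  have "grid_zeta_domain \<subseteq> ball 0 (1 / sqrt 3)"
  proof (rule ccontr)
    assume "\<not> grid_zeta_domain \<subseteq> ball 0 (1 / sqrt 3)"
    then have "grid_zeta_domain - ball 0 (1 / sqrt 3) \<noteq> {}" by blast
    moreover have "grid_zeta_domain \<inter> ball 0 (1 / sqrt 3) \<noteq> {}" using grid_zeta_domain(3) by force
    ultimately have "grid_zeta_domain \<inter> frontier (ball 0 (1 / sqrt 3)) \<noteq> {}"
      using connected_Int_frontier grid_zeta_domain(2) by blast
    then show False using D by (auto simp: frontier_ball)
  qed
  then show ?thesis using D by (auto simp: slit_disc_def)
qed

lemma slit_disc_norm: "u \<in> slit_disc \<Longrightarrow> 3 * (norm u)\<^sup>2 < 1"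
proof -
  assume "u \<in> slit_disc"
  then have "norm u < 1 / sqrt 3" by (simp add: slit_disc_def)
  then have "(norm u)\<^sup>2 < (1 / sqrt 3)\<^sup>2" by (intro power_strict_mono) auto
  then show ?thesis by (simp add: power_divide)
qed

lemma slit_disc_nonzero:
  assumes "u \<in> slit_disc"
  shows "1 + 3 * u\<^sup>2 \<noteq> 0" "1 - u\<^sup>2 \<noteq> 0" "1 - 3 * u\<^sup>2 \<noteq> 0"
proof -
  have n: "norm (3 * u\<^sup>2) < 1" "norm (u\<^sup>2) < 1" using slit_disc_norm[OF assms] by (auto simp: norm_mult norm_power)
  show "1 + 3 * u\<^sup>2 \<noteq> 0"
  proof
    assume "1 + 3 * u\<^sup>2 = 0"
    then have "3 * u\<^sup>2 = - 1" by (simp add: eq_neg_iff_add_eq_0 add.commute)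
    then show False using n(1) by simp
  qed
  show "1 - u\<^sup>2 \<noteq> 0" using n(2) by auto
  show "1 - 3 * u\<^sup>2 \<noteq> 0"
  proof
    assume "1 - 3 * u\<^sup>2 = 0"
    then have "3 * u\<^sup>2 = 1" by simp
    then show False using n(1) by (metis less_irrefl norm_one)
  qed
qed

text \<open>This is \<open>16 y^2\<close> with \<open>y = u / (1 + 3 u^2)\<close>. The singular
  value 1 of the parameter is attained for \<open>u^2 = 1/9\<close> and \<open>u^2 = 1\<close>, the
  ends of the slits in the description of the domain.\<close>

definition grid_param :: "complex \<Rightarrow> complex" where
  "grid_param u = 16 * u\<^sup>2 / (1 + 3 * u\<^sup>2)\<^sup>2"

lemma grid_param_holomorphic: "grid_param holomorphic_on slit_disc"
  unfolding grid_param_def using slit_disc_nonzero(1) by (intro holomorphic_intros) auto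

text \<open>If \<open>x = 4 u / (1 + 3 u\<^sup>2)\<close> is real, then \<open>u\<close> is real or \<open>\<bar>u\<bar>\<^sup>2 = 1/3\<close>, since then the two
  roots of \<open>3 x u\<^sup>2 - 4 u + x\<close>, of product \<open>1/3\<close>, are real or conjugate;
  the condition \<open>\<bar>x\<bar> \<ge> 1\<close> then says that \<open>u\<close> lies on a slit.\<close>

lemma grid_param_cut_plane:
  assumes u: "u \<in> slit_disc"
  shows "grid_param u \<in> cut_plane"
proof (rule ccontr)
  assume "grid_param u \<notin> cut_plane"
  then obtain k where k: "1 \<le> k" "grid_param u = of_real k" by (auto simp: cut_plane_def)
  define v where "v = 1 + 3 * u\<^sup>2"
  have v0: "v \<noteq> 0" using slit_disc_nonzero(1)[OF u] by (simp add: v_def)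
  define x where "x = 4 * u / v"
  have "x\<^sup>2 = of_real k" using k v0 by (simp add: x_def grid_param_def v_def power_divide power_mult_distrib)
  then have "x\<^sup>2 = (of_real (sqrt k))\<^sup>2" using k by (simp flip: of_real_power)
  then have "x = of_real (sqrt k) \<or> x = - of_real (sqrt k)" by (simp add: power2_eq_iff)
  moreover have "1 \<le> sqrt k" using k by simp
  ultimately obtain s where s: "x = of_real s" "1 \<le> \<bar>s\<bar>"
    by (metis abs_minus_cancel abs_of_nonneg of_real_minus real_sqrt_ge_zero k(1) order_trans zero_le_one)
  define a b where "a = Re u" and "b = Im u"
  have u_eq: "u = Complex a b" by (simp add: a_def b_def)
  have "4 * u = of_real s * v" using s v0 by (simp add: x_def field_simps)
  then have re: "4 * a = s * (1 + 3 * (a\<^sup>2 - b\<^sup>2))" and im: "4 * b = s * (6 * a * b)"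
    unfolding v_def u_eq by (auto simp: complex_eq_iff power2_eq_square algebra_simps)
  have n: "3 * (a\<^sup>2 + b\<^sup>2) < 1" using slit_disc_norm[OF u] by (simp add: a_def b_def cmod_power2)
  have "b = 0"
  proof (rule ccontr)
    assume "b \<noteq> 0"
    have "b * 4 = b * (6 * s * a)" using im by (simp add: mult_ac)
    then have "4 = 6 * s * a" using \<open>b \<noteq> 0\<close> mult_left_cancel by blast
    then have "6 * (s * a) = 4" by (simp only: mult.assoc)
    then have sa: "s * a = 2/3" by linarith
    have "4 * a\<^sup>2 = (s * a) * (1 + 3 * (a\<^sup>2 - b\<^sup>2))" using arg_cong[OF re, of "\<lambda>x. x * a"] by (simp add: power2_eq_square mult_ac)
    then have "3 * (a\<^sup>2 + b\<^sup>2) = 1" unfolding sa by (simp add: field_simps)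
    then show False using n by simp
  qed
  have re': "4 * a = s * (1 + 3 * a\<^sup>2)" using re \<open>b = 0\<close> by simp
  have "1 + 3 * a\<^sup>2 \<le> \<bar>s\<bar> * (1 + 3 * a\<^sup>2)" 
    using mult_right_mono[of 1 "\<bar>s\<bar>" "1 + 3 * a\<^sup>2"] s by simp
  also have "\<dots> = 4 * \<bar>a\<bar>" using arg_cong[OF re', of abs] by (simp add: abs_mult)
  finally have "(3 * \<bar>a\<bar> - 1) * (\<bar>a\<bar> - 1) \<le> 0" by (simp add: algebra_simps power2_eq_square abs_mult_self_eq)
  moreover have "\<bar>a\<bar> < 1"
  proof -
    have "a\<^sup>2 < 1" using n by (simp add: \<open>b = 0\<close>)
    then show ?thesis by (simp add: abs_square_less_1)
  qed
  ultimately have "1/3 \<le> \<bar>a\<bar>" by (simp add: mult_le_0_iff)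
  then have "a \<in> {-1..-1/3} \<or> a \<in> {1/3..1}" using \<open>\<bar>a\<bar> < 1\<close> by (auto simp: abs_if split: if_splits)
  moreover have "u = of_real a" using \<open>b = 0\<close> u_eq by (simp add: complex_eq_iff)
  ultimately show False using u unfolding slit_disc_def by auto
qed

section \<open>The logarithmic derivative and the continued zeta function\<close>

text \<open>The function \<open>u Z' / Z\<close>, given by the closed form of its power series
  \<open>cyclic_fps\<close>. The factor \<open>u\<close> makes the coefficients the plain numbers of
  cyclic words.\<close>

definition zeta_log_deriv :: "complex \<Rightarrow> complex" where
  "zeta_log_deriv u = (1 - 3 * u\<^sup>2) * (hyp (grid_param u) * inverse (1 + 3 * u\<^sup>2) - inverse (1 - u\<^sup>2))"

lemma hyp_grid_param_holomorphic: "(\<lambda>u. hyp (grid_param u)) holomorphic_on slit_disc"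
  using holomorphic_on_compose_gen[OF grid_param_holomorphic hyp_holomorphic] grid_param_cut_plane
  by (auto simp: comp_def)

lemma zeta_log_deriv_holomorphic: "zeta_log_deriv holomorphic_on slit_disc"
  unfolding zeta_log_deriv_def using slit_disc_nonzero hyp_grid_param_holomorphic
  by (intro holomorphic_intros) auto

lemma zeta_log_deriv_expansion: "zeta_log_deriv has_fps_expansion cyclic_fps"
proof -
  have k: "(\<lambda>u :: complex. 16 * u\<^sup>2 * inverse ((1 + 3 * u\<^sup>2)\<^sup>2)) has_fps_expansion
      16 * fps_X\<^sup>2 * inverse ((1 + 3 * fps_X\<^sup>2)\<^sup>2)"
    by (intro fps_expansion_intros) auto
  have "(hyp \<circ> (\<lambda>u. 16 * u\<^sup>2 * inverse ((1 + 3 * u\<^sup>2)\<^sup>2))) has_fps_expansion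
      (hyp_fps oo (16 * fps_X\<^sup>2 * inverse ((1 + 3 * fps_X\<^sup>2)\<^sup>2)))"
    by (intro has_fps_expansion_compose hyp_has_fps_expansion k) (simp add: fps_mult_nth_0)
  then have h: "(\<lambda>u. hyp (grid_param u)) has_fps_expansion
      (hyp_fps oo (16 * fps_X\<^sup>2 * inverse ((1 + 3 * fps_X\<^sup>2)\<^sup>2)))"
    by (simp add: comp_def grid_param_def divide_inverse)
  show ?thesis
    unfolding zeta_log_deriv_def cyclic_fps_closed_form
    by (intro fps_expansion_intros h) auto
qed

lemma starlike_slit_disc: "starlike slit_disc"
proof -
  have "closed_segment 0 u \<subseteq> slit_disc" if u: "u \<in> slit_disc" for u
  proof
    fix z assume "z \<in> closed_segment 0 u"
    then obtain t where t: "0 \<le> t" "t \<le> 1" and z: "z = of_real t * u"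
      by (auto simp: closed_segment_def scaleR_conv_of_real)
    have nu: "norm u < 1 / sqrt 3" using u by (simp add: slit_disc_def)
    have "norm z \<le> norm u" using t by (simp add: z norm_mult mult_left_le_one_le)
    then have nz: "norm z < 1 / sqrt 3" using nu by simp
    have "1 / sqrt 3 \<le> 1" by simp
    show "z \<in> slit_disc"
    proof (rule ccontr)
      assume "z \<notin> slit_disc"
      then obtain r where r: "z = of_real r" "1/3 \<le> \<bar>r\<bar>" using nz by (auto simp: slit_disc_def)
      then have t0: "t \<noteq> 0" using z by auto
      then have ur: "u = of_real (r / t)" using r z by (simp add: field_simps)
      have "1/3 \<le> \<bar>r\<bar> / t" using r t t0 by (simp add: le_divide_eq)
      then have "1/3 \<le> \<bar>r / t\<bar>" using t by simp
      moreover have "norm u < 1" using nu \<open>1 / sqrt 3 \<le> 1\<close> by linarith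
      then have "\<bar>r / t\<bar> < 1" unfolding ur by (simp only: norm_of_real)
      moreover have "q \<in> {-1..-1/3} \<or> q \<in> {1/3..1}" if "1/3 \<le> \<bar>q\<bar>" "\<bar>q\<bar> < 1" for q :: real
        using that by (auto simp: abs_if split: if_splits)
      ultimately have "r / t \<in> {-1..-1/3} \<or> r / t \<in> {1/3..1}" by blast
      then show False using u unfolding slit_disc_def ur by blast
    qed
  qed
  then show ?thesis unfolding starlike_def using zero_in_slit_disc by blast
qed

text \<open>On the star-shaped slit disc \<open>zeta_log_deriv u / u\<close> has a primitive
  \<open>P\<close>. Normalized by \<open>P 0 = 0\<close>, it has the number of cyclic words divided
  by \<open>n\<close> as its \<open>n\<close>-th coefficient, so its exponential agrees with the
  Euler product near 0.\<close>

theorem zeta_exists: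
  "\<exists>Z. is_grid_zeta Z \<and> Z holomorphic_on slit_disc \<and>
     (\<forall>u\<in>slit_disc. Z u \<noteq> 0 \<and> u * deriv Z u = Z u * zeta_log_deriv u)"
proof -
  \<comment> \<open>The singularity of \<open>zeta_log_deriv u / u\<close> at 0 is removable, since
    the numerator vanishes there.\<close>
  let ?L = "\<lambda>z. if z = 0 then deriv zeta_log_deriv 0 else (zeta_log_deriv z - zeta_log_deriv 0) / (z - 0)"
  have Lhol: "?L holomorphic_on slit_disc"
    by (intro pole_lemma_open zeta_log_deriv_holomorphic open_slit_disc)
  have zld0: "zeta_log_deriv 0 = 0"
    using has_fps_expansion_imp_0_eq_fps_nth_0[OF zeta_log_deriv_expansion] by (simp add: cyclic_fps_def)
  have uL: "u * ?L u = zeta_log_deriv u" for u using zld0 by auto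
  obtain g where g: "\<And>u. u \<in> slit_disc \<Longrightarrow> (g has_field_derivative ?L u) (at u)"
    using holomorphic_starlike_primitive[OF holomorphic_on_imp_continuous_on[OF Lhol] starlike_slit_disc open_slit_disc finite.emptyI]
      holomorphic_on_imp_differentiable_at[OF Lhol open_slit_disc] by auto
  define P where "P = (\<lambda>u. g u - g 0)"
  have P: "(P has_field_derivative ?L u) (at u)" if "u \<in> slit_disc" for u
    unfolding P_def using g[OF that] by (auto intro!: derivative_eq_intros)
  have Phol: "P holomorphic_on slit_disc"
    using P by (auto simp: holomorphic_on_def field_differentiable_def intro: has_field_derivative_at_within)
  define Pf where "Pf = fps_expansion P 0"
  have Pexp: "P has_fps_expansion Pf"
    unfolding Pf_def using Phol open_slit_disc zero_in_slit_disc by (intro has_fps_expansion_fps_expansion)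
  have "(\<lambda>u. u * deriv P u) has_fps_expansion fps_X * fps_deriv Pf"
    by (intro fps_expansion_intros Pexp)
  moreover have "u * deriv P u = zeta_log_deriv u" if "u \<in> slit_disc" for u
    using uL[of u] unfolding DERIV_imp_deriv[OF P[OF that]] .
  then have "\<forall>\<^sub>F u in nhds 0. u * deriv P u = zeta_log_deriv u"
    using eventually_nhds_in_open[OF open_slit_disc zero_in_slit_disc]
    by (rule eventually_mono[rotated])
  ultimately have "zeta_log_deriv has_fps_expansion fps_X * fps_deriv Pf"
    by (subst (asm) has_fps_expansion_cong[OF _ refl])
  then have "fps_X * fps_deriv Pf = cyclic_fps"
    using zeta_log_deriv_expansion by (rule fps_expansion_unique_complex)
  then have c: "fps_nth (fps_X * fps_deriv Pf) n = fps_nth cyclic_fps n" for n by simp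
  have Pf: "fps_nth Pf n = of_nat (card (cyclic_words n 0)) / of_nat n" for n
  proof (cases n)
    case 0
    have "P 0 = 0" by (simp add: P_def)
    then show ?thesis using has_fps_expansion_imp_0_eq_fps_nth_0[OF Pexp] 0 by simp
  next
    case (Suc m)
    have "of_nat (Suc m) * fps_nth Pf (Suc m) = of_nat (card (cyclic_words (Suc m) 0))"
      using c[of "Suc m"] by (simp add: cyclic_fps_def)
    then show ?thesis unfolding Suc by (simp add: field_simps del: of_nat_Suc)
  qed
  define Z where "Z = (\<lambda>u. exp (P u))"
  have Z: "(Z has_field_derivative exp (P u) * ?L u) (at u)" if "u \<in> slit_disc" for u
    unfolding Z_def using P[OF that] by (rule DERIV_fun_exp)
  have Zhol: "Z holomorphic_on slit_disc" unfolding Z_def by (intro holomorphic_intros Phol)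
  have "Z u \<noteq> 0 \<and> u * deriv Z u = Z u * zeta_log_deriv u" if "u \<in> slit_disc" for u
    using DERIV_imp_deriv[OF Z[OF that]] uL[of u] by (simp add: Z_def)
  moreover have "is_grid_zeta Z"
    unfolding is_grid_zeta_def
  proof
    show "Z holomorphic_on grid_zeta_domain"
      using Zhol grid_zeta_domain_subset by (rule holomorphic_on_subset)
    obtain r where r: "0 < r" "ball 0 r \<subseteq> slit_disc"
      using open_slit_disc zero_in_slit_disc open_contains_ball by blast
    have "\<forall>\<^sub>F u in nhds 0. u \<in> ball (0 :: complex) (min r (1/4))"
      using r by (intro eventually_nhds_in_open) auto
    then show "\<forall>\<^sub>F u in nhds 0. has_grid_euler_product u (Z u)"
    proof eventually_elim
      case (elim u)
      have "P holomorphic_on eball 0 (ereal r)" using Phol r by (auto intro: holomorphic_on_subset)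
      then have "(\<lambda>n. fps_nth Pf n * u ^ n) sums P u"
        using elim by (intro has_fps_expansion_imp_sums_complex[OF Pexp, of "ereal r"]) auto
      then have 1: "(\<lambda>n. of_nat (card (cyclic_words n 0)) * u ^ n / of_nat n) sums P u" by (simp add: Pf)
      obtain S where "(\<lambda>n. of_nat (card (cyclic_words n 0)) * u ^ n / of_nat n) sums S" "has_grid_euler_product u (exp S)"
        using grid_euler_product[of u] elim by auto
      then show ?case using sums_unique2[OF 1] by (simp add: Z_def)
    qed
  qed
  ultimately show ?thesis using Zhol by blast
qed

section \<open>Germs of elementary functions\<close>

text \<open>The point \<open>z0\<close> turns functions on \<open>U\<close> into elements of a
  field; connectedness of \<open>U\<close> makes the passage to germs injective on holomorphic
  functions.\<close>

locale germs =
  fixes U :: "complex set" and z0 :: complex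
  assumes open_U: "open U" and connected_U: "connected U" and z0_in: "z0 \<in> U"
    and U_subset: "U \<subseteq> slit_disc"
begin

text \<open>Laurent rather than power series, because germs are to be elements of a field.\<close>

definition germ :: "(complex \<Rightarrow> complex) \<Rightarrow> complex fls \<Rightarrow> bool" where
  "germ f F \<longleftrightarrow> (\<lambda>w. f (z0 + w)) has_laurent_expansion F"

lemma germ_exists: "f holomorphic_on U \<Longrightarrow> \<exists>F. germ f F"
  unfolding germ_def
  by (metis analytic_at_imp_has_fps_expansion analytic_on_holomorphic analytic_on_subset
      empty_subsetI has_laurent_expansion_fps insert_subset open_U z0_in)

lemma germ_unique: "germ f F \<Longrightarrow> germ f G \<Longrightarrow> F = G"
  unfolding germ_def by (rule has_laurent_expansion_unique)

lemma germ_cong: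
  assumes "germ f F" "\<And>z. z \<in> U \<Longrightarrow> f z = g z"
  shows "germ g F"
proof -
  have "eventually (\<lambda>w. w \<in> (\<lambda>w. z0 + w) -` U) (nhds 0)"
    using open_U z0_in by (intro eventually_nhds_in_open open_vimage continuous_intros) auto
  then have "eventually (\<lambda>w. f (z0 + w) = g (z0 + w)) (at 0)"
    unfolding eventually_at_filter by eventually_elim (use assms(2) in auto)
  then show ?thesis using assms(1) unfolding germ_def by (subst (asm) has_laurent_expansion_cong[OF _ refl])
qed

text \<open>The identity theorem on \<open>U\<close>, translated to the origin. It turns functions
  that are not identically zero into nonzero field elements.\<close>

lemma germ_0_imp_zero:
  assumes "germ f 0" "f holomorphic_on U" "z \<in> U"
  shows "f z = 0"
proof -
  have F: "(\<lambda>w. f (z0 + w)) has_fps_expansion 0"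
  proof -
    have an: "f analytic_on {z0}"
      using assms(2) open_U z0_in by (auto simp: analytic_on_open analytic_at)
    then have e: "(\<lambda>w. f (z0 + w)) has_fps_expansion fps_expansion f z0" by (rule analytic_at_imp_has_fps_expansion)
    then have "(\<lambda>w. f (z0 + w)) has_laurent_expansion fps_to_fls (fps_expansion f z0)" by (rule has_laurent_expansion_fps)
    then have "fps_to_fls (fps_expansion f z0) = 0" using assms(1) unfolding germ_def by (rule has_laurent_expansion_unique)
    then show ?thesis using e by simp
  qed
  have h: "(\<lambda>w. f (z0 + w)) holomorphic_on (\<lambda>z. z - z0) ` U"
    by (rule holomorphic_on_compose_gen[of "\<lambda>w. z0 + w" _ f U, unfolded comp_def])
       (auto intro!: holomorphic_intros assms)
  have o: "open ((\<lambda>z. z - z0) ` U)" using open_translation[OF open_U, of "- z0"] by (simp add: add.commute)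
  have c: "connected ((\<lambda>z. z - z0) ` U)" by (intro connected_continuous_image connected_U continuous_intros)
  have "(\<lambda>w. f (z0 + w)) (z - z0) = 0"
    by (rule has_fps_expansion_0_analytic_continuation[OF F h o c]) (use z0_in assms(3) in auto)
  then show ?thesis by simp
qed

lemma germ_deriv:
  assumes "germ f F"
  shows "germ (deriv f) (fls_deriv F)"
proof -
  have "deriv (\<lambda>w. f (z0 + w)) = (\<lambda>w. deriv f (z0 + w))"
    by (rule ext) (simp add: deriv_def DERIV_shift add.commute[of z0])
  then show ?thesis using has_laurent_expansion_deriv[OF assms[unfolded germ_def]] by (simp add: germ_def)
qed

lemma germ_const: "germ (\<lambda>z. c) (fls_const c)"
  unfolding germ_def by (intro laurent_expansion_intros)

lemma germ_numeral: "germ (\<lambda>z. numeral n) (numeral n)"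
  unfolding germ_def by (intro laurent_expansion_intros)

lemma germ_1: "germ (\<lambda>z. 1) 1"
  unfolding germ_def by (intro laurent_expansion_intros)

lemma germ_add: "germ f F \<Longrightarrow> germ g G \<Longrightarrow> germ (\<lambda>z. f z + g z) (F + G)"
  unfolding germ_def by (intro laurent_expansion_intros)

lemma germ_diff: "germ f F \<Longrightarrow> germ g G \<Longrightarrow> germ (\<lambda>z. f z - g z) (F - G)"
  unfolding germ_def by (intro laurent_expansion_intros)

lemma germ_mult: "germ f F \<Longrightarrow> germ g G \<Longrightarrow> germ (\<lambda>z. f z * g z) (F * G)"
  unfolding germ_def by (intro laurent_expansion_intros)

lemma germ_divide: "germ f F \<Longrightarrow> germ g G \<Longrightarrow> germ (\<lambda>z. f z / g z) (F / G)"
  unfolding germ_def by (intro laurent_expansion_intros)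

lemma germ_power: "germ f F \<Longrightarrow> germ (\<lambda>z. f z ^ n) (F ^ n)"
  unfolding germ_def by (intro laurent_expansion_intros)

lemma germ_sum: "(\<And>i. i \<in> I \<Longrightarrow> germ (f i) (F i)) \<Longrightarrow> germ (\<lambda>z. \<Sum>i\<in>I. f i z) (\<Sum>i\<in>I. F i)"
  unfolding germ_def by (intro laurent_expansion_intros)

lemmas germ_intros = germ_const germ_numeral germ_1 germ_add germ_diff germ_mult germ_divide germ_power

lemma germ_eqD:
  assumes "germ f F" "germ g G" "\<And>z. z \<in> U \<Longrightarrow> f z = g z"
  shows "F = G"
  using germ_unique[OF germ_cong[OF assms(1)] assms(2)] assms(3) by blast

definition \<zeta> :: "complex fls" where "\<zeta> = fls_const z0 + fls_X"
definition \<kappa> :: "complex fls" where "\<kappa> = 16 * \<zeta>\<^sup>2 / (1 + 3 * \<zeta>\<^sup>2)\<^sup>2"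
text \<open>Differentiation with respect to \<open>k\<close> instead of \<open>u\<close>, so that
  the hypergeometric equation keeps its polynomial coefficients.\<close>

definition d :: "complex fls \<Rightarrow> complex fls" where "d F = fls_deriv F / fls_deriv \<kappa>"

lemma germ_var: "germ (\<lambda>z. z) \<zeta>"
  unfolding germ_def \<zeta>_def by (intro laurent_expansion_intros)

lemma germ_param: "germ grid_param \<kappa>"
  unfolding grid_param_def \<kappa>_def by (intro germ_intros germ_var)

lemma deriv_\<zeta>: "fls_deriv \<zeta> = 1"
  by (simp add: \<zeta>_def)

lemma \<zeta>_nonzero: "\<zeta> \<noteq> 0"
  using deriv_\<zeta> by auto

lemma quad_nonzero:
  assumes "c \<noteq> 0"
  shows "1 + fls_const c * \<zeta>\<^sup>2 \<noteq> 0"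
proof
  assume "1 + fls_const c * \<zeta>\<^sup>2 = 0"
  from arg_cong[OF this, of fls_deriv] have "fls_const c * (2 * \<zeta>) = 0"
    by (simp add: deriv_\<zeta> power2_eq_square)
  then show False using assms \<zeta>_nonzero by simp
qed

lemma \<kappa>_eq: "\<kappa> * (1 + 3 * \<zeta>\<^sup>2)\<^sup>2 = 16 * \<zeta>\<^sup>2"
  using quad_nonzero[of 3] by (simp add: \<kappa>_def)

text \<open>For constant \<open>\<kappa>\<close>, differentiating \<open>\<kappa>_eq\<close> and
  cancelling \<open>\<zeta>\<close> leaves an equation whose derivative gives
  \<open>\<kappa> * \<zeta> = 0\<close>, hence \<open>\<kappa> = 0\<close> and a
  contradiction.\<close>

lemma deriv_\<kappa>_nonzero: "fls_deriv \<kappa> \<noteq> 0"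
proof
  assume 0: "fls_deriv \<kappa> = 0"
  from arg_cong[OF \<kappa>_eq, of fls_deriv]
  have "\<zeta> * (\<kappa> * (1 + 3 * \<zeta>\<^sup>2) * 12) = \<zeta> * 32"
    by (simp add: 0 deriv_\<zeta> power2_eq_square algebra_simps)
  then have e: "\<kappa> * (1 + 3 * \<zeta>\<^sup>2) * 12 = 32" using \<zeta>_nonzero by simp
  from arg_cong[OF this, of fls_deriv] have "\<kappa> * \<zeta> = 0"
    by (simp add: 0 deriv_\<zeta> power2_eq_square)
  then show False using e \<zeta>_nonzero by simp
qed

lemma d_eq_0_iff: "d c = 0 \<longleftrightarrow> c \<in> range fls_const"
  using deriv_\<kappa>_nonzero by (auto simp: d_def fls_deriv_eq_0_iff)

lemma derivation_d: "derivation_on UNIV d"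
  by (auto simp: derivation_on_def d_def add_divide_distrib)

sublocale DF: differential_field d
proof
  fix c assume "d c = 0"
  then obtain a where "c = fls_const a" by (auto simp: d_eq_0_iff)
  moreover have "csqrt a * csqrt a = a" by (metis power2_csqrt power2_eq_square)
  ultimately have "(fls_const (csqrt a))\<^sup>2 = c" by (simp add: power2_eq_square)
  then show "\<exists>b. b\<^sup>2 = c" by blast
qed (rule derivation_d)

sublocale FD: fls_derivation d \<kappa>
proof
  show "d \<kappa> = 1" using deriv_\<kappa>_nonzero by (simp add: d_def)
qed (rule derivation_d, simp add: d_def)

definition base_field :: "complex fls set" where
  "base_field = alg_cl (adjoin (range fls_const) \<kappa>)"

lemma subfield_const: "subfield_set (range (fls_const :: complex \<Rightarrow> complex fls))"
proof
  show "(1 :: complex fls) \<in> range fls_const" by (metis fls_const_1 rangeI)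
  fix x y :: "complex fls" assume "x \<in> range fls_const" "y \<in> range fls_const"
  then obtain a b where ab: "x = fls_const a" "y = fls_const b" by auto
  show "x - y \<in> range fls_const" by (simp add: ab fls_minus_const)
  show "x * y \<in> range fls_const" by (simp add: ab)
next
  fix x :: "complex fls" assume "x \<in> range fls_const"
  then obtain a where a: "x = fls_const a" by auto
  then have "inverse x = fls_const (inverse a)"
    by (cases "a = 0") (auto intro!: inverse_unique)
  then show "inverse x \<in> range fls_const" by simp
qed

lemma closed_base_field: "DF.closed_dfield base_field"
  unfolding base_field_def
proof (rule DF.closed_dfield_acl)
  interpret C: subfield_set "range (fls_const :: complex \<Rightarrow> complex fls)" by (rule subfield_const)
  interpret K: subfield_set "adjoin (range fls_const) \<kappa>" by (rule C.subfield_adj)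
  show "subfield_set (adjoin (range fls_const) \<kappa>)" by (rule C.subfield_adj)
  show "d x \<in> adjoin (range fls_const) \<kappa>" if "x \<in> adjoin (range fls_const) \<kappa>" for x
    by (rule C.derivation_in_adj[OF DF.derivation_d_on C.subfield_adj subset_refl _ _ that])
       (auto simp: FD.d_const FD.d_gen K.zero_in K.one_in)
  show "{c. d c = 0} \<subseteq> alg_cl (adjoin (range fls_const) \<kappa>)"
    using C.base_subset_adj[of \<kappa>] K.base_subset_acl by (auto simp: d_eq_0_iff)
qed

abbreviation "tower T \<equiv> DF.liouville_tower base_field T"

lemma tower_props:
  assumes "tower T"
  shows "subfield_set T" "\<And>x. x \<in> T \<Longrightarrow> d x \<in> T" "alg_cl T = T" "range fls_const \<subseteq> T" "base_field \<subseteq> T"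
  using DF.liouville_tower_closed[OF assms closed_base_field]
  unfolding DF.closed_dfield_def by (auto simp: d_eq_0_iff)

lemma \<kappa>_in_base: "\<kappa> \<in> base_field"
proof -
  interpret C: subfield_set "range (fls_const :: complex \<Rightarrow> complex fls)" by (rule subfield_const)
  show ?thesis unfolding base_field_def
    using C.gen_in_adj subfield_set.base_subset_acl[OF C.subfield_adj] by blast
qed

text \<open>Expanding \<open>\<kappa>_eq\<close> gives a quartic equation for \<open>u\<close> over
  \<complex>(k). So the tower can start from \<open>k\<close> although elementary functions are
  built from \<open>u\<close>.\<close>

lemma \<zeta>_in_base: "\<zeta> \<in> base_field"
proof -
  interpret B: subfield_set base_field using tower_props(1)[OF DF.liouville_tower.base] .
  let ?p = "[:\<kappa>, 0, 6 * \<kappa> - 16, 0, 9 * \<kappa>:]"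
  have "?p \<in> polys base_field"
    by (intro B.polys_pCons B.polys_0 B.closed_in \<kappa>_in_base)
  moreover have "?p \<noteq> 0"
    using \<kappa>_eq \<zeta>_nonzero by auto
  moreover have "poly ?p \<zeta> = \<kappa> * (1 + 3 * \<zeta>\<^sup>2)\<^sup>2 - 16 * \<zeta>\<^sup>2"
    by (simp add: power2_eq_square algebra_simps)
  then have "poly ?p \<zeta> = 0" by (simp add: \<kappa>_eq)
  ultimately have "\<zeta> \<in> alg_cl base_field" unfolding alg_cl_def by blast
  then show ?thesis using tower_props(3)[OF DF.liouville_tower.base] by simp
qed

lemma deriv_\<kappa>_in_base: "fls_deriv \<kappa> \<in> base_field"
proof -
  interpret B: subfield_set base_field using tower_props(1)[OF DF.liouville_tower.base] .
  have "inverse (fls_deriv \<kappa>) = d \<zeta>" by (simp add: d_def deriv_\<zeta> divide_inverse)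
  then have "inverse (fls_deriv \<kappa>) \<in> base_field"
    using tower_props(2)[OF DF.liouville_tower.base \<zeta>_in_base] by simp
  then show ?thesis using B.inverse_in by fastforce
qed

section \<open>Elementary functions lie in Liouville towers\<close>

lemma elementary_holomorphic: "f \<in> elementary_on U \<Longrightarrow> f holomorphic_on U"
  by (induction rule: elementary_on.induct) (auto intro!: holomorphic_intros)

lemma tower_step:
  assumes "tower T" "a \<in> T" "d t = a \<or> d t = a * t"
  shows "\<exists>T'. tower T' \<and> T \<subseteq> T' \<and> t \<in> T'"
proof -
  have c: "DF.closed_dfield T" using DF.liouville_tower_closed[OF assms(1) closed_base_field] by simp
  have ex: "\<exists>a\<in>T. d t = a \<or> d t = a * t" using assms by blast
  show ?thesis
    using DF.liouville_tower.step[OF assms(1) ex] DF.closed_dfield_step[OF c ex] by blast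
qed

text \<open>Quantifying over the tower \<open>T\<close> to start from allows towers to be stacked:
  the one for a second function is built on top of the one for the first.\<close>

definition in_tower :: "(complex \<Rightarrow> complex) \<Rightarrow> bool" where
  "in_tower f \<longleftrightarrow> (\<forall>T. tower T \<longrightarrow> (\<exists>T' F. tower T' \<and> T \<subseteq> T' \<and> germ f F \<and> F \<in> T'))"

lemma in_towerD:
  assumes "in_tower f" "tower T"
  obtains T' F where "tower T'" "T \<subseteq> T'" "germ f F" "F \<in> T'"
  using assms unfolding in_tower_def by blast

lemma in_tower_binary:
  assumes fg: "in_tower f" "in_tower g"
    and germ: "\<And>F G. germ f F \<Longrightarrow> germ g G \<Longrightarrow> germ h (c F G)"
    and closed: "\<And>T F G. subfield_set T \<Longrightarrow> F \<in> T \<Longrightarrow> G \<in> T \<Longrightarrow> c F G \<in> T"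
  shows "in_tower h"
  unfolding in_tower_def
proof (intro allI impI)
  fix T assume T: "tower T"
  obtain T1 F where 1: "tower T1" "T \<subseteq> T1" "germ f F" "F \<in> T1" using fg(1) T by (rule in_towerD)
  obtain T2 G where 2: "tower T2" "T1 \<subseteq> T2" "germ g G" "G \<in> T2" using fg(2) 1(1) by (rule in_towerD)
  have "c F G \<in> T2" using closed[OF tower_props(1)[OF 2(1)]] 1 2 by blast
  then show "\<exists>T' H. tower T' \<and> T \<subseteq> T' \<and> germ h H \<and> H \<in> T'"
    using 1 2 germ[OF 1(3) 2(3)] by blast
qed

text \<open>The clauses of \<open>elementary_on\<close> match the tower: field operations and
  algebraic functions stay in a relatively closed field, while an exponential or logarithm is a new
  generator.\<close>

lemma elementary_in_tower: "f \<in> elementary_on U \<Longrightarrow> in_tower f"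
proof (induction rule: elementary_on.induct)
  case var
  then show ?case unfolding in_tower_def using germ_var \<zeta>_in_base tower_props(5) by blast
next
  case (const c)
  then show ?case unfolding in_tower_def using germ_const tower_props(4) by blast
next
  case (add f g)
  show ?case by (rule in_tower_binary[OF add.IH germ_add subfield_set.add_in])
next
  case (diff f g)
  show ?case by (rule in_tower_binary[OF diff.IH germ_diff subfield_set.diff_in])
next
  case (mult f g)
  show ?case by (rule in_tower_binary[OF mult.IH germ_mult subfield_set.mult_in])
next
  case (divide f g)
  show ?case by (rule in_tower_binary[OF divide.IH germ_divide subfield_set.divide_in])
next
  case (algebraic n a g)
  show ?case
    unfolding in_tower_def
  proof (intro allI impI)
    fix T assume T: "tower T"
    \<comment> \<open>The germs of the coefficients are collected one by one into a single
      tower.\<close>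
    have "\<exists>T' A. tower T' \<and> T \<subseteq> T' \<and> (\<forall>i<m. germ (a i) (A i) \<and> A i \<in> T')" if "m \<le> Suc n" for m
      using that
    proof (induction m)
      case 0
      then show ?case using T by blast
    next
      case (Suc m)
      then obtain T1 A where 1: "tower T1" "T \<subseteq> T1" "\<forall>i<m. germ (a i) (A i) \<and> A i \<in> T1" by auto
      have "in_tower (a m)" using algebraic.IH[of m] Suc.prems by simp
      then obtain T2 F where 2: "tower T2" "T1 \<subseteq> T2" "germ (a m) F" "F \<in> T2"
        using 1(1) by (rule in_towerD)
      have "\<forall>i<Suc m. germ (a i) ((A(m := F)) i) \<and> (A(m := F)) i \<in> T2"
        using 1 2 by (auto simp: less_Suc_eq)
      then show ?case using 1 2 by blast
    qed
    from this[of "Suc n"] obtain T' A where T': "tower T'" "T \<subseteq> T'"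
      and A: "\<And>i. i \<le> n \<Longrightarrow> germ (a i) (A i)" "\<And>i. i \<le> n \<Longrightarrow> A i \<in> T'"
      by (auto simp: less_Suc_eq_le)
    interpret T': subfield_set T' using tower_props(1)[OF T'(1)] .
    obtain G where G: "germ g G" using germ_exists[OF algebraic.hyps(3)] by blast
    define p where "p = (\<Sum>i\<le>n. monom (A i) i)"
    have cp: "coeff p i = (if i \<le> n then A i else 0)" for i by (simp add: p_def coeff_sum)
    \<comment> \<open>The leading coefficient is nonzero somewhere in \<open>U\<close>, perhaps not
      at \<open>z0\<close>; the identity theorem still makes its germ nonzero.\<close>
    have "A n \<noteq> 0"
    proof
      assume "A n = 0"
      then have "germ (a n) 0" using A(1)[of n] by simp
      then show False
        using germ_0_imp_zero[of "a n"] elementary_holomorphic[OF algebraic.hyps(1)[of n]] algebraic.hyps(2) by auto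
    qed
    then have "p \<noteq> 0" using cp[of n] by auto
    moreover have "p \<in> polys T'" using A(2) by (auto simp: polys_def cp T'.zero_in)
    moreover have "poly p G = 0"
    proof -
      have "germ (\<lambda>z. \<Sum>i\<le>n. a i z * g z ^ i) (\<Sum>i\<le>n. A i * G ^ i)"
        using A G by (intro germ_sum germ_mult germ_power) auto
      then have "(\<Sum>i\<le>n. A i * G ^ i) = fls_const 0"
        using germ_const[of 0] by (rule germ_eqD) (use algebraic.hyps(4) in auto)
      then show ?thesis by (simp add: p_def poly_sum poly_monom)
    qed
    ultimately have "G \<in> alg_cl T'" unfolding alg_cl_def by blast
    then have "G \<in> T'" using tower_props(3)[OF T'(1)] by simp
    then show "\<exists>T' F. tower T' \<and> T \<subseteq> T' \<and> germ g F \<and> F \<in> T'" using T' G by blast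
  qed
next
  case (exp f)
  show ?case
    unfolding in_tower_def
  proof (intro allI impI)
    fix T assume T: "tower T"
    obtain T1 F where 1: "tower T1" "T \<subseteq> T1" "germ f F" "F \<in> T1" using exp.IH T by (rule in_towerD)
    have fh: "f holomorphic_on U" using elementary_holomorphic exp.hyps by blast
    then obtain G where G: "germ (\<lambda>z. exp (f z)) G" using germ_exists holomorphic_on_exp' by blast
    have "fls_deriv G = G * fls_deriv F"
    proof (rule germ_eqD[OF germ_deriv[OF G] germ_mult[OF G germ_deriv[OF 1(3)]]])
      fix z assume "z \<in> U"
      then have "(f has_field_derivative deriv f z) (at z)"
        using fh open_U holomorphic_derivI by blast
      then show "deriv (\<lambda>z. exp (f z)) z = exp (f z) * deriv f z"
        by (intro DERIV_imp_deriv DERIV_fun_exp)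
    qed
    then have "d G = d F * G" by (simp add: d_def)
    moreover have "d F \<in> T1" using tower_props(2)[OF 1(1) 1(4)] .
    ultimately obtain T2 where "tower T2" "T1 \<subseteq> T2" "G \<in> T2" using tower_step[OF 1(1)] by blast
    then show "\<exists>T' H. tower T' \<and> T \<subseteq> T' \<and> germ (\<lambda>z. exp (f z)) H \<and> H \<in> T'" using 1 G by blast
  qed
next
  case (log f g)
  show ?case
    unfolding in_tower_def
  proof (intro allI impI)
    fix T assume T: "tower T"
    obtain T1 F where 1: "tower T1" "T \<subseteq> T1" "germ f F" "F \<in> T1" using log.IH T by (rule in_towerD)
    have fh: "f holomorphic_on U" using elementary_holomorphic log.hyps by blast
    obtain G where G: "germ g G" using germ_exists log.hyps by blast
    have "fls_deriv F = F * fls_deriv G"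
    proof (rule germ_eqD[OF germ_deriv[OF 1(3)] germ_mult[OF 1(3) germ_deriv[OF G]]])
      fix z assume z: "z \<in> U"
      then have "(g has_field_derivative deriv g z) (at z)"
        using log.hyps open_U holomorphic_derivI by blast
      then have "((\<lambda>z. exp (g z)) has_field_derivative exp (g z) * deriv g z) (at z)" by (rule DERIV_fun_exp)
      then have "(f has_field_derivative exp (g z) * deriv g z) (at z)"
        by (rule has_field_derivative_transform_within_open[OF _ open_U z]) (use log.hyps in auto)
      then show "deriv f z = f z * deriv g z" using log.hyps z by (simp add: DERIV_imp_deriv)
    qed
    moreover have "F \<noteq> 0"
    proof
      assume "F = 0"
      then have "f z0 = 0" using germ_0_imp_zero[of f z0] 1(3) fh z0_in by simp
      then show False using log.hyps z0_in by (metis exp_not_eq_zero)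
    qed
    ultimately have "d G = d F / F" by (simp add: d_def)
    moreover have "d F / F \<in> T1"
      using tower_props(2)[OF 1(1) 1(4)] 1(4) subfield_set.divide_in[OF tower_props(1)[OF 1(1)]] by blast
    ultimately obtain T2 where "tower T2" "T1 \<subseteq> T2" "G \<in> T2" using tower_step[OF 1(1)] by blast
    then show "\<exists>T' F. tower T' \<and> T \<subseteq> T' \<and> germ g F \<and> F \<in> T'" using 1 G by blast
  qed
qed

text \<open>The chain rule: under composition with \<open>grid_param\<close>, differentiation in the
  cut plane becomes \<open>d\<close>.\<close>

lemma germ_compose_param:
  assumes "f holomorphic_on cut_plane" "germ (\<lambda>u. f (grid_param u)) F"
  shows "germ (\<lambda>u. deriv f (grid_param u)) (d F)"
proof -
  have fh: "(\<lambda>u. deriv f (grid_param u)) holomorphic_on U"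
    using holomorphic_on_compose_gen[OF grid_param_holomorphic holomorphic_deriv[OF assms(1) open_cut_plane]]
      grid_param_cut_plane holomorphic_on_subset[OF _ U_subset] by (auto simp: comp_def)
  then obtain G where G: "germ (\<lambda>u. deriv f (grid_param u)) G" using germ_exists by blast
  have "fls_deriv F = G * fls_deriv \<kappa>"
  proof (rule germ_eqD[OF germ_deriv[OF assms(2)] germ_mult[OF G germ_deriv[OF germ_param]]])
    fix u assume "u \<in> U"
    then have u: "u \<in> slit_disc" using U_subset by blast
    have "(grid_param has_field_derivative deriv grid_param u) (at u)"
      using grid_param_holomorphic open_slit_disc u holomorphic_derivI by blast
    moreover have "(f has_field_derivative deriv f (grid_param u)) (at (grid_param u))"
      using assms(1) open_cut_plane grid_param_cut_plane[OF u] holomorphic_derivI by blast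
    ultimately show "deriv (\<lambda>u. f (grid_param u)) u = deriv f (grid_param u) * deriv grid_param u"
      by (intro DERIV_imp_deriv DERIV_chain2)
  qed
  then have "d F = G" using deriv_\<kappa>_nonzero by (simp add: d_def)
  then show ?thesis using G by simp
qed

text \<open>The logarithmic derivative of \<open>Z\<close> stays in the tower and is affine in
  \<open>hyp (grid_param u)\<close> over the rational functions of \<open>u\<close>. So the germ
  \<open>Y\<close> of the elliptic integral lies in the tower, and \<open>d Y / Y\<close> is a
  solution of the Riccati equation to which the descent applies.\<close>

theorem grid_zeta_not_elementary:
  assumes Z: "Z holomorphic_on slit_disc"
    "\<And>u. u \<in> slit_disc \<Longrightarrow> Z u \<noteq> 0 \<and> u * deriv Z u = Z u * zeta_log_deriv u"
    and f: "f \<in> elementary_on U" "\<And>u. u \<in> U \<Longrightarrow> f u = Z u"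
  shows False
proof -
  obtain T E where T: "tower T" "germ f E" "E \<in> T"
    using elementary_in_tower[OF f(1)] DF.liouville_tower.base by (rule in_towerD)
  have gZ: "germ Z E" using germ_cong[OF T(2)] f(2) by blast
  interpret T: subfield_set T using tower_props(1)[OF T(1)] .
  have hU: "(\<lambda>u. hyp (grid_param u)) holomorphic_on U"
    using hyp_grid_param_holomorphic U_subset by (rule holomorphic_on_subset)
  then obtain Y where Y: "germ (\<lambda>u. hyp (grid_param u)) Y" using germ_exists by blast
  have E0: "E \<noteq> 0"
  proof
    assume "E = 0"
    then have "Z z0 = 0"
      using germ_0_imp_zero[of Z z0] gZ holomorphic_on_subset[OF Z(1) U_subset] z0_in by simp
    then show False using Z(2) z0_in U_subset by blast
  qed
  have q3: "1 - 3 * \<zeta>\<^sup>2 \<noteq> 0" and q1: "1 - \<zeta>\<^sup>2 \<noteq> 0" using quad_nonzero[of "-3"] quad_nonzero[of "-1"] by simp_all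
  have rel: "\<zeta> * fls_deriv E * ((1 + 3 * \<zeta>\<^sup>2) * (1 - \<zeta>\<^sup>2))
      = E * ((1 - 3 * \<zeta>\<^sup>2) * (Y * (1 - \<zeta>\<^sup>2) - (1 + 3 * \<zeta>\<^sup>2)))"
  proof (rule germ_eqD)
    show "germ (\<lambda>u. u * deriv Z u * ((1 + 3 * u\<^sup>2) * (1 - u\<^sup>2))) (\<zeta> * fls_deriv E * ((1 + 3 * \<zeta>\<^sup>2) * (1 - \<zeta>\<^sup>2)))"
      by (intro germ_intros germ_var germ_deriv gZ)
    show "germ (\<lambda>u. Z u * ((1 - 3 * u\<^sup>2) * (hyp (grid_param u) * (1 - u\<^sup>2) - (1 + 3 * u\<^sup>2))))
        (E * ((1 - 3 * \<zeta>\<^sup>2) * (Y * (1 - \<zeta>\<^sup>2) - (1 + 3 * \<zeta>\<^sup>2))))"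
      by (intro germ_intros germ_var Y gZ)
    fix u assume "u \<in> U"
    then have u: "u \<in> slit_disc" using U_subset by blast
    note nz = slit_disc_nonzero(1,2)[OF u]
    have "u * deriv Z u * ((1 + 3 * u\<^sup>2) * (1 - u\<^sup>2))
        = Z u * (zeta_log_deriv u * ((1 + 3 * u\<^sup>2) * (1 - u\<^sup>2)))" using Z(2)[OF u] by simp
    also have "zeta_log_deriv u * ((1 + 3 * u\<^sup>2) * (1 - u\<^sup>2))
        = (1 - 3 * u\<^sup>2) * (hyp (grid_param u) * (1 - u\<^sup>2) - (1 + 3 * u\<^sup>2))"
    proof -
      have "c * (y * inverse p - inverse q) * (p * q) = c * (y * q - p)" if "p \<noteq> 0" "q \<noteq> 0" for c y p q :: complex
        using that by (simp add: field_simps)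
      from this[OF nz] show ?thesis unfolding zeta_log_deriv_def .
    qed
    finally show "u * deriv Z u * ((1 + 3 * u\<^sup>2) * (1 - u\<^sup>2))
        = Z u * ((1 - 3 * u\<^sup>2) * (hyp (grid_param u) * (1 - u\<^sup>2) - (1 + 3 * u\<^sup>2)))" .
  qed
  have "fls_deriv E = d E * fls_deriv \<kappa>" using deriv_\<kappa>_nonzero by (simp add: d_def)
  then have dE: "fls_deriv E \<in> T"
    using tower_props(2)[OF T(1,3)] tower_props(5)[OF T(1)] deriv_\<kappa>_in_base T.mult_in by auto
  have \<zeta>T: "\<zeta> \<in> T" using \<zeta>_in_base tower_props(5)[OF T(1)] by blast
  \<comment> \<open>The relation is affine in \<open>Y\<close>, and the divisors \<open>E\<close>,
    \<open>1 - 3 * \<zeta>\<^sup>2\<close> and \<open>1 - \<zeta>\<^sup>2\<close> are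
    nonzero.\<close>
  have "Y = (\<zeta> * fls_deriv E * ((1 + 3 * \<zeta>\<^sup>2) * (1 - \<zeta>\<^sup>2)) / (E * (1 - 3 * \<zeta>\<^sup>2)) + (1 + 3 * \<zeta>\<^sup>2)) / (1 - \<zeta>\<^sup>2)"
    unfolding rel using E0 q3 q1 by simp
  then have YT: "Y \<in> T" using dE \<zeta>T T(3) by (auto intro!: T.closed_in)
  \<comment> \<open>A vanishing germ would propagate from \<open>U\<close> over the connected slit
    disc to \<open>u = 0\<close>, where \<open>hyp 0 = 1\<close>.\<close>
  have Y0: "Y \<noteq> 0"
  proof
    assume "Y = 0"
    then have z: "hyp (grid_param u) = 0" if "u \<in> U" for u
      using germ_0_imp_zero[of "\<lambda>u. hyp (grid_param u)" u] Y hU that by simp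
    have "hyp (grid_param 0) = 0"
    proof (rule analytic_continuation_open[where s = U and s' = slit_disc and f = "\<lambda>u. hyp (grid_param u)" and g = "\<lambda>_. 0"])
      show "connected slit_disc" using starlike_slit_disc by (rule starlike_imp_connected)
    qed (use open_U open_slit_disc z0_in U_subset hyp_grid_param_holomorphic z zero_in_slit_disc in auto)
    then show False by (simp add: grid_param_def hyp_0)
  qed
  have g1: "germ (\<lambda>u. deriv hyp (grid_param u)) (d Y)"
    by (rule germ_compose_param[OF hyp_holomorphic Y])
  have g2: "germ (\<lambda>u. deriv (deriv hyp) (grid_param u)) (d (d Y))"
    by (rule germ_compose_param[OF holomorphic_deriv[OF hyp_holomorphic open_cut_plane] g1])
  have ode: "\<kappa> * (1 - \<kappa>) * d (d Y) + (1 - 2 * \<kappa>) * d Y - Y / 4 = fls_const 0"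
  proof (rule germ_eqD)
    show "germ (\<lambda>u. grid_param u * (1 - grid_param u) * deriv (deriv hyp) (grid_param u)
        + (1 - 2 * grid_param u) * deriv hyp (grid_param u) - hyp (grid_param u) / 4)
        (\<kappa> * (1 - \<kappa>) * d (d Y) + (1 - 2 * \<kappa>) * d Y - Y / 4)"
      by (intro germ_intros germ_param g1 g2 Y)
    show "germ (\<lambda>_. 0) (fls_const 0)" by (rule germ_const)
  qed (use hyp_ode grid_param_cut_plane U_subset in auto)
  define w where "w = d Y / Y"
  have dY: "d Y = w * Y" using Y0 by (simp add: w_def)
  have ddY: "d (d Y) = (d w + w\<^sup>2) * Y"
    unfolding dY by (simp add: DF.U.der_mult dY power2_eq_square algebra_simps)
  have ab: "ev \<kappa> legendre_a = \<kappa> * (1 - \<kappa>)" "ev \<kappa> legendre_b = 1 - 2 * \<kappa>"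
    by (simp_all add: legendre_a_def legendre_b_def algebra_simps)
  have a0: "ev \<kappa> legendre_a \<noteq> 0" by (simp only: FD.ev_eq_0_iff) (simp add: legendre_a_def)
  have q: "fls_const (1/4) = (1/4 :: complex fls)"
    using fls_const_divide_const[of "1 :: complex" 4] by simp
  have iff: "DF.riccati (ev \<kappa> legendre_b / ev \<kappa> legendre_a) (- fls_const (1/4) / ev \<kappa> legendre_a) w
      \<longleftrightarrow> FD.legendre_riccati w" for w
  proof -
    have "ev \<kappa> legendre_a * (d w + w\<^sup>2 + ev \<kappa> legendre_b / ev \<kappa> legendre_a * w + - fls_const (1/4) / ev \<kappa> legendre_a)
        = ev \<kappa> legendre_a * (d w + w\<^sup>2) + ev \<kappa> legendre_b * w - fls_const (1/4)"
    proof -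
      have "A * (D + B / A * w + - C / A) = A * D + B * w - C" if "A \<noteq> 0" for A B C D :: "complex fls"
        using that by (simp add: distrib_left right_diff_distrib)
      from this[OF a0] show ?thesis .
    qed
    then show ?thesis unfolding DF.riccati_def FD.legendre_riccati_def using a0 by (metis mult_eq_0_iff)
  qed
  have "Y * (ev \<kappa> legendre_a * (d w + w\<^sup>2) + ev \<kappa> legendre_b * w - fls_const (1/4)) = 0"
    using ode unfolding ddY unfolding dY ab q by (simp add: algebra_simps)
  then have "FD.legendre_riccati w" using Y0 unfolding FD.legendre_riccati_def by simp
  moreover have "w \<in> T" unfolding w_def using YT tower_props(2)[OF T(1) YT] by (rule T.divide_in[rotated])
  moreover have "ev \<kappa> legendre_b / ev \<kappa> legendre_a \<in> base_field" "- fls_const (1/4) / ev \<kappa> legendre_a \<in> base_field"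
  proof -
    interpret B: subfield_set base_field using tower_props(1)[OF DF.liouville_tower.base] .
    have "fls_const (1/4) \<in> base_field" using tower_props(4)[OF DF.liouville_tower.base] by blast
    then show "ev \<kappa> legendre_b / ev \<kappa> legendre_a \<in> base_field" "- fls_const (1/4) / ev \<kappa> legendre_a \<in> base_field"
      unfolding ab by (auto intro!: B.closed_in \<kappa>_in_base)
  qed
  ultimately obtain w' where "w' \<in> base_field" "FD.legendre_riccati w'"
    using DF.riccati_tower_descent[OF T(1) closed_base_field, of _ _ w] iff by blast
  then show False using FD.no_algebraic_riccati_solution unfolding base_field_def by blast
qed

end

theorem theorem2:
  shows "\<not> elementary_function grid_zeta_domain grid_zeta"
proof
  assume "elementary_function grid_zeta_domain grid_zeta"
  then obtain U where U: "open U" "connected U" "U \<noteq> {}" "U \<subseteq> grid_zeta_domain" "grid_zeta \<in> elementary_on U"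
    unfolding elementary_function_def by blast
  then obtain z0 where z0: "z0 \<in> U" by blast
  interpret germs U z0
    using U z0 grid_zeta_domain_subset by unfold_locales auto
  obtain Z where Z: "is_grid_zeta Z" "Z holomorphic_on slit_disc"
    "\<forall>u\<in>slit_disc. Z u \<noteq> 0 \<and> u * deriv Z u = Z u * zeta_log_deriv u"
    using zeta_exists by blast
  \<comment> \<open>Existence of \<open>Z\<close> makes the choice in \<open>grid_zeta\<close>
    meaningful; uniqueness on \<open>grid_zeta_domain\<close> then identifies the two functions on
    \<open>U\<close>.\<close>
  have "is_grid_zeta grid_zeta" 
    unfolding grid_zeta_def using someI[of is_grid_zeta, OF Z(1)] .
  then have "grid_zeta u = Z u" if "u \<in> U" for u
    using is_grid_zeta_unique Z(1) that U(4) by blast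
  then show False using grid_zeta_not_elementary[OF Z(2) _ U(5)] Z(3) by blast
qed

end
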